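(* Let $m\geq 1$ be an integer. A topological space $X$ is homeomorphic to $\mathrm{Spec}(\mathrm{Free}(m,k))$ for some cardinal $k$ if and only if it is $m$-fan based.
   Context: An ideal of an MV-algebra $(A,\oplus,0,\neg)$ is a nonempty downward closed subset closed under $\oplus$; an ideal $P\neq A$ is prime if $x\wedge y\in P$ implies $x\in P$ or $y\in P$. $\mathrm{Spec}(A)$ is the set of prime ideals with the Zariski topology generated by the open sets $\{P : a\notin P\}$, $a\in A$. For an $\ell$-group $G$ with strong unit $u$, $\Gamma(G,u)$ is the MV-algebra on $[0,u]$ with $a\oplus b=(a+b)\wedge u$, $\neg a=u-a$. $K_m=\Gamma(\mathbb Z\ \mathrm{lex}\ \mathbb Z,(m,0))$ is the $m$-th Komori chain (lex is the lexicographic product), $\mathbb V(K_m)$ is the variety of MV-algebras it generates, and $\mathrm{Free}(m,k)$ is the free algebra in $\mathbb V(K_m)$ over $k$ generators. $\Delta_m(\mathbb R)=\Gamma(\mathbb Z\ \mathrm{lex}\ \mathbb R,(m,0))$. A topological space is spectral if it is sober (every irreducible closed set is the closure of a unique singleton), compact, and its compact open subsets form a basis of the topology closed under intersections of any two members. Fans. A subset $\sigma$ of a finite dimensional real vector space is a cone if $\alpha x\in\sigma$ for all $x\in\sigma$, $\alpha>0$; it is simplicial if it is generated by a finite set $S$ of linearly independent vectors, and its faces are the cones generated by subsets of $S$. A fan is a finite set $\phi$ of simplicial closed cones such that every face of a member of $\phi$ is in $\phi$ and the intersection of any two members of $\phi$ is in $\phi$; it is rational if every cone in it is defined by linear inequalities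 with rational coefficients. A fan is identified with the union of its cones when regarded as a subset of the vector space (the empty fan gives the empty set). For a finite set $F$, the radical classes of $\Delta_m(\mathbb R)^F$ (equivalence classes modulo the radical) are indexed by $v\in\{0,\dots,m\}^F$: the class $r_v$ consists of all $((v_i,x_i))_{i\in F}\in\Delta_m(\mathbb R)^F$, and $\beta_{r_v}$ is the natural bijection, $((v_i,x_i))_i\leftrightarrow(x_i)_i$, between $r_v$ and the union of quadrants $\{x\in\mathbb R^F : x_i\ge 0\text{ if }v_i=0,\ x_i\le 0\text{ if }v_i=m\}$. An $m$-fan in $\Delta_m(\mathbb R)^F$ is a subset whose intersection with every radical class $r$ is the image via $\beta_r$ of a rational fan in the corresponding union of quadrants. For an arbitrary set $I$, a cylinder $m$-fan of $\Delta_m(\mathbb R)^I$ is a set $\{f\in\Delta_m(\mathbb R)^I : f|_Y\in P_0\}$ with $Y\subseteq I$ finite and $P_0$ an $m$-fan in $\Delta_m(\mathbb R)^Y$. A topological space $X$ is $m$-fan based if it is spectral and, for some cardinal $k$ (possibly infinite), its compact open sets form a lattice anti-isomorphic to the lattice of cylinder $m$-fans of $\Delta_m(\mathbb R)^k$ (both ordered by inclusion). *)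

theory Defs
  imports "HOL-Analysis.Abstract_Topology" "HOL-Library.Lattice_Algebras"
begin

section \<open>MV-algebras, prime ideals, spectra\<close>

record 'a mv =
  mv_carrier :: "'a set"
  mv_plus :: "'a \<Rightarrow> 'a \<Rightarrow> 'a"
  mv_zero :: 'a
  mv_neg :: "'a \<Rightarrow> 'a"

definition mv_algebra :: "'a mv \<Rightarrow> bool" where
  "mv_algebra A \<longleftrightarrow>
     mv_zero A \<in> mv_carrier A \<and>
     (\<forall>x\<in>mv_carrier A. mv_neg A x \<in> mv_carrier A) \<and>
     (\<forall>x\<in>mv_carrier A. \<forall>y\<in>mv_carrier A. mv_plus A x y \<in> mv_carrier A) \<and>
     (\<forall>x\<in>mv_carrier A. \<forall>y\<in>mv_carrier A. \<forall>z\<in>mv_carrier A.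
        mv_plus A (mv_plus A x y) z = mv_plus A x (mv_plus A y z)) \<and>
     (\<forall>x\<in>mv_carrier A. \<forall>y\<in>mv_carrier A. mv_plus A x y = mv_plus A y x) \<and>
     (\<forall>x\<in>mv_carrier A. mv_plus A x (mv_zero A) = x) \<and>
     (\<forall>x\<in>mv_carrier A. mv_neg A (mv_neg A x) = x) \<and>
     (\<forall>x\<in>mv_carrier A. mv_plus A x (mv_neg A (mv_zero A)) = mv_neg A (mv_zero A)) \<and>
     (\<forall>x\<in>mv_carrier A. \<forall>y\<in>mv_carrier A.
        mv_plus A (mv_neg A (mv_plus A (mv_neg A x) y)) y
        = mv_plus A (mv_neg A (mv_plus A (mv_neg A y) x)) x)"

definition mv_le :: "'a mv \<Rightarrow> 'a \<Rightarrow> 'a \<Rightarrow> bool" where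
  "mv_le A x y \<longleftrightarrow> mv_plus A (mv_neg A x) y = mv_neg A (mv_zero A)"

definition mv_join :: "'a mv \<Rightarrow> 'a \<Rightarrow> 'a \<Rightarrow> 'a" where
  "mv_join A x y = mv_plus A (mv_neg A (mv_plus A (mv_neg A x) y)) y"

definition mv_meet :: "'a mv \<Rightarrow> 'a \<Rightarrow> 'a \<Rightarrow> 'a" where
  "mv_meet A x y = mv_neg A (mv_join A (mv_neg A x) (mv_neg A y))"

definition mv_ideal :: "'a mv \<Rightarrow> 'a set \<Rightarrow> bool" where
  "mv_ideal A P \<longleftrightarrow> P \<subseteq> mv_carrier A \<and> P \<noteq> {} \<and>
     (\<forall>x\<in>mv_carrier A. \<forall>y\<in>P. mv_le A x y \<longrightarrow> x \<in> P) \<and>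
     (\<forall>x\<in>P. \<forall>y\<in>P. mv_plus A x y \<in> P)"

definition mv_prime_ideal :: "'a mv \<Rightarrow> 'a set \<Rightarrow> bool" where
  "mv_prime_ideal A P \<longleftrightarrow> mv_ideal A P \<and> P \<noteq> mv_carrier A \<and>
     (\<forall>x\<in>mv_carrier A. \<forall>y\<in>mv_carrier A. mv_meet A x y \<in> P \<longrightarrow> x \<in> P \<or> y \<in> P)"

definition mv_Spec :: "'a mv \<Rightarrow> 'a set topology" where
  "mv_Spec A = topology_generated_by {{P. mv_prime_ideal A P \<and> a \<notin> P} | a. a \<in> mv_carrier A}"

lemma topspace_mv_Spec: "topspace (mv_Spec A) = {P. mv_prime_ideal A P}"
proof -
  have "\<exists>a\<in>mv_carrier A. a \<notin> P" if "mv_prime_ideal A P" for P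
    using that unfolding mv_prime_ideal_def mv_ideal_def by blast
  then show ?thesis unfolding mv_Spec_def topology_generated_by_topspace by blast
qed


section \<open>The functor \<open>\<Gamma>\<close>, lexicographic products, Komori chains\<close>

definition mv_Gamma :: "'g::lattice_ab_group_add \<Rightarrow> 'g mv" where
  "mv_Gamma u = \<lparr> mv_carrier = {0..u}, mv_plus = (\<lambda>a b. inf (a + b) u),
                  mv_zero = 0, mv_neg = (\<lambda>a. u - a) \<rparr>"

lemma mv_algebra_Gamma:
  fixes u :: "'g::lattice_ab_group_add"
  assumes "0 \<le> u"
  shows "mv_algebra (mv_Gamma u)"
proof -
  have luk: "inf (u - inf (u - x + y) u + y) u = sup x y"
    if "x \<in> {0..u}" "y \<in> {0..u}" for x y
  proof -
    have "u - inf (u - x + y) u = u + sup (- (u - x + y)) (- u)"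
      by (simp add: neg_inf_eq_sup flip: add_uminus_conv_diff)
    also have "\<dots> = sup (x - y) 0"
      by (simp add: add_sup_distrib_left)
    finally have "u - inf (u - x + y) u + y = sup x y"
      by (simp add: add_sup_distrib_right)
    then show ?thesis using that by (simp add: inf_absorb1)
  qed
  have assoc: "inf (inf (x + y) u + z) u = inf (x + inf (y + z) u) u"
    if "x \<in> {0..u}" "y \<in> {0..u}" "z \<in> {0..u}" for x y z
  proof -
    have "inf (inf (x + y) u + z) u = inf (x + y + z) (inf (u + z) u)"
      by (simp add: add_inf_distrib_right inf.assoc)
    also have "\<dots> = inf (x + y + z) u" using that by (simp add: inf_absorb2)
    also have "\<dots> = inf (x + y + z) (inf (x + u) u)" using that by (simp add: inf_absorb2)
    also have "\<dots> = inf (x + inf (y + z) u) u"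
      by (simp add: add_inf_distrib_left inf.assoc add.assoc)
    finally show ?thesis .
  qed
  have luk': "inf (u - inf (u - x + y) u + y) u = inf (u - inf (u - y + x) u + x) u"
    if "x \<in> {0..u}" "y \<in> {0..u}" for x y
    using luk[OF that] luk[OF that(2,1)] by (simp add: sup_commute)
  show ?thesis
    unfolding mv_algebra_def mv_Gamma_def mv.simps
  proof (intro conjI ballI, goal_cases)
    case (4 x y z) then show ?case by (rule assoc)
  next
    case (5 x y) show ?case by (simp only: add.commute)
  next
    case (9 x y) then show ?case by (rule luk')
  qed (use assms in \<open>auto simp: inf_absorb1 inf_absorb2\<close>)
qed

datatype ('a, 'b) lex = Lex (lex_fst: 'a) (lex_snd: 'b)

instantiation lex :: (linordered_ab_group_add, linordered_ab_group_add) lattice_ab_group_add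
begin

definition "0 = Lex 0 0"
definition "p + q = Lex (lex_fst p + lex_fst q) (lex_snd p + lex_snd q)"
definition "- p = Lex (- lex_fst p) (- lex_snd p)"
definition "p - q = Lex (lex_fst p - lex_fst q) (lex_snd p - lex_snd q)"
definition "p \<le> q \<longleftrightarrow>
  lex_fst p < lex_fst q \<or> lex_fst p = lex_fst q \<and> lex_snd p \<le> lex_snd q"
definition "p < q \<longleftrightarrow>
  lex_fst p < lex_fst q \<or> lex_fst p = lex_fst q \<and> lex_snd p < lex_snd q"
definition "inf p q = (if p \<le> q then p else q)" for p q :: "('a, 'b) lex"
definition "sup p q = (if p \<le> q then q else p)" for p q :: "('a, 'b) lex"

instance
  by intro_classes
    (auto simp: zero_lex_def plus_lex_def uminus_lex_def minus_lex_def less_eq_lex_def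
      less_lex_def inf_lex_def sup_lex_def add.assoc lex.expand intro: add.commute)

end

instance lex :: (linordered_ab_group_add, linordered_ab_group_add) linorder
  by intro_classes (auto simp: less_eq_lex_def)

definition strong_unit :: "'g::lattice_ab_group_add \<Rightarrow> bool" where
  "strong_unit u \<longleftrightarrow> 0 \<le> u \<and> (\<forall>x. \<exists>n::nat. x \<le> ((+) u ^^ n) 0)"

lemma strong_unit_lex:
  fixes m :: nat
  assumes "m \<ge> 1"
  shows "strong_unit (Lex (int m) (0::'b::linordered_ab_group_add))"
proof -
  have pow: "((+) (Lex (int m) (0::'b)) ^^ n) 0 = Lex (int n * int m) 0" for n
    by (induction n) (simp_all add: zero_lex_def plus_lex_def algebra_simps)
  have "x \<le> ((+) (Lex (int m) 0) ^^ nat (\<bar>lex_fst x\<bar> + 1)) 0" for x :: "(int, 'b) lex"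
  proof -
    have "lex_fst x < (\<bar>lex_fst x\<bar> + 1) * 1" by simp
    also have "\<dots> \<le> (\<bar>lex_fst x\<bar> + 1) * int m"
      using assms by (intro mult_left_mono) auto
    finally show ?thesis by (simp add: pow less_eq_lex_def)
  qed
  moreover have "0 \<le> Lex (int m) (0::'b)" by (auto simp: zero_lex_def less_eq_lex_def)
  ultimately show ?thesis unfolding strong_unit_def by blast
qed

definition Komori :: "nat \<Rightarrow> (int, int) lex mv" where
  "Komori m = mv_Gamma (Lex (int m) 0)"

definition Delta :: "nat \<Rightarrow> (int, real) lex mv" where
  "Delta m = mv_Gamma (Lex (int m) 0)"

lemma mv_algebra_Komori: "mv_algebra (Komori m)"
  unfolding Komori_def by (rule mv_algebra_Gamma) (auto simp: zero_lex_def less_eq_lex_def)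


section \<open>Generated varieties and free algebras\<close>

datatype (mv_vars: 'v) mv_term =
  MVar 'v | MZero | MNeg "'v mv_term" | MPlus "'v mv_term" "'v mv_term"

fun mv_eval :: "'a mv \<Rightarrow> ('v \<Rightarrow> 'a) \<Rightarrow> 'v mv_term \<Rightarrow> 'a" where
  "mv_eval A \<rho> (MVar v) = \<rho> v"
| "mv_eval A \<rho> MZero = mv_zero A"
| "mv_eval A \<rho> (MNeg t) = mv_neg A (mv_eval A \<rho> t)"
| "mv_eval A \<rho> (MPlus s t) = mv_plus A (mv_eval A \<rho> s) (mv_eval A \<rho> t)"

definition mv_satisfies :: "'a mv \<Rightarrow> 'v mv_term \<Rightarrow> 'v mv_term \<Rightarrow> bool" where
  "mv_satisfies A s t \<longleftrightarrow>
     (\<forall>\<rho>. (\<forall>v. \<rho> v \<in> mv_carrier A) \<longrightarrow> mv_eval A \<rho> s = mv_eval A \<rho> t)"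

text \<open>
  Membership of \<open>A\<close> in the variety generated by \<open>B\<close>, i.e. in the smallest equational class
  containing \<open>B\<close>.
\<close>

definition mv_in_variety :: "'b mv \<Rightarrow> 'a mv \<Rightarrow> bool" where
  "mv_in_variety B A \<longleftrightarrow> mv_algebra A \<and>
     (\<forall>s t :: nat mv_term. mv_satisfies B s t \<longrightarrow> mv_satisfies A s t)"

text \<open>
  The free algebra over the set \<open>I\<close> of generators in the variety generated by \<open>B\<close>: terms with
  variables in \<open>I\<close> modulo the identities of \<open>B\<close>. That it belongs to the variety and has the
  universal property is shown in \<open>mv_free_in_variety\<close>, \<open>mv_free_universal\<close> and
  \<open>mv_free_hom_unique\<close>.
\<close>

definition mv_identities :: "'b mv \<Rightarrow> 'k set \<Rightarrow> ('k mv_term \<times> 'k mv_term) set" where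
  "mv_identities B I = {(s, t). mv_vars s \<subseteq> I \<and> mv_vars t \<subseteq> I \<and> mv_satisfies B s t}"

definition mv_free :: "'b mv \<Rightarrow> 'k set \<Rightarrow> 'k mv_term set mv" where
  "mv_free B I =
     \<lparr> mv_carrier = {t. mv_vars t \<subseteq> I} // mv_identities B I,
       mv_plus = (\<lambda>X Y. \<Union>s\<in>X. \<Union>t\<in>Y. mv_identities B I `` {MPlus s t}),
       mv_zero = mv_identities B I `` {MZero},
       mv_neg = (\<lambda>X. \<Union>s\<in>X. mv_identities B I `` {MNeg s}) \<rparr>"

definition mv_gen :: "'b mv \<Rightarrow> 'k set \<Rightarrow> 'k \<Rightarrow> 'k mv_term set" where
  "mv_gen B I i = mv_identities B I `` {MVar i}"

definition mv_hom :: "'a mv \<Rightarrow> 'b mv \<Rightarrow> ('a \<Rightarrow> 'b) \<Rightarrow> bool" where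
  "mv_hom A B h \<longleftrightarrow> h \<in> mv_carrier A \<rightarrow> mv_carrier B \<and>
     h (mv_zero A) = mv_zero B \<and>
     (\<forall>x\<in>mv_carrier A. h (mv_neg A x) = mv_neg B (h x)) \<and>
     (\<forall>x\<in>mv_carrier A. \<forall>y\<in>mv_carrier A. h (mv_plus A x y) = mv_plus B (h x) (h y))"

lemma equiv_mv_identities: "equiv {t. mv_vars t \<subseteq> I} (mv_identities B I)"
  by (rule equivI)
    (auto simp: mv_identities_def mv_satisfies_def refl_on_def sym_on_def trans_on_def)

lemma mv_free_neg_class:
  assumes "mv_vars s \<subseteq> I"
  shows "mv_neg (mv_free B I) (mv_identities B I `` {s}) = mv_identities B I `` {MNeg s}"
proof -
  have "(\<lambda>s. mv_identities B I `` {MNeg s}) respects mv_identities B I"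
    by (rule congruentI, rule equiv_class_eq[OF equiv_mv_identities])
      (auto simp: mv_identities_def mv_satisfies_def)
  from UN_equiv_class[OF equiv_mv_identities this] assms show ?thesis
    by (simp add: mv_free_def)
qed

lemma mv_free_plus_class:
  assumes "mv_vars s \<subseteq> I" "mv_vars t \<subseteq> I"
  shows "mv_plus (mv_free B I) (mv_identities B I `` {s}) (mv_identities B I `` {t})
         = mv_identities B I `` {MPlus s t}"
proof -
  have "(\<lambda>s t. mv_identities B I `` {MPlus s t}) respects2 mv_identities B I"
    by (rule congruent2I', rule equiv_class_eq[OF equiv_mv_identities])
      (auto simp: mv_identities_def mv_satisfies_def)
  from UN_equiv_class2[OF equiv_mv_identities equiv_mv_identities this] assms show ?thesis
    by (simp add: mv_free_def)
qed

fun mv_subst :: "('w \<Rightarrow> 'v mv_term) \<Rightarrow> 'w mv_term \<Rightarrow> 'v mv_term" where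
  "mv_subst r (MVar v) = r v"
| "mv_subst r MZero = MZero"
| "mv_subst r (MNeg t) = MNeg (mv_subst r t)"
| "mv_subst r (MPlus s t) = MPlus (mv_subst r s) (mv_subst r t)"

lemma mv_eval_subst: "mv_eval A \<rho> (mv_subst r t) = mv_eval A (\<lambda>v. mv_eval A \<rho> (r v)) t"
  by (induction t) auto

lemma mv_eval_cong: "(\<And>v. v \<in> mv_vars t \<Longrightarrow> \<rho> v = \<rho>' v) \<Longrightarrow> mv_eval A \<rho> t = mv_eval A \<rho>' t"
  by (induction t) auto

lemma mv_vars_subst: "mv_vars (mv_subst r t) = (\<Union>v\<in>mv_vars t. mv_vars (r v))"
  by (induction t) auto

lemma mv_eval_closed:
  assumes "mv_algebra A" "\<And>v. v \<in> mv_vars t \<Longrightarrow> \<rho> v \<in> mv_carrier A"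
  shows "mv_eval A \<rho> t \<in> mv_carrier A"
  using assms(2) by (induction t) (use assms(1) in \<open>auto simp: mv_algebra_def\<close>)

lemma mv_eval_free:
  assumes "\<And>v. mv_vars (r v) \<subseteq> I"
  shows "mv_eval (mv_free B I) (\<lambda>v. mv_identities B I `` {r v}) t
         = mv_identities B I `` {mv_subst r t}"
proof (induction t)
  case MZero then show ?case by (simp add: mv_free_def)
next
  case (MNeg t)
  have "mv_vars (mv_subst r t) \<subseteq> I" using assms by (auto simp: mv_vars_subst)
  then show ?case using MNeg by (simp add: mv_free_neg_class)
next
  case (MPlus s t)
  have "mv_vars (mv_subst r s) \<subseteq> I" "mv_vars (mv_subst r t) \<subseteq> I"
    using assms by (auto simp: mv_vars_subst)
  then show ?case using MPlus by (simp add: mv_free_plus_class)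
qed simp

lemma mv_satisfies_free:
  fixes s t :: "'w mv_term" and I :: "'k set" and B :: "'b mv"
  assumes B: "mv_algebra B" and st: "mv_satisfies B s t"
  shows "mv_satisfies (mv_free B I) s t"
  unfolding mv_satisfies_def
proof (intro allI impI)
  fix \<rho> :: "'w \<Rightarrow> 'k mv_term set" assume "\<forall>v. \<rho> v \<in> mv_carrier (mv_free B I)"
  then have "\<forall>v. \<exists>u. mv_vars u \<subseteq> I \<and> \<rho> v = mv_identities B I `` {u}"
    by (auto simp: mv_free_def quotient_def)
  then obtain r :: "'w \<Rightarrow> 'k mv_term"
    where r: "\<And>v. mv_vars (r v) \<subseteq> I" "\<And>v. \<rho> v = mv_identities B I `` {r v}"
    by metis
  have "mv_satisfies B (mv_subst r s) (mv_subst r t)"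
    unfolding mv_satisfies_def mv_eval_subst
  proof (intro allI impI)
    fix \<sigma> :: "'k \<Rightarrow> 'b" assume "\<forall>v. \<sigma> v \<in> mv_carrier B"
    then have "\<And>v. mv_eval B \<sigma> (r v) \<in> mv_carrier B" by (blast intro: mv_eval_closed[OF B])
    then show "mv_eval B (\<lambda>v. mv_eval B \<sigma> (r v)) s = mv_eval B (\<lambda>v. mv_eval B \<sigma> (r v)) t"
      by (rule st[unfolded mv_satisfies_def, rule_format])
  qed
  moreover have "mv_vars (mv_subst r s) \<subseteq> I" "mv_vars (mv_subst r t) \<subseteq> I"
    using r(1) by (auto simp: mv_vars_subst)
  ultimately have "mv_identities B I `` {mv_subst r s} = mv_identities B I `` {mv_subst r t}"
    by (intro equiv_class_eq[OF equiv_mv_identities]) (simp add: mv_identities_def)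
  moreover have "\<rho> = (\<lambda>v. mv_identities B I `` {r v})" using r(2) by blast
  ultimately show "mv_eval (mv_free B I) \<rho> s = mv_eval (mv_free B I) \<rho> t"
    using mv_eval_free[of r I B] r(1) by simp
qed

lemma mv_algebra_free:
  assumes B: "mv_algebra B"
  shows "mv_algebra (mv_free B I)"
proof -
  let ?F = "mv_free B I"
  have classE: "\<exists>s. mv_vars s \<subseteq> I \<and> x = mv_identities B I `` {s}" if "x \<in> mv_carrier ?F" for x
    using that by (auto simp: mv_free_def quotient_def)
  have classI: "mv_identities B I `` {s} \<in> mv_carrier ?F" if "mv_vars s \<subseteq> I" for s
    using that by (auto simp: mv_free_def quotient_def)
  have zero: "mv_zero ?F \<in> mv_carrier ?F"
    using classI[of MZero] by (simp add: mv_free_def)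
  have neg: "mv_neg ?F x \<in> mv_carrier ?F" if "x \<in> mv_carrier ?F" for x
  proof -
    from classE[OF that] obtain s where "mv_vars s \<subseteq> I" "x = mv_identities B I `` {s}" by blast
    then show ?thesis using classI[of "MNeg s"] by (simp add: mv_free_neg_class)
  qed
  have plus: "mv_plus ?F x y \<in> mv_carrier ?F"
    if "x \<in> mv_carrier ?F" "y \<in> mv_carrier ?F" for x y
  proof -
    from classE[OF that(1)] obtain s where "mv_vars s \<subseteq> I" "x = mv_identities B I `` {s}" by blast
    moreover from classE[OF that(2)] obtain t
      where "mv_vars t \<subseteq> I" "y = mv_identities B I `` {t}" by blast
    ultimately show ?thesis using classI[of "MPlus s t"] by (simp add: mv_free_plus_class)
  qed
  have law: "mv_eval ?F (\<lambda>n. if n = 0 then x else if n = 1 then y else z) s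
           = mv_eval ?F (\<lambda>n. if n = 0 then x else if n = 1 then y else z) t"
    if "mv_satisfies B s t" "x \<in> mv_carrier ?F" "y \<in> mv_carrier ?F" "z \<in> mv_carrier ?F"
    for x y z and s t :: "nat mv_term"
    using mv_satisfies_free[OF B that(1), of I] that(2-4) unfolding mv_satisfies_def by simp
  let ?x = "MVar (0::nat)" and ?y = "MVar (1::nat)" and ?z = "MVar (2::nat)"
  have ax:
    "mv_satisfies B (MPlus (MPlus ?x ?y) ?z) (MPlus ?x (MPlus ?y ?z))"
    "mv_satisfies B (MPlus ?x ?y) (MPlus ?y ?x)"
    "mv_satisfies B (MPlus ?x MZero) ?x"
    "mv_satisfies B (MNeg (MNeg ?x)) ?x"
    "mv_satisfies B (MPlus ?x (MNeg MZero)) (MNeg MZero)"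
    "mv_satisfies B (MPlus (MNeg (MPlus (MNeg ?x) ?y)) ?y) (MPlus (MNeg (MPlus (MNeg ?y) ?x)) ?x)"
    using B by (auto simp: mv_satisfies_def mv_algebra_def)
  show ?thesis
    unfolding mv_algebra_def
  proof (intro conjI ballI, goal_cases)
    case 1 show ?case by (rule zero)
  next
    case (2 x) then show ?case by (rule neg)
  next
    case (3 x y) then show ?case by (rule plus)
  next
    case (4 x y z) then show ?case using law[OF ax(1)] by simp
  next
    case (5 x y) then show ?case using law[OF ax(2) _ _ zero, of x y] by simp
  next
    case (6 x) then show ?case using law[OF ax(3) _ zero zero, of x] by simp
  next
    case (7 x) then show ?case using law[OF ax(4) _ zero zero, of x] by simp
  next
    case (8 x) then show ?case using law[OF ax(5) _ zero zero, of x] by simp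
  next
    case (9 x y) then show ?case using law[OF ax(6) _ _ zero, of x y] by simp
  qed
qed

lemma mv_free_in_variety: "mv_algebra B \<Longrightarrow> mv_in_variety B (mv_free B I)"
  by (simp add: mv_in_variety_def mv_algebra_free mv_satisfies_free)

lemma mv_in_variety_satisfies:
  fixes s t :: "'k mv_term"
  assumes A: "mv_in_variety B A" and st: "mv_satisfies B s t"
  shows "mv_satisfies A s t"
  unfolding mv_satisfies_def
proof (intro allI impI)
  fix \<rho> :: "'k \<Rightarrow> 'b" assume \<rho>: "\<forall>v. \<rho> v \<in> mv_carrier A"
  define V where "V = mv_vars s \<union> mv_vars t"
  have fin: "finite (mv_vars u)" for u :: "'k mv_term" by (induction u) auto
  then have "finite V" by (simp add: V_def)
  then obtain e :: "'k \<Rightarrow> nat" where e: "inj_on e V"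
    by (metis finite_imp_inj_to_nat_seg)
  have "mv_satisfies B (mv_subst (MVar \<circ> e) s) (mv_subst (MVar \<circ> e) t)"
    using st by (simp add: mv_satisfies_def mv_eval_subst)
  then have *: "mv_satisfies A (mv_subst (MVar \<circ> e) s) (mv_subst (MVar \<circ> e) t)"
    using A by (simp add: mv_in_variety_def)
  have "\<forall>n. \<rho> (inv_into V e n) \<in> mv_carrier A" using \<rho> by blast
  then have "mv_eval A (\<lambda>v. \<rho> (inv_into V e (e v))) s = mv_eval A (\<lambda>v. \<rho> (inv_into V e (e v))) t"
    using *[unfolded mv_satisfies_def, rule_format, of "\<lambda>n. \<rho> (inv_into V e n)"]
    by (simp add: mv_eval_subst)
  moreover have "mv_eval A (\<lambda>v. \<rho> (inv_into V e (e v))) u = mv_eval A \<rho> u"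
    if "mv_vars u \<subseteq> V" for u
    using that e by (intro mv_eval_cong) (auto simp: inv_into_f_f)
  ultimately show "mv_eval A \<rho> s = mv_eval A \<rho> t" by (simp add: V_def)
qed

lemma mv_free_universal:
  assumes A: "mv_in_variety B A" and f: "f \<in> I \<rightarrow> mv_carrier A"
  shows "\<exists>h. mv_hom (mv_free B I) A h \<and> (\<forall>i\<in>I. h (mv_gen B I i) = f i)"
proof -
  let ?F = "mv_free B I"
  have mvA: "mv_algebra A" using A by (simp add: mv_in_variety_def)
  define f' where "f' i = (if i \<in> I then f i else mv_zero A)" for i
  have f': "\<forall>i. f' i \<in> mv_carrier A" using f mvA by (auto simp: f'_def mv_algebra_def)
  define h where "h X = mv_eval A f' (SOME t. t \<in> X)" for X
  have h: "h (mv_identities B I `` {s}) = mv_eval A f' s" if "mv_vars s \<subseteq> I" for s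
  proof -
    have "s \<in> mv_identities B I `` {s}"
      using that by (simp add: mv_identities_def mv_satisfies_def)
    then have "(SOME t. t \<in> mv_identities B I `` {s}) \<in> mv_identities B I `` {s}"
      by (rule someI)
    then have "mv_satisfies B s (SOME t. t \<in> mv_identities B I `` {s})"
      unfolding mv_identities_def by blast
    from mv_in_variety_satisfies[OF A this] f' show ?thesis
      unfolding h_def mv_satisfies_def by simp
  qed
  have classE: "\<exists>s. mv_vars s \<subseteq> I \<and> x = mv_identities B I `` {s}" if "x \<in> mv_carrier ?F" for x
    using that by (auto simp: mv_free_def quotient_def)
  have "mv_hom ?F A h"
    unfolding mv_hom_def
  proof (intro conjI ballI funcsetI)
    show "h x \<in> mv_carrier A" if "x \<in> mv_carrier ?F" for x
    proof -
      from classE[OF that] obtain s where "mv_vars s \<subseteq> I" "x = mv_identities B I `` {s}" by blast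
      then show ?thesis using h[of s] mv_eval_closed[OF mvA, of s f'] f' by simp
    qed
    show "h (mv_zero ?F) = mv_zero A" using h[of MZero] by (simp add: mv_free_def)
    show "h (mv_neg ?F x) = mv_neg A (h x)" if x: "x \<in> mv_carrier ?F" for x
    proof -
      from classE[OF x] obtain s where "mv_vars s \<subseteq> I" "x = mv_identities B I `` {s}" by blast
      then show ?thesis using h[of s] h[of "MNeg s"] by (simp add: mv_free_neg_class)
    qed
    show "h (mv_plus ?F x y) = mv_plus A (h x) (h y)"
      if x: "x \<in> mv_carrier ?F" and y: "y \<in> mv_carrier ?F" for x y
    proof -
      from classE[OF x] obtain s where "mv_vars s \<subseteq> I" "x = mv_identities B I `` {s}" by blast
      moreover from classE[OF y] obtain t
        where "mv_vars t \<subseteq> I" "y = mv_identities B I `` {t}" by blast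
      ultimately show ?thesis
        using h[of s] h[of t] h[of "MPlus s t"] by (simp add: mv_free_plus_class)
    qed
  qed
  moreover have "\<forall>i\<in>I. h (mv_gen B I i) = f i"
    using h[of "MVar i" for i] by (auto simp: mv_gen_def f'_def)
  ultimately show "\<exists>h. mv_hom ?F A h \<and> (\<forall>i\<in>I. h (mv_gen B I i) = f i)" by blast
qed

lemma mv_free_hom_unique:
  assumes g: "mv_hom (mv_free B I) A g" "\<forall>i\<in>I. g (mv_gen B I i) = f i"
    and h: "mv_hom (mv_free B I) A h" "\<forall>i\<in>I. h (mv_gen B I i) = f i"
    and x: "x \<in> mv_carrier (mv_free B I)"
  shows "g x = h x"
proof -
  let ?F = "mv_free B I"
  have classE: "\<exists>s. mv_vars s \<subseteq> I \<and> x = mv_identities B I `` {s}" if "x \<in> mv_carrier ?F" for x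
    using that by (auto simp: mv_free_def quotient_def)
  have class_eq: "g (mv_identities B I `` {s}) = h (mv_identities B I `` {s})"
    if "mv_vars s \<subseteq> I" for s
    using that
  proof (induction s)
    case (MVar i)
    then show ?case using g(2) h(2) by (simp add: mv_gen_def)
  next
    case MZero
    have "mv_identities B I `` {MZero} = mv_zero ?F" by (simp add: mv_free_def)
    then show ?case using g(1) h(1) by (simp add: mv_hom_def)
  next
    case (MNeg s)
    then have "mv_identities B I `` {s} \<in> mv_carrier ?F" by (auto simp: mv_free_def quotient_def)
    then show ?case
      using MNeg g(1) h(1) by (simp add: mv_hom_def flip: mv_free_neg_class)
  next
    case (MPlus s t)
    then have "mv_identities B I `` {s} \<in> mv_carrier ?F" "mv_identities B I `` {t} \<in> mv_carrier ?F"
      by (auto simp: mv_free_def quotient_def)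
    then show ?case
      using MPlus g(1) h(1) by (simp add: mv_hom_def flip: mv_free_plus_class)
  qed
  show "g x = h x" using classE[OF x] class_eq by auto
qed

definition Free :: "nat \<Rightarrow> 'k set \<Rightarrow> 'k mv_term set mv" where
  "Free m I = mv_free (Komori m) I"


section \<open>Spectral spaces\<close>

definition irreducible_closed :: "'a topology \<Rightarrow> 'a set \<Rightarrow> bool" where
  "irreducible_closed X C \<longleftrightarrow> closedin X C \<and> C \<noteq> {} \<and>
     (\<forall>D E. closedin X D \<and> closedin X E \<and> C = D \<union> E \<longrightarrow> C = D \<or> C = E)"

definition sober_space :: "'a topology \<Rightarrow> bool" where
  "sober_space X \<longleftrightarrow>
     (\<forall>C. irreducible_closed X C \<longrightarrow> (\<exists>!x. x \<in> topspace X \<and> C = X closure_of {x}))"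

definition compact_opens :: "'a topology \<Rightarrow> 'a set set" where
  "compact_opens X = {U. openin X U \<and> compactin X U}"

definition spectral_space :: "'a topology \<Rightarrow> bool" where
  "spectral_space X \<longleftrightarrow> sober_space X \<and> compact_space X \<and>
     (\<forall>U. openin X U \<longrightarrow> (\<exists>\<B> \<subseteq> compact_opens X. U = \<Union>\<B>)) \<and>
     (\<forall>U\<in>compact_opens X. \<forall>V\<in>compact_opens X. U \<inter> V \<in> compact_opens X)"


section \<open>Rational fans in \<open>\<real>\<^sup>F\<close>\<close>

text \<open>
  For a finite index set \<open>F\<close>, the space \<open>\<real>\<^sup>F\<close> is the set \<open>F \<rightarrow>\<^sub>E UNIV\<close> of extensional functions.
\<close>

definition lin_indep_on :: "'k set \<Rightarrow> ('k \<Rightarrow> real) set \<Rightarrow> bool" where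
  "lin_indep_on F S \<longleftrightarrow>
     (\<forall>c. (\<forall>i\<in>F. (\<Sum>s\<in>S. c s * s i) = 0) \<longrightarrow> (\<forall>s\<in>S. c s = 0))"

text \<open>The closed cone generated by a finite set; the empty set generates \<open>{0}\<close>.\<close>

definition cone_gen :: "'k set \<Rightarrow> ('k \<Rightarrow> real) set \<Rightarrow> ('k \<Rightarrow> real) set" where
  "cone_gen F S = {\<lambda>i\<in>F. \<Sum>s\<in>S. c s * s i | c. \<forall>s\<in>S. 0 \<le> c s}"

definition simplicial_basis :: "'k set \<Rightarrow> ('k \<Rightarrow> real) set \<Rightarrow> ('k \<Rightarrow> real) set \<Rightarrow> bool" where
  "simplicial_basis F S \<sigma> \<longleftrightarrow>
     finite S \<and> S \<subseteq> (F \<rightarrow>\<^sub>E UNIV) \<and> lin_indep_on F S \<and> \<sigma> = cone_gen F S"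

definition simplicial_cone :: "'k set \<Rightarrow> ('k \<Rightarrow> real) set \<Rightarrow> bool" where
  "simplicial_cone F \<sigma> \<longleftrightarrow> (\<exists>S. simplicial_basis F S \<sigma>)"

definition cone_face :: "'k set \<Rightarrow> ('k \<Rightarrow> real) set \<Rightarrow> ('k \<Rightarrow> real) set \<Rightarrow> bool" where
  "cone_face F \<tau> \<sigma> \<longleftrightarrow> (\<exists>S T. simplicial_basis F S \<sigma> \<and> T \<subseteq> S \<and> \<tau> = cone_gen F T)"

definition fan :: "'k set \<Rightarrow> ('k \<Rightarrow> real) set set \<Rightarrow> bool" where
  "fan F \<phi> \<longleftrightarrow> finite \<phi> \<and> (\<forall>\<sigma>\<in>\<phi>. simplicial_cone F \<sigma>) \<and>
     (\<forall>\<sigma>\<in>\<phi>. \<forall>\<tau>. cone_face F \<tau> \<sigma> \<longrightarrow> \<tau> \<in> \<phi>) \<and>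
     (\<forall>\<sigma>\<in>\<phi>. \<forall>\<tau>\<in>\<phi>. \<sigma> \<inter> \<tau> \<in> \<phi>)"

text \<open>Rationality: the cone is cut out by finitely many inequalities with rational coefficients.\<close>

definition rational_cone :: "'k set \<Rightarrow> ('k \<Rightarrow> real) set \<Rightarrow> bool" where
  "rational_cone F \<sigma> \<longleftrightarrow>
     (\<exists>A :: ('k \<Rightarrow> rat) set. finite A \<and>
        \<sigma> = {x \<in> F \<rightarrow>\<^sub>E UNIV. \<forall>a\<in>A. 0 \<le> (\<Sum>i\<in>F. of_rat (a i) * x i)})"

definition rational_fan :: "'k set \<Rightarrow> ('k \<Rightarrow> real) set set \<Rightarrow> bool" where
  "rational_fan F \<phi> \<longleftrightarrow> fan F \<phi> \<and> (\<forall>\<sigma>\<in>\<phi>. rational_cone F \<sigma>)"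


section \<open>\<open>m\<close>-fans and \<open>m\<close>-fan based spaces\<close>

definition Delta_pow :: "nat \<Rightarrow> 'k set \<Rightarrow> ('k \<Rightarrow> (int, real) lex) set" where
  "Delta_pow m I = (I \<rightarrow>\<^sub>E mv_carrier (Delta m))"

definition radical_class ::
    "nat \<Rightarrow> 'k set \<Rightarrow> ('k \<Rightarrow> int) \<Rightarrow> ('k \<Rightarrow> (int, real) lex) set" where
  "radical_class m F v = {f \<in> Delta_pow m F. \<forall>i\<in>F. lex_fst (f i) = v i}"

definition quadrants :: "nat \<Rightarrow> 'k set \<Rightarrow> ('k \<Rightarrow> int) \<Rightarrow> ('k \<Rightarrow> real) set" where
  "quadrants m F v = {x \<in> F \<rightarrow>\<^sub>E UNIV.
     \<forall>i\<in>F. (v i = 0 \<longrightarrow> 0 \<le> x i) \<and> (v i = int m \<longrightarrow> x i \<le> 0)}"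

text \<open>The bijection \<open>\<beta>\<close>, in the direction from quadrants to the radical class.\<close>

definition beta :: "'k set \<Rightarrow> ('k \<Rightarrow> int) \<Rightarrow> ('k \<Rightarrow> real) \<Rightarrow> 'k \<Rightarrow> (int, real) lex" where
  "beta F v x = (\<lambda>i\<in>F. Lex (v i) (x i))"

lemma bij_betw_beta:
  assumes "m \<ge> 1" "v \<in> F \<rightarrow>\<^sub>E {0..int m}"
  shows "bij_betw (beta F v) (quadrants m F v) (radical_class m F v)"
proof (rule bij_betwI[where g = "\<lambda>f. \<lambda>i\<in>F. lex_snd (f i)"])
  have v: "0 \<le> v i \<and> v i \<le> int m" if "i \<in> F" for i using assms(2) that by auto
  show "beta F v \<in> quadrants m F v \<rightarrow> radical_class m F v"
    using v by (force simp: beta_def quadrants_def radical_class_def Delta_pow_def Delta_def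
        mv_Gamma_def less_eq_lex_def zero_lex_def)
  show "(\<lambda>f. \<lambda>i\<in>F. lex_snd (f i)) \<in> radical_class m F v \<rightarrow> quadrants m F v"
    using assms(1) by (force simp: beta_def quadrants_def radical_class_def Delta_pow_def Delta_def
        mv_Gamma_def less_eq_lex_def zero_lex_def PiE_iff)
  show "(\<lambda>i\<in>F. lex_snd (beta F v x i)) = x" if "x \<in> quadrants m F v" for x
    using that by (auto simp: beta_def quadrants_def fun_eq_iff PiE_iff extensional_def)
  show "beta F v (\<lambda>i\<in>F. lex_snd (f i)) = f" if "f \<in> radical_class m F v" for f
    using that by (auto simp: beta_def radical_class_def Delta_pow_def fun_eq_iff PiE_iff
        extensional_def lex.expand)
qed

definition m_fan :: "nat \<Rightarrow> 'k set \<Rightarrow> ('k \<Rightarrow> (int, real) lex) set \<Rightarrow> bool" where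
  "m_fan m F P \<longleftrightarrow> P \<subseteq> Delta_pow m F \<and>
     (\<forall>v \<in> F \<rightarrow>\<^sub>E {0..int m}.
        \<exists>\<phi>. rational_fan F \<phi> \<and> \<Union>\<phi> \<subseteq> quadrants m F v \<and>
            P \<inter> radical_class m F v = beta F v ` \<Union>\<phi>)"

definition cylinder_m_fans :: "nat \<Rightarrow> 'k set \<Rightarrow> ('k \<Rightarrow> (int, real) lex) set set" where
  "cylinder_m_fans m I = {{f \<in> Delta_pow m I. restrict f Y \<in> P} | Y P.
     finite Y \<and> Y \<subseteq> I \<and> m_fan m Y P}"

text \<open>An order-reversing bijection between two lattices of sets is a lattice anti-isomorphism.\<close>

definition anti_isomorphic :: "'a set set \<Rightarrow> 'b set set \<Rightarrow> bool" where
  "anti_isomorphic L M \<longleftrightarrow>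
     (\<exists>\<phi>. bij_betw \<phi> L M \<and> (\<forall>U\<in>L. \<forall>V\<in>L. U \<subseteq> V \<longleftrightarrow> \<phi> V \<subseteq> \<phi> U))"

text \<open>
  HOL has no quantifier over all cardinals. A cardinal \<open>k\<close> is represented by a set \<open>I\<close> over a type
  \<open>'k\<close>, and \<open>'k\<close> is left arbitrary; since every cardinal is the size of a subset of some type,
  results that hold for all \<open>'k\<close> cover all cardinals.
\<close>

definition m_fan_based :: "'k itself \<Rightarrow> nat \<Rightarrow> 'a topology \<Rightarrow> bool" where
  "m_fan_based (K :: 'k itself) m X \<longleftrightarrow> spectral_space X \<and>
     (\<exists>I :: 'k set. anti_isomorphic (compact_opens X) (cylinder_m_fans m I))"

end

theory Submission
  imports Defs
begin

text \<open>
For an MV-term \<open>t\<close> with variables in \<open>I\<close> let \<open>Z(t)\<close> be its zero set in \<open>\<Delta>\<^sub>m(\<real>)\<^sup>I\<close>. The theorem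
rests on two facts. First, the cylinder \<open>m\<close>-fans are exactly the sets \<open>Z(t)\<close>
(\<open>cylinder_m_fans_eq\<close>). Second, \<open>Z(s) \<subseteq> Z(t)\<close> holds if and only if the class of \<open>t\<close> in the free
algebra lies in the ideal generated by the class of \<open>s\<close> (\<open>zero_set_subset_iff\<close>). So ideals of
\<open>Free(m, I)\<close> are filters of cylinder \<open>m\<close>-fans; since sums of terms correspond to intersections
and meets to unions, prime ideals are prime filters, and the spectrum is the space of prime filters
of the lattice of cylinder \<open>m\<close>-fans (\<open>stone_map_vanishing\<close>). Stone duality characterises the
spaces homeomorphic to a space of prime filters as the spectral spaces whose compact open sets are
anti-isomorphic to the lattice (\<open>homeomorphic_iff_anti_isomorphic\<close>).

The two facts about zero sets are proved one radical class at a time. On a radical class the first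
coordinate of a term is constant and the second one is continuous and piecewise linear with rational
coefficients, so it is linear on each cell of a finite arrangement of rational hyperplanes
(\<open>adapted_snd_value_ex\<close>). Choosing a rational point in every cell gives the barycentric subdivision
of the arrangement: chains of cells span simplicial cones, and these form a rational fan
(\<open>rational_fan_of_cells\<close>). This shows that zero sets are \<open>m\<close>-fans (\<open>zero_set_m_fan\<close>). The same
subdivision proves the second fact: a linear inequality on a cone may be checked on its generators,
of which there are finitely many, so \<open>Z(s) \<subseteq> Z(t)\<close> yields a single \<open>n\<close> with \<open>t \<le> n s\<close>
(\<open>snd_value_dominated\<close>). That it does not matter whether identities are tested in the Komori chain
or in \<open>\<Delta>\<^sub>m(\<real>)\<close> is again due to the cells: an identity that fails at a point fails on its whole cell,
which contains a rational point and hence, cells being cones, an integral one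
(\<open>Komori_identities_Delta\<close>).

Conversely, integral affine forms truncated to \<open>[0, u]\<close> are term functions (\<open>clampable_linear\<close>).
They define the closed rational half-spaces of a radical class as well as the complement of the
class, and zero sets are closed under finite unions and intersections; therefore every \<open>m\<close>-fan is a
zero set (\<open>m_fan_definable\<close>).
\<close>

section \<open>Prime filters and spectral spaces\<close>

definition set_lattice :: "'b set set \<Rightarrow> bool" where
  "set_lattice L \<longleftrightarrow> {} \<in> L \<and> \<Union>L \<in> L \<and> (\<forall>a\<in>L. \<forall>b\<in>L. a \<inter> b \<in> L \<and> a \<union> b \<in> L)"

definition prime_filter :: "'b set set \<Rightarrow> 'b set set \<Rightarrow> bool" where
  "prime_filter L F \<longleftrightarrow> F \<subseteq> L \<and> F \<noteq> {} \<and> {} \<notin> F \<and>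
     (\<forall>a\<in>F. \<forall>b\<in>L. a \<subseteq> b \<longrightarrow> b \<in> F) \<and>
     (\<forall>a\<in>F. \<forall>b\<in>F. a \<inter> b \<in> F) \<and>
     (\<forall>a\<in>L. \<forall>b\<in>L. a \<union> b \<in> F \<longrightarrow> a \<in> F \<or> b \<in> F)"

text \<open>
The spectra considered have different types, and homeomorphic spaces are to be treated alike. So
instead of a space of prime filters, the notion describes the spaces homeomorphic to it, with the
homeomorphism as a parameter; the sets of prime filters omitting one member of \<open>L\<close> form a base.
\<close>

definition stone_map :: "'a topology \<Rightarrow> 'b set set \<Rightarrow> ('a \<Rightarrow> 'b set set) \<Rightarrow> bool" where
  "stone_map X L h \<longleftrightarrow>
     bij_betw h (topspace X) {F. prime_filter L F} \<and>
     (\<forall>U. openin X U \<longleftrightarrow> U \<subseteq> topspace X \<and>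
        (\<forall>x\<in>U. \<exists>a\<in>L. a \<notin> h x \<and> {y \<in> topspace X. a \<notin> h y} \<subseteq> U))"

text \<open>
Zorn's lemma is applied to the families \<open>M \<supseteq> B\<close> none of whose finite intersections lies in \<open>a\<close>. This
property is of finite character, so it passes to unions of chains; a maximal such family is
automatically a prime filter, because for every member \<open>b\<close> of \<open>L\<close> outside \<open>M\<close> some finite
intersection of \<open>M\<close> meets \<open>b\<close> inside \<open>a\<close>.
\<close>

lemma prime_filter_exists:
  assumes L: "set_lattice L" and B: "B \<subseteq> L" and a: "a \<in> L"
    and avoid: "\<And>K. finite K \<Longrightarrow> K \<subseteq> B \<Longrightarrow> \<not> \<Union>L \<inter> \<Inter>K \<subseteq> a"
  obtains F where "prime_filter L F" "B \<subseteq> F" "a \<notin> F"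
proof -
  define Q where "Q M \<longleftrightarrow> B \<subseteq> M \<and> M \<subseteq> L \<and> (\<forall>K. finite K \<longrightarrow> K \<subseteq> M \<longrightarrow> \<not> \<Union>L \<inter> \<Inter>K \<subseteq> a)"
    for M
  have "\<exists>M\<in>{M. Q M}. \<forall>X\<in>{M. Q M}. M \<subseteq> X \<longrightarrow> X = M"
  proof (rule subset_Zorn_nonempty)
    show "{M. Q M} \<noteq> {}" using B avoid by (auto simp: Q_def intro!: exI[of _ B])
  next
    fix C assume C: "C \<noteq> {}" "subset.chain {M. Q M} C"
    have CQ: "Q M" if "M \<in> C" for M using C(2) that by (auto simp: subset.chain_def)
    have "\<not> \<Union>L \<inter> \<Inter>K \<subseteq> a" if K: "finite K" "K \<subseteq> \<Union>C" for K
    proof -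
      obtain M where "M \<in> C" "K \<subseteq> M"
        using finite_subset_Union_chain[OF K C] by blast
      then show ?thesis using CQ K(1) by (auto simp: Q_def)
    qed
    moreover have "B \<subseteq> \<Union>C" "\<Union>C \<subseteq> L"
      using C(1) CQ unfolding Q_def by blast+
    ultimately show "\<Union>C \<in> {M. Q M}" by (simp add: Q_def)
  qed
  then obtain M where QM: "Q M" and max: "\<And>X. Q X \<Longrightarrow> M \<subseteq> X \<Longrightarrow> X = M" by blast
  have M: "B \<subseteq> M" "M \<subseteq> L" using QM by (auto simp: Q_def)
  have fin: "\<not> \<Union>L \<inter> \<Inter>K \<subseteq> a" if "finite K" "K \<subseteq> M" for K
    using QM that by (auto simp: Q_def)
  have out: "\<exists>K. finite K \<and> K \<subseteq> M \<and> \<Union>L \<inter> \<Inter>K \<inter> b \<subseteq> a" if b: "b \<in> L" "b \<notin> M" for b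
  proof -
    have "\<not> Q (insert b M)" using max[of "insert b M"] b(2) by blast
    then obtain K where K: "finite K" "K \<subseteq> insert b M" "\<Union>L \<inter> \<Inter>K \<subseteq> a"
      using M b(1) unfolding Q_def by blast
    have "\<Inter>(K - {b}) \<inter> b \<subseteq> \<Inter>K" by blast
    then have "finite (K - {b}) \<and> K - {b} \<subseteq> M \<and> \<Union>L \<inter> \<Inter>(K - {b}) \<inter> b \<subseteq> a"
      using K by blast
    then show ?thesis by (rule exI)
  qed
  have top: "\<Union>L \<in> M"
  proof (rule ccontr)
    assume "\<Union>L \<notin> M"
    with out[of "\<Union>L"] L obtain K where "finite K" "K \<subseteq> M" "\<Union>L \<inter> \<Inter>K \<inter> \<Union>L \<subseteq> a"
      by (auto simp: set_lattice_def)
    then show False using fin[of K] by blast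
  qed
  have "prime_filter L M"
    unfolding prime_filter_def
  proof (intro conjI ballI impI)
    show "M \<subseteq> L" by fact
    show "M \<noteq> {}" using top by blast
    show "{} \<notin> M" using fin[of "{{}}"] by auto
    show "b \<in> M" if bc: "c \<in> M" "b \<in> L" "c \<subseteq> b" for b c
    proof (rule ccontr)
      assume "b \<notin> M"
      then obtain K where K: "finite K" "K \<subseteq> M" "\<Union>L \<inter> \<Inter>K \<inter> b \<subseteq> a"
        using out bc by meson
      have "\<Union>L \<inter> \<Inter>(insert c K) \<subseteq> \<Union>L \<inter> \<Inter>K \<inter> b" using bc by auto
      then show False using fin[of "insert c K"] bc K by (meson finite_insert insert_subset subset_trans)
    qed
    show "b \<inter> c \<in> M" if bc: "b \<in> M" "c \<in> M" for b c
    proof (rule ccontr)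
      assume n: "b \<inter> c \<notin> M"
      have "b \<inter> c \<in> L" using L bc subsetD[OF M(2)] unfolding set_lattice_def by blast
      then obtain K where K: "finite K" "K \<subseteq> M" "\<Union>L \<inter> \<Inter>K \<inter> (b \<inter> c) \<subseteq> a"
        using out n by meson
      have "\<Union>L \<inter> \<Inter>(insert b (insert c K)) = \<Union>L \<inter> \<Inter>K \<inter> (b \<inter> c)" by auto
      then show False using fin[of "insert b (insert c K)"] bc K by simp
    qed
    show "b \<in> M \<or> c \<in> M" if bc: "b \<in> L" "c \<in> L" "b \<union> c \<in> M" for b c
    proof (rule ccontr)
      assume "\<not> (b \<in> M \<or> c \<in> M)"
      then have "b \<notin> M" "c \<notin> M" by auto
      obtain K where K: "finite K" "K \<subseteq> M" "\<Union>L \<inter> \<Inter>K \<inter> b \<subseteq> a"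
        using out[OF bc(1) \<open>b \<notin> M\<close>] by auto
      obtain K' where K': "finite K'" "K' \<subseteq> M" "\<Union>L \<inter> \<Inter>K' \<inter> c \<subseteq> a"
        using out[OF bc(2) \<open>c \<notin> M\<close>] by auto
      have "\<Union>L \<inter> \<Inter>(insert (b \<union> c) (K \<union> K')) = \<Union>L \<inter> \<Inter>K \<inter> \<Inter>K' \<inter> (b \<union> c)"
        by (simp add: Inter_Un_distrib Int_ac)
      also have "\<dots> \<subseteq> (\<Union>L \<inter> \<Inter>K \<inter> b) \<union> (\<Union>L \<inter> \<Inter>K' \<inter> c)" by auto
      also have "\<dots> \<subseteq> a" using K(3) K'(3) by simp
      finally show False using fin[of "insert (b \<union> c) (K \<union> K')"] bc(3) K(1,2) K'(1,2) by simp
    qed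
  qed
  moreover have "a \<notin> M" using fin[of "{a}"] by auto
  ultimately show ?thesis using that M(1) by blast
qed

lemma set_lattice_finite_Inter:
  assumes L: "set_lattice L" and K: "finite K" "K \<subseteq> L"
  shows "\<Union>L \<inter> \<Inter>K \<in> L"
  using K
proof (induction K)
  case empty
  then show ?case using L by (simp add: set_lattice_def)
next
  case (insert b K)
  have "\<Union>L \<inter> \<Inter>(insert b K) = b \<inter> (\<Union>L \<inter> \<Inter>K)" by blast
  then show ?case using insert L by (simp add: set_lattice_def)
qed

text \<open>
Intersecting with \<open>\<Union>L\<close> gives the empty family the top element as its intersection.
\<close>

lemma prime_filter_finite_Inter:
  assumes L: "set_lattice L" and F: "prime_filter L F" and K: "finite K" "K \<subseteq> L"
  shows "\<Union>L \<inter> \<Inter>K \<in> F \<longleftrightarrow> K \<subseteq> F"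
  using K
proof (induction K)
  case empty
  obtain a where "a \<in> F" using F by (auto simp: prime_filter_def)
  then have "\<Union>L \<in> F" using F L unfolding prime_filter_def set_lattice_def
    by (metis Sup_upper subsetD)
  then show ?case by simp
next
  case (insert b K)
  have eq: "\<Union>L \<inter> \<Inter>(insert b K) = b \<inter> (\<Union>L \<inter> \<Inter>K)" using insert by blast
  have inL: "\<Union>L \<inter> \<Inter>K \<in> L" using insert set_lattice_finite_Inter[OF L] by blast
  have "b \<inter> (\<Union>L \<inter> \<Inter>K) \<in> F \<longleftrightarrow> b \<in> F \<and> \<Union>L \<inter> \<Inter>K \<in> F"
    using F inL insert.prems unfolding prime_filter_def
    by (metis inf.cobounded1 inf.cobounded2 insert_subset)
  then show ?case using insert unfolding eq by simp
qed

context
  fixes X :: "'a topology" and L :: "'b set set" and h :: "'a \<Rightarrow> 'b set set"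
  assumes L: "set_lattice L" and st: "stone_map X L h"
begin

definition basic :: "'b set \<Rightarrow> 'a set" where
  "basic a = {y \<in> topspace X. a \<notin> h y}"

lemma prime_filter_stone: "x \<in> topspace X \<Longrightarrow> prime_filter L (h x)"
  using st by (auto simp: stone_map_def bij_betw_def)

lemma openin_stone_iff:
  "openin X U \<longleftrightarrow> U \<subseteq> topspace X \<and> (\<forall>x\<in>U. \<exists>a\<in>L. x \<in> basic a \<and> basic a \<subseteq> U)"
proof -
  have "openin X U \<longleftrightarrow> U \<subseteq> topspace X \<and> (\<forall>x\<in>U. \<exists>a\<in>L. a \<notin> h x \<and> basic a \<subseteq> U)"
    using st unfolding stone_map_def basic_def by simp
  also have "\<dots> \<longleftrightarrow> U \<subseteq> topspace X \<and> (\<forall>x\<in>U. \<exists>a\<in>L. x \<in> basic a \<and> basic a \<subseteq> U)"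
    by (intro conj_cong ball_cong bex_cong refl) (auto simp: basic_def)
  finally show ?thesis .
qed

lemma openin_basic: "a \<in> L \<Longrightarrow> openin X (basic a)"
  unfolding openin_stone_iff by (auto simp: basic_def)

lemma stone_surj:
  assumes "prime_filter L F" obtains x where "x \<in> topspace X" "h x = F"
proof -
  have "F \<in> h ` topspace X" using st assms by (simp add: stone_map_def bij_betw_def)
  then show ?thesis using that by blast
qed

text \<open>
For \<open>p \<in> b - a\<close> the members of \<open>L\<close> that contain \<open>p\<close> form a prime filter with \<open>b\<close> but without \<open>a\<close>.
\<close>

lemma basic_subset_iff:
  assumes "a \<in> L" "b \<in> L" shows "basic a \<subseteq> basic b \<longleftrightarrow> b \<subseteq> a"
proof
  assume "b \<subseteq> a"
  then show "basic a \<subseteq> basic b"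
    using assms prime_filter_stone unfolding basic_def prime_filter_def by blast
next
  assume sub: "basic a \<subseteq> basic b"
  show "b \<subseteq> a"
  proof
    fix p assume "p \<in> b"
    show "p \<in> a"
    proof (rule ccontr)
      assume "p \<notin> a"
      have "prime_filter L {c \<in> L. p \<in> c}"
        using L assms \<open>p \<in> b\<close> unfolding prime_filter_def set_lattice_def by auto
      then obtain x where "x \<in> topspace X" "h x = {c \<in> L. p \<in> c}" by (rule stone_surj)
      then have "x \<in> basic a" "x \<notin> basic b"
        using \<open>p \<in> b\<close> \<open>p \<notin> a\<close> assms by (auto simp: basic_def)
      then show False using sub by blast
    qed
  qed
qed

lemma basic_finite_Inter:
  assumes "finite K" "K \<subseteq> L" shows "basic (\<Union>L \<inter> \<Inter>K) = \<Union>(basic ` K)"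
proof -
  have "\<Union>L \<inter> \<Inter>K \<in> h y \<longleftrightarrow> K \<subseteq> h y" if "y \<in> topspace X" for y
    using prime_filter_finite_Inter[OF L prime_filter_stone[OF that] assms] .
  then show ?thesis by (auto simp: basic_def)
qed

lemma basic_Un:
  assumes "a \<in> L" "b \<in> L" shows "basic (a \<union> b) = basic a \<inter> basic b"
proof -
  have "a \<union> b \<in> h y \<longleftrightarrow> a \<in> h y \<or> b \<in> h y" if "y \<in> topspace X" for y
    using prime_filter_stone[OF that] assms L unfolding prime_filter_def set_lattice_def
    by (metis Un_upper1 Un_upper2)
  then show ?thesis by (auto simp: basic_def)
qed

lemma basic_empty: "basic {} = topspace X"
  using prime_filter_stone by (auto simp: basic_def prime_filter_def)

text \<open>
Let \<open>B\<close> consist of the \<open>b\<close> whose basic open set lies in one member of the cover. If no finite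
intersection of \<open>B\<close> were contained in \<open>a\<close>, a prime filter containing \<open>B\<close> and omitting \<open>a\<close> would be an
uncovered point of the basic open set of \<open>a\<close>.
\<close>

lemma compactin_basic:
  assumes a: "a \<in> L" shows "compactin X (basic a)"
  unfolding compactin_def
proof (intro conjI allI impI)
  show "basic a \<subseteq> topspace X" by (auto simp: basic_def)
next
  fix \<U> assume U: "(\<forall>U\<in>\<U>. openin X U) \<and> basic a \<subseteq> \<Union>\<U>"
  define B where "B = {b \<in> L. \<exists>U\<in>\<U>. basic b \<subseteq> U}"
  have "\<exists>K. finite K \<and> K \<subseteq> B \<and> \<Union>L \<inter> \<Inter>K \<subseteq> a"
  proof (rule ccontr)
    assume no: "\<not> ?thesis"
    obtain F where F: "prime_filter L F" "B \<subseteq> F" "a \<notin> F"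
      by (rule prime_filter_exists[OF L _ a, of B]) (use no in \<open>auto simp: B_def\<close>)
    obtain x where x: "x \<in> topspace X" "h x = F" using F(1) by (rule stone_surj)
    then have "x \<in> basic a" using F by (simp add: basic_def)
    then obtain U where "U \<in> \<U>" "x \<in> U" using U by blast
    then obtain b where "b \<in> L" "x \<in> basic b" "basic b \<subseteq> U"
      using U unfolding openin_stone_iff by blast
    then have "b \<in> B" "b \<notin> F" using \<open>U \<in> \<U>\<close> x by (auto simp: B_def basic_def)
    then show False using F by blast
  qed
  then obtain K where K: "finite K" "K \<subseteq> B" "\<Union>L \<inter> \<Inter>K \<subseteq> a" by blast
  have KL: "K \<subseteq> L" using K(2) by (auto simp: B_def)
  have "\<forall>b\<in>K. \<exists>U. U \<in> \<U> \<and> basic b \<subseteq> U" using K(2) by (auto simp: B_def)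
  then obtain g where g: "\<And>b. b \<in> K \<Longrightarrow> g b \<in> \<U> \<and> basic b \<subseteq> g b"
    using bchoice[of K "\<lambda>b U. U \<in> \<U> \<and> basic b \<subseteq> U"] by blast
  have "basic a \<subseteq> \<Union>(basic ` K)"
    using basic_subset_iff[OF a, of "\<Union>L \<inter> \<Inter>K"] set_lattice_finite_Inter[OF L K(1) KL] K(3)
      basic_finite_Inter[OF K(1) KL] by simp
  then show "\<exists>\<F>. finite \<F> \<and> \<F> \<subseteq> \<U> \<and> basic a \<subseteq> \<Union>\<F>"
  proof (intro exI conjI)
    show "finite (g ` K)" using K(1) by simp
    show "g ` K \<subseteq> \<U>" using g by blast
    have "\<Union>(basic ` K) \<subseteq> \<Union>(g ` K)" using g by blast
    then show "basic a \<subseteq> \<Union>(g ` K)"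
      using \<open>basic a \<subseteq> \<Union>(basic ` K)\<close> by (rule subset_trans[rotated])
  qed
qed

lemma compact_opens_stone: "compact_opens X = basic ` L"
proof
  show "basic ` L \<subseteq> compact_opens X"
    using openin_basic compactin_basic by (auto simp: compact_opens_def)
  show "compact_opens X \<subseteq> basic ` L"
  proof
    fix U assume "U \<in> compact_opens X"
    then have U: "openin X U" "compactin X U" by (auto simp: compact_opens_def)
    define \<U> where "\<U> = {basic b |b. b \<in> L \<and> basic b \<subseteq> U}"
    have "\<forall>V\<in>\<U>. openin X V" "U \<subseteq> \<Union>\<U>"
      using U(1) openin_basic unfolding \<U>_def openin_stone_iff[of U] by blast+
    then obtain \<F> where F: "finite \<F>" "\<F> \<subseteq> \<U>" "U \<subseteq> \<Union>\<F>"
      using U(2) unfolding compactin_def by meson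
    have "\<F> \<subseteq> basic ` {b \<in> L. basic b \<subseteq> U}" using F(2) by (auto simp: \<U>_def)
    from finite_subset_image[OF F(1) this] obtain K
      where K: "K \<subseteq> {b \<in> L. basic b \<subseteq> U}" "finite K" "\<F> = basic ` K" by auto
    have "\<Union>(basic ` K) \<subseteq> U" using K(1) by blast
    then have "U = \<Union>(basic ` K)" using F(3) K(3) by simp
    moreover have "K \<subseteq> L" using K(1) by blast
    ultimately show "U \<in> basic ` L"
      using basic_finite_Inter[OF K(2)] set_lattice_finite_Inter[OF L K(2)] by blast
  qed
qed

text \<open>
The generic point of an irreducible closed set is the intersection of all its prime filters;
irreducibility says precisely that this intersection is prime.
\<close>

lemma sober_stone: "sober_space X"
  unfolding sober_space_def
proof (intro allI impI)
  fix C assume irr: "irreducible_closed X C"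
  then have C: "closedin X C" "C \<noteq> {}"
    and split: "\<And>D E. closedin X D \<Longrightarrow> closedin X E \<Longrightarrow> C = D \<union> E \<Longrightarrow> C = D \<or> C = E"
    unfolding irreducible_closed_def by blast+
  have CX: "C \<subseteq> topspace X" using C(1) by (rule closedin_subset)
  define G where "G = {a \<in> L. \<forall>x\<in>C. a \<in> h x}"
  have pf: "prime_filter L (h x)" if "x \<in> C" for x using that CX prime_filter_stone by blast
  have "prime_filter L G"
    unfolding prime_filter_def
  proof (intro conjI ballI impI)
    show "G \<subseteq> L" by (auto simp: G_def)
    have "\<Union>L \<in> h x" if "x \<in> C" for x
      using prime_filter_finite_Inter[OF L pf[OF that], of "{}"] by simp
    then show "G \<noteq> {}" using L by (auto simp: G_def set_lattice_def)
    show "{} \<notin> G" using C(2) pf by (auto simp: G_def prime_filter_def)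
    show "b \<in> G" if "a \<in> G" "b \<in> L" "a \<subseteq> b" for a b
      using that pf unfolding G_def prime_filter_def by blast
    show "a \<inter> b \<in> G" if "a \<in> G" "b \<in> G" for a b
      using that pf L unfolding G_def prime_filter_def set_lattice_def by blast
    show "a \<in> G \<or> b \<in> G" if ab: "a \<in> L" "b \<in> L" "a \<union> b \<in> G" for a b
    proof -
      have cl: "closedin X (C - basic c)" if "c \<in> L" for c
        using C(1) openin_basic[OF that] by (rule closedin_diff)
      have "C \<inter> basic (a \<union> b) = {}" using ab(3) by (auto simp: G_def basic_def)
      then have "C = (C - basic a) \<union> (C - basic b)" using basic_Un[OF ab(1,2)] by blast
      then have "C = C - basic a \<or> C = C - basic b"
        by (rule split[OF cl[OF ab(1)] cl[OF ab(2)]])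
      then show ?thesis using ab CX by (auto simp: G_def basic_def)
    qed
  qed
  then obtain g where g: "g \<in> topspace X" "h g = G" by (rule stone_surj)
  have closure: "X closure_of {x} = {y \<in> topspace X. h x \<subseteq> h y}" if x: "x \<in> topspace X" for x
  proof -
    have "(\<forall>T. y \<in> T \<and> openin X T \<longrightarrow> x \<in> T) \<longleftrightarrow> h x \<subseteq> h y" if y: "y \<in> topspace X" for y
    proof
      assume T: "\<forall>T. y \<in> T \<and> openin X T \<longrightarrow> x \<in> T"
      show "h x \<subseteq> h y"
      proof
        fix a assume a: "a \<in> h x"
        then have "a \<in> L" using prime_filter_stone[OF x] by (auto simp: prime_filter_def)
        then show "a \<in> h y" using T[rule_format, of "basic a"] openin_basic a y
          by (auto simp: basic_def)
      qed
    next
      assume "h x \<subseteq> h y"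
      then show "\<forall>T. y \<in> T \<and> openin X T \<longrightarrow> x \<in> T"
        unfolding openin_stone_iff using x by (fastforce simp: basic_def)
    qed
    then show ?thesis unfolding closure_of_def by blast
  qed
  have "X closure_of {g} = C"
  proof
    show "C \<subseteq> X closure_of {g}" using CX closure[OF g(1)] g(2) by (auto simp: G_def)
    show "X closure_of {g} \<subseteq> C"
    proof
      fix y assume "y \<in> X closure_of {g}"
      then have y: "y \<in> topspace X" "G \<subseteq> h y" using closure[OF g(1)] g(2) by auto
      show "y \<in> C"
      proof (rule ccontr)
        assume "y \<notin> C"
        moreover have "openin X (topspace X - C)" using C(1) by blast
        ultimately obtain a where a: "a \<in> L" "y \<in> basic a" "basic a \<subseteq> topspace X - C"
          using y(1) unfolding openin_stone_iff by blast
        then have "a \<in> G" using CX by (auto simp: G_def basic_def)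
        then show False using a(2) y(2) by (auto simp: basic_def)
      qed
    qed
  qed
  moreover have "x = g" if "x \<in> topspace X" "C = X closure_of {x}" for x
  proof -
    have "{y \<in> topspace X. h x \<subseteq> h y} = {y \<in> topspace X. h g \<subseteq> h y}"
      using closure g(1) that \<open>X closure_of {g} = C\<close> by blast
    then have "h x = h g" using that(1) g(1) by blast
    moreover have "inj_on h (topspace X)" using st by (auto simp: stone_map_def bij_betw_def)
    ultimately show ?thesis using that(1) g(1) by (auto dest: inj_onD)
  qed
  ultimately show "\<exists>!x. x \<in> topspace X \<and> C = X closure_of {x}" using g(1) by blast
qed

lemma spectral_stone: "spectral_space X"
  unfolding spectral_space_def compact_opens_stone
proof (intro conjI allI impI ballI)
  show "sober_space X" by (rule sober_stone)
  show "compact_space X"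
    using compactin_basic[of "{}"] L basic_empty by (simp add: set_lattice_def compact_space_def)
  show "\<exists>\<B>\<subseteq>basic ` L. U = \<Union>\<B>" if "openin X U" for U
    using that unfolding openin_stone_iff
    by (intro exI[of _ "{V \<in> basic ` L. V \<subseteq> U}"]) blast
  fix U V assume "U \<in> basic ` L" "V \<in> basic ` L"
  then obtain a b where ab: "a \<in> L" "b \<in> L" "U = basic a" "V = basic b" by auto
  then have "U \<inter> V = basic (a \<union> b)" by (simp add: basic_Un)
  moreover have "a \<union> b \<in> L" using L ab by (simp add: set_lattice_def)
  ultimately show "U \<inter> V \<in> basic ` L" by simp
qed

lemma anti_isomorphic_stone: "anti_isomorphic (compact_opens X) L"
proof -
  have inj: "inj_on basic L"
    by (intro inj_onI) (simp add: set_eq_subset basic_subset_iff)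
  have "bij_betw (inv_into L basic) (basic ` L) L" 
    using inj by (simp add: bij_betw_inv_into inj_on_imp_bij_betw)
  moreover have "basic a \<subseteq> basic b \<longleftrightarrow>
      inv_into L basic (basic b) \<subseteq> inv_into L basic (basic a)"
    if "a \<in> L" "b \<in> L" for a b
    using that inj basic_subset_iff by simp
  ultimately show ?thesis unfolding anti_isomorphic_def compact_opens_stone by blast
qed

end

text \<open>
A point \<open>x\<close> is sent to the images of the compact open sets that omit \<open>x\<close>. Given a prime filter \<open>F\<close>,
remove from \<open>X\<close> all compact open sets with image in \<open>F\<close>. What is left is closed, and it is irreducible
because \<open>F\<close> is prime; its generic point, provided by sobriety, is sent to \<open>F\<close>. Uniqueness of generic
points makes the map injective.
\<close>

lemma stone_map_exists:
  assumes L: "set_lattice L" and sp: "spectral_space X"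
    and iso: "anti_isomorphic (compact_opens X) L"
  shows "\<exists>h. stone_map X L h"
proof -
  let ?K = "compact_opens X"
  obtain \<theta> where bij: "bij_betw \<theta> ?K L"
    and ord: "\<And>U V. U \<in> ?K \<Longrightarrow> V \<in> ?K \<Longrightarrow> U \<subseteq> V \<longleftrightarrow> \<theta> V \<subseteq> \<theta> U"
    using iso by (auto simp: anti_isomorphic_def)
  have \<theta>L: "\<theta> U \<in> L" if "U \<in> ?K" for U using bij that by (auto simp: bij_betw_def)
  have surj: "\<exists>U\<in>?K. \<theta> U = a" if "a \<in> L" for a using bij that by (auto simp: bij_betw_def)
  have inj: "\<theta> U = \<theta> V \<Longrightarrow> U = V" if "U \<in> ?K" "V \<in> ?K" for U V
    using bij that by (auto simp: bij_betw_def dest: inj_onD)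
  have sober: "sober_space X" and comp: "compact_space X"
    and base: "\<And>U. openin X U \<Longrightarrow> \<exists>\<B>\<subseteq>?K. U = \<Union>\<B>"
    and cap: "\<And>U V. U \<in> ?K \<Longrightarrow> V \<in> ?K \<Longrightarrow> U \<inter> V \<in> ?K"
    using sp by (auto simp: spectral_space_def)
  have KX: "U \<subseteq> topspace X" "openin X U" "compactin X U" if "U \<in> ?K" for U
    using that by (auto simp: compact_opens_def dest: openin_subset)
  have top: "topspace X \<in> ?K" using comp by (simp add: compact_opens_def compact_space_def)
  have cup: "U \<union> V \<in> ?K" if "U \<in> ?K" "V \<in> ?K" for U V
    using that by (auto simp: compact_opens_def compactin_Un)
  have \<theta>_Un: "\<theta> (U \<union> V) = \<theta> U \<inter> \<theta> V" if UV: "U \<in> ?K" "V \<in> ?K" for U V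
  proof
    show "\<theta> (U \<union> V) \<subseteq> \<theta> U \<inter> \<theta> V" using ord cup UV by (metis Un_upper1 Un_upper2 le_inf_iff)
    have "\<theta> U \<inter> \<theta> V \<in> L" using \<theta>L UV L by (auto simp: set_lattice_def)
    then obtain W where W: "W \<in> ?K" "\<theta> W = \<theta> U \<inter> \<theta> V" using surj by blast
    then have "U \<union> V \<subseteq> W" using ord UV by auto
    then show "\<theta> U \<inter> \<theta> V \<subseteq> \<theta> (U \<union> V)" using ord cup UV W by metis
  qed
  have \<theta>_Int: "\<theta> (U \<inter> V) = \<theta> U \<union> \<theta> V" if UV: "U \<in> ?K" "V \<in> ?K" for U V
  proof
    show "\<theta> U \<union> \<theta> V \<subseteq> \<theta> (U \<inter> V)" using ord cap UV by (metis Int_lower1 Int_lower2 Un_least)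
    have "\<theta> U \<union> \<theta> V \<in> L" using \<theta>L UV L by (auto simp: set_lattice_def)
    then obtain W where W: "W \<in> ?K" "\<theta> W = \<theta> U \<union> \<theta> V" using surj by blast
    then have "W \<subseteq> U \<inter> V" using ord UV by auto
    then show "\<theta> (U \<inter> V) \<subseteq> \<theta> U \<union> \<theta> V" using ord cap UV W by metis
  qed
  have \<theta>_top: "\<theta> (topspace X) = {}"
  proof -
    obtain U where "U \<in> ?K" "\<theta> U = {}" using surj[of "{}"] L by (auto simp: set_lattice_def)
    then show ?thesis using ord[OF _ top, of U] KX(1)[of U] by simp
  qed
  define h where "h x = \<theta> ` {U \<in> ?K. x \<notin> U}" for x
  have h_iff: "\<theta> U \<in> h x \<longleftrightarrow> x \<notin> U" if "U \<in> ?K" for U x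
    using that inj by (auto simp: h_def)
  have pf: "prime_filter L (h x)" if x: "x \<in> topspace X" for x
    unfolding prime_filter_def
  proof (intro conjI ballI impI)
    show "h x \<subseteq> L" using \<theta>L by (auto simp: h_def)
    have "{} \<in> ?K" by (simp add: compact_opens_def)
    then show "h x \<noteq> {}" using h_iff[of "{}" x] by auto
    show "{} \<notin> h x" using h_iff[OF top, of x] x \<theta>_top by simp
    show "b \<in> h x" if "a \<in> h x" "b \<in> L" "a \<subseteq> b" for a b
    proof -
      obtain U V where "U \<in> ?K" "\<theta> U = a" "V \<in> ?K" "\<theta> V = b" "x \<notin> U"
        using \<open>a \<in> h x\<close> surj[OF \<open>b \<in> L\<close>] by (auto simp: h_def)
      then show ?thesis using ord[of V U] h_iff[of V x] that(3) by blast
    qed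
    show "a \<inter> b \<in> h x" if ab: "a \<in> h x" "b \<in> h x" for a b
    proof -
      obtain U V where "U \<in> ?K" "\<theta> U = a" "V \<in> ?K" "\<theta> V = b" "x \<notin> U" "x \<notin> V"
        using ab by (auto simp: h_def)
      then show ?thesis using \<theta>_Un[of U V] h_iff[OF cup, of U V x] by auto
    qed
    show "a \<in> h x \<or> b \<in> h x" if ab: "a \<in> L" "b \<in> L" "a \<union> b \<in> h x" for a b
    proof -
      obtain U V where "U \<in> ?K" "\<theta> U = a" "V \<in> ?K" "\<theta> V = b" using surj ab by metis
      then show ?thesis
        using ab \<theta>_Int[of U V] h_iff[OF cap, of U V x] h_iff[of U x] h_iff[of V x] by auto
    qed
  qed
  have closure_K: "x \<in> U \<longleftrightarrow> X closure_of {x} \<inter> U \<noteq> {}" if "x \<in> topspace X" "openin X U" for x U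
  proof -
    have "{x} \<inter> U = {} \<longleftrightarrow> X closure_of {x} \<inter> U = {}"
      using openin_Int_closure_of_eq_empty[OF that(2), of "{x}"] by (simp add: Int_commute)
    then show ?thesis by auto
  qed
  have "inj_on h (topspace X)"
  proof (rule inj_onI)
    fix x y assume xy: "x \<in> topspace X" "y \<in> topspace X" "h x = h y"
    have same: "x \<in> U \<longleftrightarrow> y \<in> U" if "U \<in> ?K" for U using h_iff[OF that] xy(3) by blast
    have same': "x \<in> U \<longleftrightarrow> y \<in> U" if "openin X U" for U using base[OF that] same by blast
    have eq: "X closure_of {x} = X closure_of {y}"
      unfolding closure_of_def using same' by auto
    have "irreducible_closed X (X closure_of {x})"
      unfolding irreducible_closed_def
    proof (intro conjI allI impI)
      show "X closure_of {x} \<noteq> {}" using closure_of_eq_empty[of "{x}" X] xy(1) by auto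
    next
      fix D E assume DE: "closedin X D \<and> closedin X E \<and> X closure_of {x} = D \<union> E"
      have "x \<in> X closure_of {x}" using xy(1) by (simp add: in_closure_of)
      then have "x \<in> D \<or> x \<in> E" using DE by blast
      then show "X closure_of {x} = D \<or> X closure_of {x} = E"
        using closure_of_minimal[of "{x}" D X] closure_of_minimal[of "{x}" E X] DE by blast
    qed simp
    then show "x = y" using sober eq xy(1,2) unfolding sober_space_def by metis
  qed
  moreover have "\<exists>x\<in>topspace X. h x = F" if F: "prime_filter L F" for F
  proof -
    define \<U> where "\<U> = {U \<in> ?K. \<theta> U \<in> F}"
    define C where "C = topspace X - \<Union>\<U>"
    have FL: "F \<subseteq> L" "{} \<notin> F" and Fup: "\<And>a b. a \<in> F \<Longrightarrow> b \<in> L \<Longrightarrow> a \<subseteq> b \<Longrightarrow> b \<in> F"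
      and Fint: "\<And>a b. a \<in> F \<Longrightarrow> b \<in> F \<Longrightarrow> a \<inter> b \<in> F"
      and Fun: "\<And>a b. a \<in> L \<Longrightarrow> b \<in> L \<Longrightarrow> a \<union> b \<in> F \<Longrightarrow> a \<in> F \<or> b \<in> F"
      and Fne: "F \<noteq> {}"
      using F unfolding prime_filter_def by auto
    have \<U>_open: "openin X U" if "U \<in> \<U>" for U using that KX by (auto simp: \<U>_def)
    have \<U>_Un: "U \<union> V \<in> \<U>" if "U \<in> \<U>" "V \<in> \<U>" for U V
      using that cup \<theta>_Un Fint by (auto simp: \<U>_def)
    have \<U>_ne: "{} \<in> \<U>"
    proof -
      obtain a where a: "a \<in> F" using Fne by blast
      then obtain U where "U \<in> ?K" "\<theta> U = a" using surj FL(1) by blast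
      moreover have "{} \<in> ?K" by (simp add: compact_opens_def)
      ultimately show ?thesis using ord[of "{}" U] Fup[OF a \<theta>L] by (auto simp: \<U>_def)
    qed
    have \<U>_fin: "\<Union>\<F> \<in> \<U>" if "finite \<F>" "\<F> \<subseteq> \<U>" for \<F>
      using that by (induction \<F>) (auto simp: \<U>_ne \<U>_Un)
    have \<U>_iff: "U \<in> \<U> \<longleftrightarrow> U \<inter> C = {}" if U: "U \<in> ?K" for U
    proof
      assume "U \<inter> C = {}"
      then have "U \<subseteq> \<Union>\<U>" using KX(1)[OF U] by (auto simp: C_def)
      then obtain \<F> where \<F>: "finite \<F>" "\<F> \<subseteq> \<U>" "U \<subseteq> \<Union>\<F>"
        using KX(3)[OF U] \<U>_open unfolding compactin_def by meson
      then have W: "\<Union>\<F> \<in> ?K" "\<theta> (\<Union>\<F>) \<in> F" using \<U>_fin by (auto simp: \<U>_def)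
      then have "\<theta> U \<in> F" using ord[OF U W(1)] Fup[OF W(2) \<theta>L[OF U]] \<F>(3) by blast
      then show "U \<in> \<U>" using U by (simp add: \<U>_def)
    qed (auto simp: C_def)
    have clC: "closedin X C" unfolding C_def using \<U>_open by auto
    have "irreducible_closed X C"
      unfolding irreducible_closed_def
    proof (intro conjI allI impI)
      show "closedin X C" by fact
      have "topspace X \<notin> \<U>" using \<theta>_top FL by (simp add: \<U>_def)
      then show "C \<noteq> {}" using \<U>_iff[OF top] by blast
    next
      fix D E assume DE: "closedin X D \<and> closedin X E \<and> C = D \<union> E"
      show "C = D \<or> C = E"
      proof (rule ccontr)
        assume "\<not> (C = D \<or> C = E)"
        then obtain x y where xy: "x \<in> C" "x \<notin> D" "y \<in> C" "y \<notin> E" using DE by blast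
        have xyX: "x \<in> topspace X" "y \<in> topspace X" using xy by (auto simp: C_def)
        have "openin X (topspace X - D)" "openin X (topspace X - E)" using DE by blast+
        then obtain U V where UV: "U \<in> ?K" "x \<in> U" "U \<inter> D = {}" "V \<in> ?K" "y \<in> V" "V \<inter> E = {}"
          using base[of "topspace X - D"] base[of "topspace X - E"] xy xyX by blast
        then have "U \<inter> V \<in> \<U>" using \<U>_iff[OF cap] DE by blast
        then have "\<theta> U \<union> \<theta> V \<in> F" using \<theta>_Int UV by (simp add: \<U>_def)
        then have "U \<in> \<U> \<or> V \<in> \<U>" using Fun \<theta>L UV by (auto simp: \<U>_def)
        then show False using \<U>_iff UV xy by blast
      qed
    qed
    then obtain x where x: "x \<in> topspace X" "C = X closure_of {x}"
      using sober unfolding sober_space_def by metis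
    have "U \<in> \<U> \<longleftrightarrow> x \<notin> U" if "U \<in> ?K" for U
      using \<U>_iff[OF that] closure_K[OF x(1) KX(2)[OF that]] x(2) by blast
    then have "{U \<in> ?K. x \<notin> U} = {U \<in> ?K. \<theta> U \<in> F}" by (auto simp: \<U>_def)
    then have "h x = \<theta> ` {U \<in> ?K. \<theta> U \<in> F}" by (simp add: h_def)
    also have "\<dots> = F" using surj FL(1) by (auto simp: image_iff)
    finally show ?thesis using x(1) by blast
  qed
  ultimately have "bij_betw h (topspace X) {F. prime_filter L F}"
    using pf unfolding bij_betw_def by blast
  moreover have "openin X U \<longleftrightarrow> U \<subseteq> topspace X \<and>
      (\<forall>x\<in>U. \<exists>a\<in>L. a \<notin> h x \<and> {y \<in> topspace X. a \<notin> h y} \<subseteq> U)" for U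
  proof -
    have pre: "{y \<in> topspace X. \<theta> V \<notin> h y} = V" if "V \<in> ?K" for V
      using h_iff[OF that] KX(1)[OF that] by blast
    have eq: "x \<in> V \<and> V \<subseteq> U \<longleftrightarrow> \<theta> V \<notin> h x \<and> {y \<in> topspace X. \<theta> V \<notin> h y} \<subseteq> U"
      if "V \<in> ?K" for x V
      unfolding pre[OF that] by (simp add: h_iff[OF that])
    have "openin X U \<longleftrightarrow> U \<subseteq> topspace X \<and> (\<forall>x\<in>U. \<exists>V\<in>?K. x \<in> V \<and> V \<subseteq> U)"
    proof
      assume U: "openin X U"
      then obtain \<B> where "\<B> \<subseteq> ?K" "U = \<Union>\<B>" using base by blast
      then show "U \<subseteq> topspace X \<and> (\<forall>x\<in>U. \<exists>V\<in>?K. x \<in> V \<and> V \<subseteq> U)"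
        using openin_subset[OF U] by blast
    next
      assume "U \<subseteq> topspace X \<and> (\<forall>x\<in>U. \<exists>V\<in>?K. x \<in> V \<and> V \<subseteq> U)"
      then show "openin X U" using KX(2) by (subst openin_subopen) blast
    qed
    also have "\<dots> \<longleftrightarrow> U \<subseteq> topspace X \<and>
        (\<forall>x\<in>U. \<exists>V\<in>?K. \<theta> V \<notin> h x \<and> {y \<in> topspace X. \<theta> V \<notin> h y} \<subseteq> U)"
      using eq by (intro conj_cong[OF refl] ball_cong[OF refl] bex_cong[OF refl])
    also have "\<dots> \<longleftrightarrow> U \<subseteq> topspace X \<and>
        (\<forall>x\<in>U. \<exists>a\<in>\<theta> ` ?K. a \<notin> h x \<and> {y \<in> topspace X. a \<notin> h y} \<subseteq> U)"
      by (simp only: bex_simps)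
    also have "\<theta> ` ?K = L" using bij by (simp add: bij_betw_def)
    finally show ?thesis .
  qed
  ultimately show ?thesis unfolding stone_map_def by blast
qed

lemma openin_stone_image_iff:
  assumes Y: "stone_map Y L k" and f: "bij_betw f (topspace X) (topspace Y)" and U: "U \<subseteq> topspace X"
  shows "openin Y (f ` U) \<longleftrightarrow> (\<forall>x\<in>U. \<exists>a\<in>L. a \<notin> k (f x) \<and> {y \<in> topspace X. a \<notin> k (f y)} \<subseteq> U)"
proof -
  have tY: "topspace Y = f ` topspace X" using f by (simp add: bij_betw_def)
  have "{y \<in> topspace Y. a \<notin> k y} \<subseteq> f ` U \<longleftrightarrow> {y \<in> topspace X. a \<notin> k (f y)} \<subseteq> U" for a
  proof -
    have "{y \<in> topspace Y. a \<notin> k y} = f ` {y \<in> topspace X. a \<notin> k (f y)}" by (auto simp: tY)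
    moreover have "{y \<in> topspace X. a \<notin> k (f y)} \<subseteq> U"
      if sub: "f ` {y \<in> topspace X. a \<notin> k (f y)} \<subseteq> f ` U"
    proof
      fix y assume y: "y \<in> {y \<in> topspace X. a \<notin> k (f y)}"
      then have "f y \<in> f ` U" using sub by blast
      then show "y \<in> U"
        using y U f inj_on_image_mem_iff[of f "topspace X" y U] by (auto simp: bij_betw_def)
    qed
    ultimately show ?thesis by auto
  qed
  moreover have "openin Y (f ` U) \<longleftrightarrow>
      (\<forall>x\<in>U. \<exists>a\<in>L. a \<notin> k (f x) \<and> {y \<in> topspace Y. a \<notin> k y} \<subseteq> f ` U)"
    using Y U unfolding stone_map_def by (auto simp: tY)
  ultimately show ?thesis by simp
qed

lemma stone_map_homeomorphic_iff:
  assumes Y: "stone_map Y L k"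
  shows "X homeomorphic_space Y \<longleftrightarrow> (\<exists>h. stone_map X L h)"
proof
  assume "X homeomorphic_space Y"
  then obtain f where f: "homeomorphic_map X Y f" by (auto simp: homeomorphic_space)
  then have fb: "bij_betw f (topspace X) (topspace Y)"
    by (simp add: bij_betw_def homeomorphic_imp_injective_map homeomorphic_imp_surjective_map)
  then have "bij_betw (k \<circ> f) (topspace X) {F. prime_filter L F}"
    using Y by (auto simp: stone_map_def intro: bij_betw_trans)
  moreover have "openin X U \<longleftrightarrow> U \<subseteq> topspace X \<and>
      (\<forall>x\<in>U. \<exists>a\<in>L. a \<notin> (k \<circ> f) x \<and> {y \<in> topspace X. a \<notin> (k \<circ> f) y} \<subseteq> U)" for U
    using openin_stone_image_iff[OF Y fb, of U] homeomorphic_map_openness[OF f, of U]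
      openin_subset[of X U] by auto
  ultimately show "\<exists>h. stone_map X L h" unfolding stone_map_def by blast
next
  assume "\<exists>h. stone_map X L h"
  then obtain h where h: "stone_map X L h" by blast
  have hb: "bij_betw h (topspace X) {F. prime_filter L F}"
    and kb: "bij_betw k (topspace Y) {F. prime_filter L F}"
    using h Y by (auto simp: stone_map_def)
  define f where "f = inv_into (topspace Y) k \<circ> h"
  have fb: "bij_betw f (topspace X) (topspace Y)"
    unfolding f_def by (rule bij_betw_trans[OF hb bij_betw_inv_into[OF kb]])
  have kf: "k (f x) = h x" if "x \<in> topspace X" for x
  proof -
    have "h x \<in> k ` topspace Y" using that hb kb by (auto simp: bij_betw_def)
    then show ?thesis by (simp add: f_def f_inv_into_f)
  qed
  have open_iff: "openin X U \<longleftrightarrow> openin Y (f ` U)" if U: "U \<subseteq> topspace X" for U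
  proof -
    have eq: "{y \<in> topspace X. a \<notin> k (f y)} = {y \<in> topspace X. a \<notin> h y}" for a
      using kf by auto
    have "openin Y (f ` U) \<longleftrightarrow> (\<forall>x\<in>U. \<exists>a\<in>L. a \<notin> h x \<and> {y \<in> topspace X. a \<notin> h y} \<subseteq> U)"
      unfolding openin_stone_image_iff[OF Y fb U] eq
      by (intro ball_cong refl) (simp add: kf subsetD[OF U])
    then show ?thesis using h U by (simp add: stone_map_def)
  qed
  have "homeomorphic_map X Y f"
  proof (rule bijective_open_imp_homeomorphic_map)
    show "continuous_map X Y f"
      unfolding continuous_map_def
    proof (intro conjI allI impI)
      show "f \<in> topspace X \<rightarrow> topspace Y" using fb by (auto simp: bij_betw_def)
      fix V assume V: "openin Y V"
      have "f ` {x \<in> topspace X. f x \<in> V} = V"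
        using openin_subset[OF V] fb by (auto simp: bij_betw_def)
      then show "openin X {x \<in> topspace X. f x \<in> V}"
        using open_iff[of "{x \<in> topspace X. f x \<in> V}"] V by simp
    qed
    show "open_map X Y f" unfolding open_map_def using open_iff openin_subset by blast
  qed (use fb in \<open>auto simp: bij_betw_def\<close>)
  then show "X homeomorphic_space Y" by (rule homeomorphic_map_imp_homeomorphic_space)
qed

theorem homeomorphic_iff_anti_isomorphic:
  assumes L: "set_lattice L" and Y: "stone_map Y L k"
  shows "X homeomorphic_space Y \<longleftrightarrow>
         spectral_space X \<and> anti_isomorphic (compact_opens X) L"
  using stone_map_homeomorphic_iff[OF Y, of X] stone_map_exists[OF L, of X]
    spectral_stone[OF L, of X] anti_isomorphic_stone[OF L, of X] by blast

section \<open>Rational linear forms\<close>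

definition lin :: "'k set \<Rightarrow> ('k \<Rightarrow> rat) \<Rightarrow> ('k \<Rightarrow> real) \<Rightarrow> real" where
  "lin F a x = (\<Sum>i\<in>F. of_rat (a i) * x i)"

definition rational_vector :: "'k set \<Rightarrow> ('k \<Rightarrow> real) \<Rightarrow> bool" where
  "rational_vector F x \<longleftrightarrow> (\<forall>i\<in>F. x i \<in> \<rat>)"

lemma lin_add: "lin F a (\<lambda>i. x i + y i) = lin F a x + lin F a y"
  by (simp add: lin_def algebra_simps sum.distrib)

lemma lin_scale: "lin F a (\<lambda>i. c * x i) = c * lin F a x"
  by (simp add: lin_def sum_distrib_left algebra_simps)

lemma lin_diff_scale: "lin F a (\<lambda>i. x i - c * y i) = lin F a x - c * lin F a y"
  by (simp add: lin_def sum_distrib_left algebra_simps sum_subtractf)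

lemma lin_sum: "lin F a (\<lambda>i. \<Sum>s\<in>S. c s * s i) = (\<Sum>s\<in>S. c s * lin F a s)"
  unfolding lin_def sum_distrib_left
  by (subst sum.swap) (simp add: algebra_simps)

lemma lin_cong: "(\<And>i. i \<in> F \<Longrightarrow> x i = y i) \<Longrightarrow> lin F a x = lin F a y"
  by (simp add: lin_def)

lemma lin_restrict: "lin F a (\<lambda>i\<in>F. x i) = lin F a x"
  by (rule lin_cong) simp

lemma lin_zero: "lin F a (\<lambda>i. 0) = 0"
  by (simp add: lin_def)

lemma lin_add_form: "lin F (\<lambda>i. a i + b i) x = lin F a x + lin F b x"
  by (simp add: lin_def algebra_simps sum.distrib of_rat_add)

lemma lin_uminus_form: "lin F (\<lambda>i. - a i) x = - lin F a x"
  by (simp add: lin_def of_rat_minus sum_negf)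

lemma lin_zero_form: "lin F (\<lambda>i. 0) x = 0"
  by (simp add: lin_def)

lemma lin_scale_form: "lin F (\<lambda>i. q * a i) x = of_rat q * lin F a x"
  by (simp add: lin_def sum_distrib_left of_rat_mult algebra_simps)

lemma lin_unit_form:
  "finite F \<Longrightarrow> j \<in> F \<Longrightarrow> lin F (\<lambda>i. if i = j then 1 else 0) x = x j"
  unfolding lin_def by (subst sum.remove[of _ j]) (auto intro: sum.neutral)

lemma lin_rational: "rational_vector F x \<Longrightarrow> lin F a x \<in> \<rat>"
  unfolding lin_def rational_vector_def by (induction F rule: infinite_finite_induct) auto

lemma lin_dist_le:
  assumes "\<forall>i\<in>F. \<bar>y i - x i\<bar> < e"
  shows "\<bar>lin F a y - lin F a x\<bar> \<le> (\<Sum>i\<in>F. \<bar>of_rat (a i)\<bar>) * e"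
proof -
  have "\<bar>lin F a y - lin F a x\<bar> = \<bar>\<Sum>i\<in>F. of_rat (a i) * (y i - x i)\<bar>"
    by (simp add: lin_def sum_subtractf algebra_simps)
  also have "\<dots> \<le> (\<Sum>i\<in>F. \<bar>of_rat (a i)\<bar> * e)"
  proof (rule order_trans[OF sum_abs sum_mono])
    fix i assume "i \<in> F"
    then have "\<bar>of_rat (a i) :: real\<bar> * \<bar>y i - x i\<bar> \<le> \<bar>of_rat (a i)\<bar> * e"
      using assms by (intro mult_left_mono) (auto intro: less_imp_le)
    then show "\<bar>of_rat (a i) * (y i - x i)\<bar> \<le> \<bar>of_rat (a i)\<bar> * e"
      by (simp only: abs_mult)
  qed
  finally show ?thesis by (simp only: sum_distrib_right)
qed

text \<open>
A real vector has rational vectors arbitrarily close to it that satisfy all its rational linear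
relations. By induction on the coordinates: a coordinate that is a rational combination of the
earlier ones is approximated by the same combination of their approximations, and any other
coordinate occurs in no relation, so that every nearby rational number will do.
\<close>

lemma rational_approx_relations:
  assumes "finite F" "\<epsilon> > 0"
  shows "\<exists>y. rational_vector F y \<and> (\<forall>i\<in>F. \<bar>y i - x i\<bar> < \<epsilon>) \<and>
             (\<forall>a. lin F a x = 0 \<longrightarrow> lin F a y = 0)"
  using assms
proof (induction F arbitrary: \<epsilon>)
  case empty
  then show ?case by (simp add: rational_vector_def lin_def)
next
  case (insert j F)
  have split: "lin (insert j F) a z = of_rat (a j) * z j + lin F a z" for a and z :: "'a \<Rightarrow> real"
    using insert.hyps by (simp add: lin_def)
  show ?case
  proof (cases "\<exists>q. x j = lin F q x")
    case True
    then obtain q where q: "x j = lin F q x" by blast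
    \<comment> \<open>The combination \<open>q\<close> magnifies errors by less than \<open>M\<close>.\<close>
    define M :: real where "M = (\<Sum>i\<in>F. \<bar>of_rat (q i)\<bar>) + 1"
    have M: "M \<ge> 1" by (simp add: M_def sum_nonneg)
    obtain y where y: "rational_vector F y" "\<forall>i\<in>F. \<bar>y i - x i\<bar> < \<epsilon> / M"
        "\<forall>a. lin F a x = 0 \<longrightarrow> lin F a y = 0"
      using insert.IH[of "\<epsilon> / M"] insert.prems M by auto
    define z where "z = y(j := lin F q y)"
    have zF: "lin F a z = lin F a y" for a
      using insert.hyps by (intro lin_cong) (auto simp: z_def)
    have "rational_vector (insert j F) z"
      using y(1) lin_rational[OF y(1), of q] insert.hyps by (auto simp: rational_vector_def z_def)
    moreover have "\<bar>z i - x i\<bar> < \<epsilon>" if "i \<in> insert j F" for i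
    proof (cases "i = j")
      case True
      have "\<bar>lin F q y - lin F q x\<bar> \<le> (\<Sum>i\<in>F. \<bar>of_rat (q i)\<bar>) * (\<epsilon> / M)"
        by (rule lin_dist_le[OF y(2)])
      also have "\<dots> = (M - 1) * (\<epsilon> / M)" by (simp only: M_def add_diff_cancel)
      also have "\<dots> < \<epsilon>" using M insert.prems by (simp add: field_simps)
      finally show ?thesis using True q by (simp add: z_def)
    next
      case False
      then have "\<bar>z i - x i\<bar> < \<epsilon> / M" using that y(2) by (simp add: z_def)
      also have "\<dots> \<le> \<epsilon>" using M insert.prems by (simp add: field_simps)
      finally show ?thesis .
    qed
    moreover have "lin (insert j F) a z = 0" if "lin (insert j F) a x = 0" for a
    proof -
      have *: "lin F (\<lambda>i. a j * q i + a i) w = of_rat (a j) * lin F q w + lin F a w"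
        for w :: "'a \<Rightarrow> real"
        by (simp add: lin_add_form lin_scale_form)
      have "lin F (\<lambda>i. a j * q i + a i) x = 0" using that q by (simp add: * split)
      then have "lin F (\<lambda>i. a j * q i + a i) y = 0" using y(3) by blast
      then show ?thesis by (simp add: * split zF) (simp add: z_def)
    qed
    ultimately show ?thesis by blast
  next
    case False
    obtain y where y: "rational_vector F y" "\<forall>i\<in>F. \<bar>y i - x i\<bar> < \<epsilon>"
        "\<forall>a. lin F a x = 0 \<longrightarrow> lin F a y = 0"
      using insert.IH[of "\<epsilon>"] insert.prems by auto
    obtain r where r: "r \<in> \<rat>" "x j < r" "r < x j + \<epsilon>"
      using Rats_dense_in_real[of "x j" "x j + \<epsilon>"] insert.prems by auto
    define z where "z = y(j := r)"
    have zF: "lin F a z = lin F a y" for a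
      using insert.hyps by (intro lin_cong) (auto simp: z_def)
    have "rational_vector (insert j F) z"
      using y(1) r(1) insert.hyps by (auto simp: rational_vector_def z_def)
    moreover have "\<bar>z i - x i\<bar> < \<epsilon>" if "i \<in> insert j F" for i
      using that r y(2) by (auto simp: z_def)
    moreover have "lin (insert j F) a z = 0" if a: "lin (insert j F) a x = 0" for a
    proof -
      have "a j = 0"
      proof (rule ccontr)
        assume "a j \<noteq> 0"
        then have "x j = lin F (\<lambda>i. (- 1 / a j) * a i) x"
          using a unfolding lin_scale_form split by (simp add: of_rat_divide of_rat_minus field_simps)
        then show False using False by blast
      qed
      then show ?thesis using a y(3) by (simp add: split zF)
    qed
    ultimately show ?thesis by blast
  qed
qed

text \<open>
Membership in the same cell of the hyperplane arrangement given by the forms \<open>H\<close>.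
\<close>

definition same_sign :: "'k set \<Rightarrow> ('k \<Rightarrow> rat) set \<Rightarrow> ('k \<Rightarrow> real) \<Rightarrow> ('k \<Rightarrow> real) \<Rightarrow> bool" where
  "same_sign F H x y \<longleftrightarrow> (\<forall>a\<in>H. sgn (lin F a x) = sgn (lin F a y))"

text \<open>
Every cell of a rational arrangement contains a rational point: forms that vanish are preserved as
relations, and the remaining ones keep their sign when the approximation is close enough.
\<close>

lemma rational_same_sign:
  assumes F: "finite F" and H: "finite H"
  obtains y where "rational_vector F y" "y \<in> F \<rightarrow>\<^sub>E UNIV" "same_sign F H x y"
proof -
  define M where "M = (\<Sum>a\<in>H. \<Sum>i\<in>F. \<bar>of_rat (a i)\<bar>) + (1::real)"
  have M: "M \<ge> 1" by (simp add: M_def sum_nonneg)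
  \<comment> \<open>Including \<open>1\<close> keeps the minimum \<open>d\<close> of the nonzero values defined if all of them vanish.\<close>
  define D where "D = insert 1 ((\<lambda>a. \<bar>lin F a x\<bar>) ` {a \<in> H. lin F a x \<noteq> 0})"
  define d where "d = Min D"
  have D: "finite D" "D \<noteq> {}" using H by (auto simp: D_def)
  have d: "d > 0" using D by (auto simp: d_def D_def)
  obtain y where y: "rational_vector F y" "\<forall>i\<in>F. \<bar>y i - x i\<bar> < d / M"
      "\<forall>a. lin F a x = 0 \<longrightarrow> lin F a y = 0"
    using rational_approx_relations[OF F, of "d / M" x] d M by auto
  have "sgn (lin F a x) = sgn (lin F a y)" if a: "a \<in> H" for a
  proof (cases "lin F a x = 0")
    case False
    have "\<bar>lin F a y - lin F a x\<bar> \<le> (\<Sum>i\<in>F. \<bar>of_rat (a i)\<bar>) * (d / M)"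
      by (rule lin_dist_le[OF y(2)])
    also have "\<dots> \<le> (M - 1) * (d / M)"
    proof (rule mult_right_mono)
      show "(\<Sum>i\<in>F. \<bar>of_rat (a i)\<bar>) \<le> M - 1"
        using member_le_sum[OF a _ H, of "\<lambda>a. \<Sum>i\<in>F. \<bar>of_rat (a i) :: real\<bar>"]
        by (simp add: M_def sum_nonneg)
    qed (use d M in auto)
    also have "\<dots> < d" using M d by (simp add: field_simps)
    also have "d \<le> \<bar>lin F a x\<bar>" unfolding d_def using D False a by (intro Min_le) (auto simp: D_def)
    finally show ?thesis by (auto simp: sgn_if split: if_splits)
  qed (use y(3) in simp)
  then have "same_sign F H x (\<lambda>i\<in>F. y i)"
    by (simp add: same_sign_def lin_restrict)
  moreover have "rational_vector F (\<lambda>i\<in>F. y i)" using y(1) by (simp add: rational_vector_def)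
  ultimately show ?thesis using that by simp
qed

section \<open>Faces of simplicial cones\<close>

lemma cone_gen_ext: "x \<in> cone_gen F S \<Longrightarrow> x \<in> F \<rightarrow>\<^sub>E UNIV"
  by (auto simp: cone_gen_def)

lemma cone_gen_mono:
  assumes "finite S" "T \<subseteq> S" shows "cone_gen F T \<subseteq> cone_gen F S"
proof
  fix x assume "x \<in> cone_gen F T"
  then obtain c where c: "\<forall>s\<in>T. 0 \<le> c s" "x = (\<lambda>i\<in>F. \<Sum>s\<in>T. c s * s i)"
    by (auto simp: cone_gen_def)
  have "(\<Sum>s\<in>S. (if s \<in> T then c s else 0) * s i) = (\<Sum>s\<in>T. c s * s i)" for i
    using assms by (intro sum.mono_neutral_cong_right) auto
  then have "x = (\<lambda>i\<in>F. \<Sum>s\<in>S. (if s \<in> T then c s else 0) * s i)" using c(2) by simp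
  then show "x \<in> cone_gen F S" using c(1)
    unfolding cone_gen_def by (intro CollectI exI[of _ "\<lambda>s. if s \<in> T then c s else 0"]) auto
qed

lemma cone_gen_scaled_generator:
  assumes "finite S" "s \<in> S" "0 \<le> d" shows "(\<lambda>i\<in>F. d * s i) \<in> cone_gen F S"
proof -
  have "(\<Sum>t\<in>S. (if t = s then d else 0) * t i) = d * s i" for i
    using assms by (subst sum.remove[of _ s]) (auto intro: sum.neutral)
  then show ?thesis using assms
    unfolding cone_gen_def by (intro CollectI exI[of _ "\<lambda>t. if t = s then d else 0"]) auto
qed

lemma cone_gen_add:
  assumes "x \<in> cone_gen F S" "y \<in> cone_gen F S"
  shows "(\<lambda>i\<in>F. x i + y i) \<in> cone_gen F S"
proof -
  obtain c d where "\<forall>s\<in>S. 0 \<le> c s" "x = (\<lambda>i\<in>F. \<Sum>s\<in>S. c s * s i)"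
    "\<forall>s\<in>S. 0 \<le> d s" "y = (\<lambda>i\<in>F. \<Sum>s\<in>S. d s * s i)"
    using assms by (auto simp: cone_gen_def)
  then show ?thesis unfolding cone_gen_def
    by (intro CollectI exI[of _ "\<lambda>s. c s + d s"]) (auto simp: fun_eq_iff algebra_simps sum.distrib)
qed

lemma cone_gen_scale:
  assumes "x \<in> cone_gen F S" "0 \<le> d"
  shows "(\<lambda>i\<in>F. d * x i) \<in> cone_gen F S"
proof -
  obtain c where "\<forall>s\<in>S. 0 \<le> c s" "x = (\<lambda>i\<in>F. \<Sum>s\<in>S. c s * s i)"
    using assms by (auto simp: cone_gen_def)
  then show ?thesis unfolding cone_gen_def using assms(2)
    by (intro CollectI exI[of _ "\<lambda>s. d * c s"]) (auto simp: fun_eq_iff algebra_simps sum_distrib_left)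
qed

lemma cone_gen_zero: "(\<lambda>i\<in>F. 0) \<in> cone_gen F S"
  unfolding cone_gen_def by (intro CollectI exI[of _ "\<lambda>s. 0"]) auto

lemma cone_gen_subset:
  assumes "finite T" "T \<subseteq> cone_gen F U"
  shows "cone_gen F T \<subseteq> cone_gen F U"
proof -
  have "(\<lambda>i\<in>F. \<Sum>s\<in>T. c s * s i) \<in> cone_gen F U" if "\<forall>s\<in>T. 0 \<le> c s" for c
    using assms that
  proof (induction T)
    case empty
    show ?case by (simp only: sum.empty cone_gen_zero)
  next
    case (insert t T)
    have "(\<lambda>i\<in>F. (\<lambda>i\<in>F. c t * t i) i + (\<lambda>i\<in>F. \<Sum>s\<in>T. c s * s i) i) \<in> cone_gen F U"
      using insert by (intro cone_gen_add cone_gen_scale) auto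
    also have "(\<lambda>i\<in>F. (\<lambda>i\<in>F. c t * t i) i + (\<lambda>i\<in>F. \<Sum>s\<in>T. c s * s i) i) =
        (\<lambda>i\<in>F. \<Sum>s\<in>insert t T. c s * s i)"
      using insert.hyps by (intro restrict_ext) simp
    finally show ?case .
  qed
  then show ?thesis unfolding cone_gen_def[of F T] by blast
qed

lemma lin_indep_unique:
  assumes "lin_indep_on F S" "finite S" "\<forall>i\<in>F. (\<Sum>s\<in>S. c s * s i) = (\<Sum>s\<in>S. d s * s i)" "s \<in> S"
  shows "c s = d s"
proof -
  have "\<forall>i\<in>F. (\<Sum>s\<in>S. (c s - d s) * s i) = 0"
    using assms(3) by (simp add: algebra_simps sum_subtractf)
  then have "\<forall>s\<in>S. c s - d s = 0"
    using assms(1)[unfolded lin_indep_on_def, rule_format, of "\<lambda>s. c s - d s"] by blast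
  then show ?thesis using assms(4) by simp
qed

text \<open>
The generators of a simplicial cone are unique up to scaling. Express \<open>s'\<close> by \<open>S\<close> and the members of
\<open>S\<close> by \<open>S'\<close>, all with nonnegative coefficients. By independence of \<open>S'\<close> the composite coefficients at
generators other than \<open>s'\<close> vanish, and a sum of nonnegative terms vanishes only termwise.
\<close>

lemma simplicial_generator_unique:
  assumes S: "simplicial_basis F S \<sigma>" and S': "simplicial_basis F S' \<sigma>" and s': "s' \<in> S'"
  shows "\<exists>d>0. (\<lambda>i\<in>F. d * s' i) \<in> S"
proof -
  have fin: "finite S" "finite S'" and li: "lin_indep_on F S'"
    and eq: "cone_gen F S = \<sigma>" "cone_gen F S' = \<sigma>"
    and ext: "S \<subseteq> F \<rightarrow>\<^sub>E UNIV" "S' \<subseteq> F \<rightarrow>\<^sub>E UNIV"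
    using S S' by (auto simp: simplicial_basis_def)
  have mem: "s \<in> \<sigma>" if "s \<in> S \<or> s \<in> S'" for s
  proof -
    have "(\<lambda>i\<in>F. 1 * s i) = s" using that ext by (auto simp: fun_eq_iff PiE_def extensional_def)
    then show ?thesis using that cone_gen_scaled_generator[of _ s 1 F] fin eq by fastforce
  qed
  obtain c where c: "\<forall>s\<in>S. 0 \<le> c s" "s' = (\<lambda>i\<in>F. \<Sum>s\<in>S. c s * s i)"
    using mem[of s'] s' unfolding eq(1)[symmetric] by (auto simp: cone_gen_def)
  have "\<forall>s\<in>S. \<exists>d. (\<forall>t\<in>S'. 0 \<le> d t) \<and> s = (\<lambda>i\<in>F. \<Sum>t\<in>S'. d t * t i)"
    using mem unfolding eq(2)[symmetric] cone_gen_def by blast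
  from bchoice[OF this] obtain d
    where d0: "\<forall>s\<in>S. (\<forall>t\<in>S'. 0 \<le> d s t) \<and> s = (\<lambda>i\<in>F. \<Sum>t\<in>S'. d s t * t i)" ..
  have d: "0 \<le> d s t" if "s \<in> S" "t \<in> S'" for s t using d0 that by blast
  have d2: "s i = (\<Sum>t\<in>S'. d s t * t i)" if "s \<in> S" "i \<in> F" for s i
    using fun_cong[OF conjunct2[OF bspec[OF d0 that(1)]], of i] that(2) by simp
  define e where "e t = (\<Sum>s\<in>S. c s * d s t)" for t
  have "(\<Sum>t\<in>S'. (if t = s' then 1 else 0) * t i) = (\<Sum>t\<in>S'. e t * t i)" if i: "i \<in> F" for i
  proof -
    have di: "s i = (\<Sum>t\<in>S'. d s t * t i)" if "s \<in> S" for s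
      using d2[OF that i] .
    have "s' i = (\<Sum>s\<in>S. c s * s i)" using fun_cong[OF c(2), of i] i by simp
    also have "\<dots> = (\<Sum>s\<in>S. \<Sum>t\<in>S'. c s * d s t * t i)"
      by (rule sum.cong[OF refl]) (simp add: di sum_distrib_left mult.assoc)
    also have "\<dots> = (\<Sum>t\<in>S'. e t * t i)"
      by (subst sum.swap) (simp add: e_def sum_distrib_right)
    finally have "s' i = (\<Sum>t\<in>S'. e t * t i)" .
    moreover have "(\<Sum>t\<in>S'. (if t = s' then 1 else 0) * t i) = s' i"
      using fin s' by (subst sum.remove[of _ s']) (auto intro: sum.neutral)
    ultimately show ?thesis by simp
  qed
  then have e: "e t = (if t = s' then 1 else 0)" if "t \<in> S'" for t
    using lin_indep_unique[OF li fin(2) _ that, of "\<lambda>t. if t = s' then 1 else 0" e] by simp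
  have "(\<Sum>s\<in>S. c s * d s s') \<noteq> 0" using e[OF s'] by (simp add: e_def)
  then obtain s where s: "s \<in> S" "c s * d s s' \<noteq> 0" by (meson sum.neutral)
  have zero: "d s t = 0" if t: "t \<in> S'" "t \<noteq> s'" for t
  proof -
    have "\<forall>s\<in>S. c s * d s t = 0"
      using e[OF t(1)] t fin c d unfolding e_def
      by (subst sum_nonneg_eq_0_iff[symmetric]) auto
    then show ?thesis using s by auto
  qed
  have "s i = d s s' * s' i" if "i \<in> F" for i
  proof -
    have "s i = (\<Sum>t\<in>S'. d s t * t i)" using d2[OF s(1) that] .
    also have "\<dots> = d s s' * s' i"
      using fin s' zero by (subst sum.remove[of _ s']) (auto intro: sum.neutral)
    finally show ?thesis .
  qed
  moreover have "s = (\<lambda>i\<in>F. s i)" using s(1) ext by (auto simp: fun_eq_iff PiE_def extensional_def)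
  ultimately have "(\<lambda>i\<in>F. d s s' * s' i) = s" by (metis (no_types, lifting) restrict_ext)
  moreover have "d s s' > 0" using s d[OF s(1) s'] by (auto simp: less_le)
  ultimately show ?thesis using s(1) by auto
qed

text \<open>
The faces of a cone are defined through an arbitrary basis of it. This brings them back to the
basis in use.
\<close>

lemma cone_face_of_basis:
  assumes S: "simplicial_basis F S \<sigma>" and face: "cone_face F \<tau> \<sigma>"
  shows "\<exists>T\<subseteq>S. \<tau> = cone_gen F T"
proof -
  obtain S' T' where S': "simplicial_basis F S' \<sigma>" "T' \<subseteq> S'" "\<tau> = cone_gen F T'"
    using face by (auto simp: cone_face_def)
  have fin: "finite T'" and ext: "T' \<subseteq> F \<rightarrow>\<^sub>E UNIV"
    using S' finite_subset by (auto simp: simplicial_basis_def)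
  have "\<forall>s'\<in>T'. \<exists>d. d > 0 \<and> (\<lambda>i\<in>F. d * s' i) \<in> S"
    using simplicial_generator_unique[OF S S'(1)] S'(2) by blast
  from bchoice[OF this] obtain d
    where d: "\<forall>s'\<in>T'. d s' > (0::real) \<and> (\<lambda>i\<in>F. d s' * s' i) \<in> S" ..
  define g where "g s' = (\<lambda>i\<in>F. d s' * s' i)" for s'
  have g: "g s' \<in> S \<and> d s' > 0 \<and> g s' = (\<lambda>i\<in>F. d s' * s' i)" if "s' \<in> T'" for s'
    using d that by (simp add: g_def)
  have "cone_gen F T' = cone_gen F (g ` T')"
  proof
    show "cone_gen F T' \<subseteq> cone_gen F (g ` T')"
    proof (rule cone_gen_subset[OF fin], rule subsetI)
      fix t assume t: "t \<in> T'"
      have "(\<lambda>i\<in>F. (1 / d t) * g t i) \<in> cone_gen F (g ` T')"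
        by (rule cone_gen_scaled_generator[OF finite_imageI[OF fin] imageI[OF t]])
          (use g[OF t] in simp)
      moreover have "(\<lambda>i\<in>F. (1 / d t) * g t i) = t"
        using g[OF t] ext t by (auto simp: fun_eq_iff PiE_def extensional_def subset_iff)
      ultimately show "t \<in> cone_gen F (g ` T')" by simp
    qed
    show "cone_gen F (g ` T') \<subseteq> cone_gen F T'"
    proof (rule cone_gen_subset)
      show "g ` T' \<subseteq> cone_gen F T'"
      proof
        fix s assume "s \<in> g ` T'"
        then obtain t where t: "t \<in> T'" "s = g t" by blast
        show "s \<in> cone_gen F T'"
          using cone_gen_scaled_generator[OF fin t(1), of "d t" F] g[OF t(1)] t(2) by simp
      qed
    qed (use fin in simp)
  qed
  moreover have "g ` T' \<subseteq> S" using g by blast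
  ultimately show ?thesis using S'(3) by blast
qed

section \<open>Barycentric subdivision of a rational hyperplane arrangement\<close>

text \<open>
The cell of \<open>x\<close> lies in the closure of the cell of \<open>y\<close>.
\<close>

definition face_le :: "'k set \<Rightarrow> ('k \<Rightarrow> rat) set \<Rightarrow> ('k \<Rightarrow> real) \<Rightarrow> ('k \<Rightarrow> real) \<Rightarrow> bool" where
  "face_le F H x y \<longleftrightarrow> (\<forall>a\<in>H. lin F a x = 0 \<or> sgn (lin F a x) = sgn (lin F a y))"

text \<open>
With the coordinate forms among the hyperplanes, the origin is a cell by itself and every other cell
spans a pointed cone.
\<close>

locale arrangement =
  fixes F :: "'k set" and H :: "('k \<Rightarrow> rat) set"
  assumes finF: "finite F" and finH: "finite H"
    and coordinates: "\<And>j. j \<in> F \<Longrightarrow> (\<lambda>i. if i = j then 1 else 0) \<in> H"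
begin

abbreviation comb :: "('k \<Rightarrow> real) set \<Rightarrow> (('k \<Rightarrow> real) \<Rightarrow> real) \<Rightarrow> 'k \<Rightarrow> real" where
  "comb S c \<equiv> (\<lambda>i\<in>F. \<Sum>s\<in>S. c s * s i)"

definition sign_vector :: "('k \<Rightarrow> real) \<Rightarrow> ('k \<Rightarrow> rat) \<Rightarrow> real" where
  "sign_vector x = (\<lambda>a\<in>H. sgn (lin F a x))"

text \<open>
The choice depends on the sign vector only, so every cell receives exactly one rational point.
\<close>

definition vertex :: "(('k \<Rightarrow> rat) \<Rightarrow> real) \<Rightarrow> 'k \<Rightarrow> real" where
  "vertex s = (SOME y. rational_vector F y \<and> y \<in> F \<rightarrow>\<^sub>E UNIV \<and> sign_vector y = s)"

definition vertices :: "('k \<Rightarrow> real) set" where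
  "vertices = vertex ` sign_vector ` {x. \<exists>i\<in>F. x i \<noteq> 0}"

text \<open>
A chain of cells, ordered by inclusion of closures and represented by the chosen points: a simplex of
the barycentric subdivision.
\<close>

definition flag :: "('k \<Rightarrow> real) set \<Rightarrow> bool" where
  "flag S \<longleftrightarrow> S \<subseteq> vertices \<and> (\<forall>p\<in>S. \<forall>q\<in>S. face_le F H p q \<or> face_le F H q p)"

lemma sign_vector_eq_iff: "sign_vector x = sign_vector y \<longleftrightarrow> same_sign F H x y"
  by (auto simp: sign_vector_def same_sign_def fun_eq_iff restrict_def)

lemma same_sign_nonzero:
  assumes "same_sign F H x y" "\<exists>i\<in>F. x i \<noteq> 0" shows "\<exists>i\<in>F. y i \<noteq> 0"
proof -
  obtain i where i: "i \<in> F" "x i \<noteq> 0" using assms by blast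
  then have "sgn (x i) = sgn (y i)"
    using assms(1) coordinates[OF i(1)] lin_unit_form[OF finF i(1)] unfolding same_sign_def by metis
  then show ?thesis using i by (metis sgn_0_0)
qed

lemma vertex_sign_vector:
  "rational_vector F (vertex (sign_vector x)) \<and> vertex (sign_vector x) \<in> F \<rightarrow>\<^sub>E UNIV \<and>
   same_sign F H x (vertex (sign_vector x))"
proof -
  obtain y where "rational_vector F y" "y \<in> F \<rightarrow>\<^sub>E UNIV" "sign_vector x = sign_vector y"
    unfolding sign_vector_eq_iff by (rule rational_same_sign[OF finF finH])
  then have "\<exists>y. rational_vector F y \<and> y \<in> F \<rightarrow>\<^sub>E UNIV \<and> sign_vector y = sign_vector x" by metis
  from someI_ex[OF this] show ?thesis
    unfolding vertex_def[symmetric] sign_vector_eq_iff[symmetric] by simp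
qed

lemma finite_vertices: "finite vertices"
proof -
  have "sign_vector x \<in> H \<rightarrow>\<^sub>E {-1, 0, 1}" for x
    by (auto simp: sign_vector_def sgn_if)
  then have "sign_vector ` {x. \<exists>i\<in>F. x i \<noteq> 0} \<subseteq> H \<rightarrow>\<^sub>E {-1, 0, 1}" by blast
  then have "finite (sign_vector ` {x. \<exists>i\<in>F. x i \<noteq> 0})"
    by (rule finite_subset) (auto intro: finite_PiE finH)
  then show ?thesis by (simp add: vertices_def)
qed

lemma vertices_props:
  assumes "p \<in> vertices"
  shows "rational_vector F p" "p \<in> F \<rightarrow>\<^sub>E UNIV" "\<exists>i\<in>F. p i \<noteq> 0"
  using assms vertex_sign_vector same_sign_nonzero unfolding vertices_def by blast+

lemma vertex_ex:
  assumes "\<exists>i\<in>F. x i \<noteq> 0" shows "\<exists>p\<in>vertices. same_sign F H x p"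
  using assms vertex_sign_vector unfolding vertices_def by blast

lemma same_sign_trans: "same_sign F H x y \<Longrightarrow> same_sign F H y z \<Longrightarrow> same_sign F H x z"
  by (simp add: same_sign_def)

lemma same_sign_sym: "same_sign F H x y \<Longrightarrow> same_sign F H y x"
  by (simp add: same_sign_def)

lemma vertices_unique:
  assumes "p \<in> vertices" "q \<in> vertices" "same_sign F H p q" shows "p = q"
proof -
  obtain x y where "p = vertex (sign_vector x)" "q = vertex (sign_vector y)"
    using assms by (auto simp: vertices_def)
  moreover have "sign_vector x = sign_vector y"
    using vertex_sign_vector assms(3) calculation
    unfolding sign_vector_eq_iff by (metis same_sign_sym same_sign_trans)
  ultimately show ?thesis by simp
qed

lemma face_le_trans: "face_le F H x y \<Longrightarrow> face_le F H y z \<Longrightarrow> face_le F H x z"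
  unfolding face_le_def by (metis sgn_0_0)

lemma face_le_same_sign: "same_sign F H x y \<Longrightarrow> face_le F H x y"
  by (simp add: face_le_def same_sign_def)

lemma finite_flag: "flag S \<Longrightarrow> finite S"
  using finite_vertices finite_subset by (auto simp: flag_def)

lemma flag_subset: "flag S \<Longrightarrow> T \<subseteq> S \<Longrightarrow> flag T"
  by (auto simp: flag_def)

lemma flag_max:
  assumes "flag S" "S \<noteq> {}" shows "\<exists>q\<in>S. \<forall>p\<in>S. face_le F H p q"
  using finite_flag[OF assms(1)] assms(2,1)
proof (induction S rule: finite_ne_induct)
  case (singleton p)
  then show ?case by (auto simp: flag_def)
next
  case (insert p S)
  then obtain q where q: "q \<in> S" "\<forall>p\<in>S. face_le F H p q" using flag_subset[of "insert p S" S] by blast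
  have "face_le F H p q \<or> face_le F H q p" "face_le F H p p" "face_le F H q q"
    using insert.prems q(1) by (auto simp: flag_def)
  then show ?case using q face_le_trans by (metis insert_iff)
qed

lemma lin_comb: "lin F a (comb S c) = (\<Sum>s\<in>S. c s * lin F a s)"
  by (simp add: lin_restrict lin_sum)

text \<open>
On each form of \<open>H\<close>, every vertex of a flag has the sign of the last vertex or vanishes. So a positive
combination lies in the cell of the last vertex.
\<close>

lemma same_sign_comb:
  assumes S: "flag S" and c: "\<forall>s\<in>S. 0 < c s" and q: "q \<in> S" "\<forall>p\<in>S. face_le F H p q"
  shows "same_sign F H (comb S c) q"
  unfolding same_sign_def
proof
  fix a assume a: "a \<in> H"
  define t where "t = sgn (lin F a q)"
  have fin: "finite S" using S by (rule finite_flag)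
  have sg: "lin F a p = 0 \<or> sgn (lin F a p) = t" if "p \<in> S" for p
    using q(2) a that unfolding face_le_def t_def by blast
  have "sgn (\<Sum>s\<in>S. c s * lin F a s) = t"
  proof (cases "t = 0")
    case True
    then have "\<forall>p\<in>S. lin F a p = 0" using sg by (auto simp: sgn_0_0)
    then show ?thesis using True by (simp add: sum.neutral)
  next
    case False
    then have t: "t = 1 \<or> t = -1" by (auto simp: t_def sgn_if)
    have "0 < (\<Sum>s\<in>S. c s * (t * lin F a s))"
    proof (rule sum_pos2[OF fin q(1)])
      show "0 < c q * (t * lin F a q)"
        using c q(1) False unfolding t_def by (simp add: sgn_if split: if_splits)
      show "0 \<le> c p * (t * lin F a p)" if "p \<in> S" for p
      proof -
        have "0 \<le> t * lin F a p" using sg[OF that] t by (auto simp: sgn_if split: if_splits)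
        then show ?thesis using c that by (simp add: less_imp_le)
      qed
    qed
    also have "\<dots> = t * (\<Sum>s\<in>S. c s * lin F a s)" by (simp add: sum_distrib_left algebra_simps)
    finally show ?thesis using t by (auto simp: sgn_if zero_less_mult_iff)
  qed
  then show "sgn (lin F a (comb S c)) = sgn (lin F a q)" by (simp add: lin_comb t_def)
qed

lemma comb_remove:
  assumes "finite S" "q \<in> S" "i \<in> F"
  shows "comb S c i = c q * q i + comb (S - {q}) c i"
  using assms by (simp add: sum.remove)

text \<open>
A point has at most one flag over which it is a positive combination. The last vertices of both flags
lie in the cell of the point, hence agree; subtracting the smaller one of their two coefficients
shortens one of the flags, and induction applies.
\<close>

lemma comb_eq_flag_eq:
  assumes "flag S" "flag T" "\<forall>s\<in>S. 0 < c s" "\<forall>s\<in>T. 0 < d s" "comb S c = comb T d"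
  shows "S = T"
  using assms
proof (induction "card S + card T" arbitrary: S T c d rule: less_induct)
  case less
  have key: "S1 = T1"
    if card: "card S1 + card T1 = card S + card T" and fl: "flag S1" "flag T1"
      and pos: "\<forall>s\<in>S1. 0 < c1 s" "\<forall>s\<in>T1. 0 < d1 s" and eq: "comb S1 c1 = comb T1 d1"
      and q: "q \<in> S1" "q \<in> T1" and le: "c1 q \<le> d1 q"
    for S1 T1 c1 d1 q
  proof -
    have fin: "finite S1" "finite T1" using fl finite_flag by auto
    have cS: "card (S1 - {q}) < card S1" using fin(1) q(1) by (rule card_Diff1_less)
    have cT: "card (T1 - {q}) < card T1" using fin(2) q(2) by (rule card_Diff1_less)
    have split: "comb (S1 - {q}) c1 i = comb (T1 - {q}) d1 i + (d1 q - c1 q) * q i"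
      if "i \<in> F" for i
      using fun_cong[OF eq, of i] comb_remove[OF fin(1) q(1) that, of c1]
        comb_remove[OF fin(2) q(2) that, of d1] by (simp add: algebra_simps)
    show ?thesis
    proof (cases "c1 q = d1 q")
      case True
      have "comb (S1 - {q}) c1 = comb (T1 - {q}) d1"
        using split True by (auto simp: fun_eq_iff)
      then have "S1 - {q} = T1 - {q}"
        using less.hyps[of "S1 - {q}" "T1 - {q}" c1 d1] card cS cT fl pos
        by (auto intro: flag_subset)
      then show ?thesis using q by blast
    next
      case False
      define d2 where "d2 = d1(q := d1 q - c1 q)"
      have "comb (S1 - {q}) c1 i = comb T1 d2 i" for i
      proof (cases "i \<in> F")
        case True
        have "comb (T1 - {q}) d1 i = comb (T1 - {q}) d2 i"
          using True by (auto simp: d2_def intro!: sum.cong)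
        then show ?thesis
          using split[OF True] comb_remove[OF fin(2) q(2) True, of d2] by (simp add: d2_def)
      qed simp
      then have "comb (S1 - {q}) c1 = comb T1 d2" by blast
      moreover have "\<forall>s\<in>T1. 0 < d2 s" using pos(2) le False by (auto simp: d2_def)
      ultimately have "S1 - {q} = T1"
        using less.hyps[of "S1 - {q}" T1 c1 d2] card cS fl pos by (auto intro: flag_subset)
      then show ?thesis using q by blast
    qed
  qed
  have nz: "S1 = {}" if S1: "flag S1" "\<forall>s\<in>S1. 0 < c1 s" and zero: "comb S1 c1 = (\<lambda>i\<in>F. 0)" for S1 c1
  proof (rule ccontr)
    assume ne: "S1 \<noteq> {}"
    obtain q where q: "q \<in> S1" "\<forall>p\<in>S1. face_le F H p q" using flag_max[OF S1(1) ne] by blast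
    then have "q \<in> vertices" using S1(1) by (auto simp: flag_def)
    then show False
      using same_sign_nonzero[OF same_sign_sym[OF same_sign_comb[OF S1 q]]] vertices_props(3) zero
      by simp
  qed
  show ?case
  proof (cases "S = {} \<or> T = {}")
    case True
    then have "comb S c = (\<lambda>i\<in>F. 0)"
      by (rule disjE) (simp_all add: less.prems(5))
    then show ?thesis using nz[of S c] nz[of T d] less.prems by simp
  next
    case False
    obtain p where p: "p \<in> S" "\<forall>r\<in>S. face_le F H r p" using flag_max[OF less.prems(1)] False by blast
    obtain q where q: "q \<in> T" "\<forall>r\<in>T. face_le F H r q" using flag_max[OF less.prems(2)] False by blast
    have "same_sign F H p q"
      using same_sign_comb[OF less.prems(1,3) p] same_sign_comb[OF less.prems(2,4) q] less.prems(5)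
      by (metis same_sign_sym same_sign_trans)
    then have "p = q"
      using p(1) q(1) less.prems by (intro vertices_unique) (auto simp: flag_def)
    then show ?thesis
      using key[of S T c d q] key[of T S d c q] less.prems p(1) q(1)
      by (cases "c q \<le> d q") (auto simp: add.commute)
  qed
qed

text \<open>
Separating the positive from the negative coefficients, a linear relation equates positive
combinations over two disjoint subflags; by uniqueness both are empty.
\<close>

lemma flag_lin_indep:
  assumes S: "flag S" shows "lin_indep_on F S"
  unfolding lin_indep_on_def
proof (intro allI impI)
  fix c :: "('k \<Rightarrow> real) \<Rightarrow> real"
  assume c: "\<forall>i\<in>F. (\<Sum>s\<in>S. c s * s i) = 0"
  have fin: "finite S" using S by (rule finite_flag)
  define P N where "P = {s \<in> S. 0 < c s}" and "N = {s \<in> S. c s < 0}"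
  have "comb P c = comb N (\<lambda>s. - c s)"
  proof (rule restrict_ext)
    fix i assume i: "i \<in> F"
    have "(\<Sum>s\<in>S. c s * s i) = (\<Sum>s\<in>P \<union> N. c s * s i)"
      using fin by (intro sum.mono_neutral_right) (auto simp: P_def N_def)
    also have "\<dots> = (\<Sum>s\<in>P. c s * s i) + (\<Sum>s\<in>N. c s * s i)"
      using fin by (intro sum.union_disjoint) (auto simp: P_def N_def)
    finally show "(\<Sum>s\<in>P. c s * s i) = (\<Sum>s\<in>N. - c s * s i)" using c i by (simp add: sum_negf)
  qed
  moreover have "flag P" "flag N" using S by (auto intro: flag_subset simp: P_def N_def)
  ultimately have "P = N" by (intro comb_eq_flag_eq[of P N c "\<lambda>s. - c s"]) (auto simp: P_def N_def)
  then show "\<forall>s\<in>S. c s = 0" unfolding P_def N_def by force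
qed

lemma simplicial_basis_flag: "flag S \<Longrightarrow> simplicial_basis F S (cone_gen F S)"
  unfolding simplicial_basis_def
  using finite_flag flag_lin_indep vertices_props(2) by (auto simp: flag_def)

lemma cone_gen_support:
  assumes S: "finite S" and x: "x \<in> cone_gen F S"
  obtains c T where "T \<subseteq> S" "\<forall>s\<in>T. 0 < c s" "x = comb T c"
proof -
  obtain c where c: "\<forall>s\<in>S. 0 \<le> c s" "x = comb S c" using x by (auto simp: cone_gen_def)
  have eq: "comb S c = comb {s \<in> S. 0 < c s} c"
    using S c(1) by (intro restrict_ext sum.mono_neutral_right) (auto simp: less_le)
  show ?thesis
    by (rule that[of "{s \<in> S. 0 < c s}" c]) (simp_all only: c(2) eq, auto)
qed

lemma comb_in_cone_gen: "\<forall>s\<in>T. 0 < c s \<Longrightarrow> comb T c \<in> cone_gen F T"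
  unfolding cone_gen_def by (auto intro: less_imp_le)

lemma cone_gen_flag_Int:
  assumes "flag S" "flag T"
  shows "cone_gen F S \<inter> cone_gen F T = cone_gen F (S \<inter> T)"
proof
  show "cone_gen F (S \<inter> T) \<subseteq> cone_gen F S \<inter> cone_gen F T"
    using cone_gen_mono[of S "S \<inter> T" F] cone_gen_mono[of T "S \<inter> T" F] assms finite_flag by blast
  show "cone_gen F S \<inter> cone_gen F T \<subseteq> cone_gen F (S \<inter> T)"
  proof
    fix x assume x: "x \<in> cone_gen F S \<inter> cone_gen F T"
    obtain c S' where S': "S' \<subseteq> S" "\<forall>s\<in>S'. 0 < c s" "x = comb S' c"
      using x cone_gen_support[OF finite_flag[OF assms(1)]] by blast
    obtain d T' where T': "T' \<subseteq> T" "\<forall>s\<in>T'. 0 < d s" "x = comb T' d"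
      using x cone_gen_support[OF finite_flag[OF assms(2)]] by blast
    have "S' = T'"
      using comb_eq_flag_eq[of S' T' c d] S' T' assms flag_subset by metis
    then have "cone_gen F S' \<subseteq> cone_gen F (S \<inter> T)"
      using S'(1) T'(1) finite_flag[OF assms(1)] by (intro cone_gen_mono) auto
    then show "x \<in> cone_gen F (S \<inter> T)" using comb_in_cone_gen[OF S'(2)] S'(3) by blast
  qed
qed

text \<open>
Subtract from \<open>x\<close> the largest multiple of the vertex of its cell that keeps it in the closure of the
cell. The remainder lies in a proper face, on which fewer forms are nonzero.
\<close>

lemma flag_cover:
  assumes "x \<in> F \<rightarrow>\<^sub>E UNIV"
  shows "\<exists>S c. flag S \<and> (\<forall>s\<in>S. 0 < c s \<and> face_le F H s x) \<and> x = comb S c"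
  using assms
proof (induction "card {a \<in> H. lin F a x \<noteq> 0}" arbitrary: x rule: less_induct)
  case less
  show ?case
  proof (cases "\<exists>i\<in>F. x i \<noteq> 0")
    case False
    then have "x = comb {} (\<lambda>_. 0)" using less.prems by (auto simp: fun_eq_iff PiE_def extensional_def)
    moreover have "flag {}" by (simp add: flag_def)
    ultimately show ?thesis by (intro exI[of _ "{}"] exI[of _ "\<lambda>_. 0"]) simp
  next
    case True
    then obtain p where p: "p \<in> vertices" "same_sign F H x p" using vertex_ex by blast
    define A where "A = {a \<in> H. lin F a x \<noteq> 0}"
    have finA: "finite A" using finH by (simp add: A_def)
    have "A \<noteq> {}"
      using True coordinates lin_unit_form[OF finF] unfolding A_def by fastforce
    \<comment> \<open>The form \<open>a\<close> vanishes at \<open>x - l p\<close> exactly for \<open>l = \<rho> a\<close>, so the least \<open>\<rho> a\<close> is the largest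
      multiple of \<open>p\<close> that can be subtracted.\<close>
    define \<rho> where "\<rho> a = lin F a x / lin F a p" for a
    have sg: "sgn (lin F a x) = sgn (lin F a p)" if "a \<in> H" for a
      using p(2) that by (simp add: same_sign_def)
    have \<rho>: "\<rho> a > 0" if "a \<in> A" for a
      using that sg[of a] by (auto simp: A_def \<rho>_def sgn_if zero_less_divide_iff split: if_splits)
    define l where "l = Min (\<rho> ` A)"
    have lmin: "l \<le> \<rho> a" if "a \<in> A" for a unfolding l_def using finA that by simp
    have "l \<in> \<rho> ` A" unfolding l_def using finA \<open>A \<noteq> {}\<close> by (intro Min_in) auto
    then obtain b where b: "b \<in> A" "l = \<rho> b" by blast
    have l: "l > 0" using \<rho> b by simp
    define y where "y = (\<lambda>i\<in>F. x i - l * p i)"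
    have y: "lin F a y = lin F a x - l * lin F a p" for a
      by (simp add: y_def lin_restrict lin_diff_scale)
    have face: "face_le F H y x"
      unfolding face_le_def
    proof
      fix a assume a: "a \<in> H"
      show "lin F a y = 0 \<or> sgn (lin F a y) = sgn (lin F a x)"
      proof (cases "a \<in> A")
        case False
        then have "lin F a x = 0" "lin F a p = 0" using a sg[OF a] by (auto simp: A_def sgn_0_0)
        then show ?thesis by (simp add: y)
      next
        case True
        have np: "lin F a p \<noteq> 0" using True sg[OF a] by (auto simp: A_def sgn_0_0)
        have eq: "lin F a y = (\<rho> a - l) * lin F a p" using np by (simp add: y \<rho>_def algebra_simps)
        show ?thesis
          using lmin[OF True] sg[OF a] unfolding eq by (cases "\<rho> a = l") (auto simp: sgn_mult)
      qed
    qed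
    have bzero: "lin F b y = 0" using b sg[of b] by (auto simp: y \<rho>_def A_def sgn_0_0)
    have "{a \<in> H. lin F a y \<noteq> 0} \<subset> A"
    proof -
      have "{a \<in> H. lin F a y \<noteq> 0} \<subseteq> A" using face unfolding face_le_def A_def by (auto simp: sgn_0_0)
      then show ?thesis using b(1) bzero by auto
    qed
    then have "card {a \<in> H. lin F a y \<noteq> 0} < card A" using finA by (rule psubset_card_mono[rotated])
    then obtain S c where S: "flag S" "\<forall>s\<in>S. 0 < c s \<and> face_le F H s y" "y = comb S c"
      using less.hyps[of y] by (auto simp: A_def y_def)
    have "p \<notin> S"
    proof
      assume "p \<in> S"
      then have "face_le F H p y" using S by blast
      then have "lin F b p = 0" using bzero b(1) unfolding face_le_def A_def by (auto simp: sgn_0_0)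
      then show False using b(1) sg[of b] by (auto simp: A_def sgn_0_0)
    qed
    have px: "face_le F H p x" by (rule face_le_same_sign[OF same_sign_sym[OF p(2)]])
    have Sx: "face_le F H s x" if "s \<in> S" for s using S(2) that face face_le_trans by blast
    have Sp: "face_le F H s p" if "s \<in> S" for s
      using Sx[OF that] p(2) by (meson face_le_trans face_le_same_sign)
    have pp: "face_le F H p p" by (simp add: face_le_def)
    have "flag (insert p S)" using S(1) p(1) Sp pp by (auto simp: flag_def)
    moreover have "\<forall>s\<in>insert p S. 0 < (c(p := l)) s \<and> face_le F H s x"
      using S(2) l px Sx \<open>p \<notin> S\<close> by auto
    moreover have "x = comb (insert p S) (c(p := l))"
    proof
      fix i
      show "x i = comb (insert p S) (c(p := l)) i"
      proof (cases "i \<in> F")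
        case True
        have "(\<Sum>s\<in>S. (c(p := l)) s * s i) = (\<Sum>s\<in>S. c s * s i)"
          using \<open>p \<notin> S\<close> by (intro sum.cong) auto
        also have "\<dots> = y i" using S(3) True by simp
        finally show ?thesis using True \<open>p \<notin> S\<close> finite_flag[OF S(1)] by (simp add: y_def)
      qed (use less.prems in \<open>auto simp: PiE_def extensional_def\<close>)
    qed
    ultimately show ?thesis by blast
  qed
qed

text \<open>
Some form in \<open>H\<close> vanishes on all vertices but the last one, \<open>q\<close>; divided by its value at \<open>q\<close> it is a
rational form \<open>l\<close> that reads off the coefficient of \<open>q\<close>. So \<open>x\<close> belongs to the cone if \<open>l x \<ge> 0\<close> and
\<open>x - l x q\<close> belongs to the cone over the other vertices, which is rational by induction.
\<close>

lemma flag_rational_cone: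
  assumes "flag S" shows "rational_cone F (cone_gen F S)"
  using finite_flag[OF assms] assms
proof (induction S rule: finite_psubset_induct)
  case (psubset S)
  show ?case
  proof (cases "S = {}")
    case True
    define e where "e j = (\<lambda>i. if i = j then 1 else (0::rat))" for j :: 'k
    define A where "A = e ` F \<union> (\<lambda>j i. - e j i) ` F"
    have "x = (\<lambda>i\<in>F. 0) \<longleftrightarrow> (\<forall>a\<in>A. 0 \<le> lin F a x)" if "x \<in> F \<rightarrow>\<^sub>E UNIV" for x
    proof -
      have "(\<forall>a\<in>A. 0 \<le> lin F a x) \<longleftrightarrow> (\<forall>j\<in>F. x j = 0)"
        using lin_unit_form[OF finF]
        by (auto simp: A_def e_def lin_uminus_form ball_Un intro!: antisym)
      then show ?thesis using that by (auto simp: fun_eq_iff PiE_def extensional_def)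
    qed
    moreover have "\<forall>a\<in>A. 0 \<le> lin F a (\<lambda>i\<in>F. 0)" by (simp add: lin_restrict lin_zero)
    moreover have "cone_gen F S = {\<lambda>i\<in>F. 0}" using True by (simp add: cone_gen_def)
    ultimately have "cone_gen F S = {x \<in> F \<rightarrow>\<^sub>E UNIV. \<forall>a\<in>A. 0 \<le> lin F a x}" by auto
    moreover have "finite A" using finF by (simp add: A_def)
    ultimately show ?thesis unfolding rational_cone_def lin_def by blast
  next
    case False
    obtain q where q: "q \<in> S" "\<forall>p\<in>S. face_le F H p q" using flag_max psubset.prems False by blast
    have S: "S \<subseteq> vertices" using psubset.prems by (simp add: flag_def)
    let ?S = "S - {q}"
    have "\<exists>a. lin F a q \<noteq> 0 \<and> (\<forall>p\<in>?S. lin F a p = 0)"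
    proof (cases "?S = {}")
      case True
      obtain i where i: "i \<in> F" "q i \<noteq> 0" using vertices_props(3) q(1) S by blast
      then have "lin F (\<lambda>k. if k = i then 1 else 0) q \<noteq> 0" by (simp add: lin_unit_form[OF finF])
      then show ?thesis unfolding True by blast
    next
      case False
      obtain r where r: "r \<in> ?S" "\<forall>p\<in>?S. face_le F H p r"
        using flag_max[of ?S] flag_subset[OF psubset.prems, of ?S] False by blast
      have "\<not> same_sign F H r q" using vertices_unique[of r q] r(1) q(1) S by blast
      then obtain a where a: "a \<in> H" "sgn (lin F a r) \<noteq> sgn (lin F a q)" by (auto simp: same_sign_def)
      then have ar: "lin F a r = 0" using q(2) r(1) by (auto simp: face_le_def)
      then have "\<forall>p\<in>?S. lin F a p = 0" using r(2) a(1) unfolding face_le_def by (metis sgn_0_0)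
      moreover have "lin F a q \<noteq> 0" using a(2) ar by auto
      ultimately show ?thesis by blast
    qed
    then obtain a where a: "lin F a q \<noteq> 0" "\<forall>p\<in>?S. lin F a p = 0" by blast
    have rat: "\<exists>r. lin F b q = of_rat r" for b
      using lin_rational[OF vertices_props(1), of q b] q(1) S by (auto simp: Rats_def)
    then obtain \<rho> where \<rho>: "\<And>b. lin F b q = of_rat (\<rho> b)" by metis
    define l where "l = (\<lambda>i. (1 / \<rho> a) * a i)"
    have l: "lin F l x = lin F a x / lin F a q" for x
      unfolding l_def lin_scale_form \<rho> by (simp add: of_rat_divide)
    obtain A where A: "finite A" "cone_gen F ?S = {x \<in> F \<rightarrow>\<^sub>E UNIV. \<forall>a\<in>A. 0 \<le> lin F a x}"
      using psubset.IH[of ?S] flag_subset[OF psubset.prems, of ?S] q(1)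
      unfolding rational_cone_def lin_def by blast
    define g where "g b = (\<lambda>i. b i + (- \<rho> b) * l i)" for b
    have g: "lin F (g b) x = lin F b x - lin F l x * lin F b q" for b x
      unfolding g_def lin_add_form lin_scale_form \<rho> by (simp add: of_rat_minus)
    define A' where "A' = insert l (g ` A)"
    have iff: "x \<in> cone_gen F S \<longleftrightarrow> 0 \<le> lin F l x \<and> (\<lambda>i\<in>F. x i - lin F l x * q i) \<in> cone_gen F ?S"
      if x: "x \<in> F \<rightarrow>\<^sub>E UNIV" for x
    proof
      assume "x \<in> cone_gen F S"
      then obtain c where c: "\<forall>s\<in>S. 0 \<le> c s" "x = comb S c" by (auto simp: cone_gen_def)
      have "lin F a x = c q * lin F a q"
        unfolding c(2) lin_comb using psubset.hyps q(1) a(2)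
        by (subst sum.remove[of _ q]) (auto intro: sum.neutral)
      then have lx: "lin F l x = c q" using a(1) by (simp add: l)
      have "(\<lambda>i\<in>F. x i - lin F l x * q i) = comb ?S c"
        unfolding lx using comb_remove[OF psubset.hyps q(1), of _ c]
        by (intro restrict_ext) (simp add: c(2))
      then show "0 \<le> lin F l x \<and> (\<lambda>i\<in>F. x i - lin F l x * q i) \<in> cone_gen F ?S"
        using c(1) q(1) lx unfolding cone_gen_def by auto
    next
      assume r: "0 \<le> lin F l x \<and> (\<lambda>i\<in>F. x i - lin F l x * q i) \<in> cone_gen F ?S"
      have "(\<lambda>i\<in>F. lin F l x * q i) \<in> cone_gen F S"
        using r q(1) psubset.hyps by (intro cone_gen_scaled_generator) auto
      moreover have "(\<lambda>i\<in>F. x i - lin F l x * q i) \<in> cone_gen F S"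
        using r cone_gen_mono[OF psubset.hyps, of ?S F] by blast
      ultimately have "(\<lambda>i\<in>F. (\<lambda>i\<in>F. lin F l x * q i) i + (\<lambda>i\<in>F. x i - lin F l x * q i) i) \<in> cone_gen F S"
        by (rule cone_gen_add)
      moreover have "(\<lambda>i\<in>F. (\<lambda>i\<in>F. lin F l x * q i) i + (\<lambda>i\<in>F. x i - lin F l x * q i) i) = x"
        using x by (auto simp: fun_eq_iff PiE_def extensional_def)
      ultimately show "x \<in> cone_gen F S" by simp
    qed
    have "x \<in> cone_gen F S \<longleftrightarrow> (\<forall>a\<in>A'. 0 \<le> lin F a x)" if x: "x \<in> F \<rightarrow>\<^sub>E UNIV" for x
      unfolding iff[OF x] A(2) by (simp add: A'_def g lin_restrict lin_diff_scale)
    then have "cone_gen F S = {x \<in> F \<rightarrow>\<^sub>E UNIV. \<forall>a\<in>A'. 0 \<le> lin F a x}"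
      using cone_gen_ext by blast
    moreover have "finite A'" using A(1) by (simp add: A'_def)
    ultimately show ?thesis unfolding rational_cone_def lin_def by blast
  qed
qed

text \<open>
The hypothesis on \<open>D\<close> says that \<open>D\<close> is a union of closed cells. The fan consists of the cones over the
flags with all vertices in \<open>D\<close>: by \<open>flag_cover\<close> they cover \<open>D\<close>, and because a point determines its flag,
two of these cones intersect in the cone over the common vertices.
\<close>

theorem rational_fan_of_cells:
  assumes D: "D \<subseteq> F \<rightarrow>\<^sub>E UNIV" "D \<noteq> {}"
    and closed: "\<And>x y. x \<in> D \<Longrightarrow> y \<in> F \<rightarrow>\<^sub>E UNIV \<Longrightarrow> face_le F H y x \<Longrightarrow> y \<in> D"
  shows "\<exists>\<phi>. rational_fan F \<phi> \<and> \<Union>\<phi> = D"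
proof -
  define \<S> where "\<S> = {S. flag S \<and> S \<subseteq> D}"
  define \<phi> where "\<phi> = cone_gen F ` \<S>"
  have zero: "(\<lambda>i\<in>F. 0) \<in> D"
  proof -
    obtain x where "x \<in> D" using D(2) by blast
    then show ?thesis by (rule closed) (simp_all add: face_le_def lin_restrict lin_zero)
  qed
  have "finite \<S>"
    by (rule finite_subset[of _ "Pow vertices"]) (auto simp: \<S>_def flag_def finite_vertices)
  moreover have "simplicial_cone F \<sigma>" if "\<sigma> \<in> \<phi>" for \<sigma>
    using that simplicial_basis_flag by (auto simp: \<phi>_def \<S>_def simplicial_cone_def)
  moreover have "\<tau> \<in> \<phi>" if \<sigma>: "\<sigma> \<in> \<phi>" and face: "cone_face F \<tau> \<sigma>" for \<sigma> \<tau>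
  proof -
    obtain S where S: "S \<in> \<S>" "\<sigma> = cone_gen F S" using \<sigma> by (auto simp: \<phi>_def)
    then have "simplicial_basis F S \<sigma>" using simplicial_basis_flag by (simp add: \<S>_def)
    then obtain T where "T \<subseteq> S" "\<tau> = cone_gen F T" using cone_face_of_basis face by blast
    then show ?thesis using S flag_subset by (auto simp: \<phi>_def \<S>_def)
  qed
  moreover have "\<sigma> \<inter> \<tau> \<in> \<phi>" if st: "\<sigma> \<in> \<phi>" "\<tau> \<in> \<phi>" for \<sigma> \<tau>
  proof -
    obtain S T where S: "S \<in> \<S>" "\<sigma> = cone_gen F S" and T: "T \<in> \<S>" "\<tau> = cone_gen F T"
      using st by (auto simp: \<phi>_def)
    then have "\<sigma> \<inter> \<tau> = cone_gen F (S \<inter> T)" using cone_gen_flag_Int by (simp add: \<S>_def)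
    moreover have "S \<inter> T \<in> \<S>" using S T flag_subset[of S "S \<inter> T"] by (auto simp: \<S>_def)
    ultimately show ?thesis by (simp add: \<phi>_def)
  qed
  moreover have "rational_cone F \<sigma>" if "\<sigma> \<in> \<phi>" for \<sigma>
    using that flag_rational_cone by (auto simp: \<phi>_def \<S>_def)
  ultimately have "rational_fan F \<phi>" unfolding rational_fan_def fan_def by (simp add: \<phi>_def)
  moreover have "\<Union>\<phi> = D"
  proof
    show "D \<subseteq> \<Union>\<phi>"
    proof
      fix x assume x: "x \<in> D"
      then obtain S c where S: "flag S" "\<forall>s\<in>S. 0 < c s \<and> face_le F H s x" "x = comb S c"
        using flag_cover D(1) by blast
      have "S \<subseteq> D"
      proof
        fix s assume s: "s \<in> S"
        then have "s \<in> F \<rightarrow>\<^sub>E UNIV" using S(1) vertices_props(2) by (auto simp: flag_def)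
        then show "s \<in> D" using closed[OF x] S(2) s by blast
      qed
      then show "x \<in> \<Union>\<phi>" using S comb_in_cone_gen[of S c] by (auto simp: \<phi>_def \<S>_def)
    qed
    show "\<Union>\<phi> \<subseteq> D"
    proof
      fix x assume "x \<in> \<Union>\<phi>"
      then obtain S where S: "flag S" "S \<subseteq> D" "x \<in> cone_gen F S" by (auto simp: \<phi>_def \<S>_def)
      obtain c T where T: "T \<subseteq> S" "\<forall>s\<in>T. 0 < c s" "x = comb T c"
        by (rule cone_gen_support[OF finite_flag[OF S(1)] S(3)])
      have fT: "flag T" using S(1) T(1) by (rule flag_subset)
      show "x \<in> D"
      proof (cases "T = {}")
        case True
        then show ?thesis using T(3) zero by simp
      next
        case False
        then obtain q where q: "q \<in> T" "\<forall>p\<in>T. face_le F H p q" using flag_max[OF fT] by blast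
        have "face_le F H x q"
          using same_sign_comb[OF fT T(2) q] T(3) by (simp add: face_le_same_sign)
        then show ?thesis using closed[of q x] q(1) T(1) S(2,3) cone_gen_ext by blast
      qed
    qed
  qed
  ultimately show ?thesis by blast
qed

end

section \<open>MV-terms on radical classes\<close>

text \<open>
Terms are evaluated in \<open>\<Delta>\<^sub>m(\<real>)\<close> one coordinate at a time. The first coordinate of the value depends on
the radical class \<open>v\<close> alone, and it decides how the second one is truncated.
\<close>

fun fst_value :: "nat \<Rightarrow> ('k \<Rightarrow> int) \<Rightarrow> 'k mv_term \<Rightarrow> int" where
  "fst_value m v (MVar i) = v i"
| "fst_value m v MZero = 0"
| "fst_value m v (MNeg t) = int m - fst_value m v t"
| "fst_value m v (MPlus s t) = min (fst_value m v s + fst_value m v t) (int m)"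

fun snd_value :: "nat \<Rightarrow> ('k \<Rightarrow> int) \<Rightarrow> 'k mv_term \<Rightarrow> ('k \<Rightarrow> real) \<Rightarrow> real" where
  "snd_value m v (MVar i) y = y i"
| "snd_value m v MZero y = 0"
| "snd_value m v (MNeg t) y = - snd_value m v t y"
| "snd_value m v (MPlus s t) y =
     (if fst_value m v s + fst_value m v t < int m then snd_value m v s y + snd_value m v t y
      else if fst_value m v s + fst_value m v t = int m
        then min (snd_value m v s y + snd_value m v t y) 0
      else 0)"

lemma Delta_simps:
  "mv_zero (Delta m) = Lex 0 0"
  "mv_neg (Delta m) (Lex a b) = Lex (int m - a) (- b)"
  "mv_plus (Delta m) (Lex a b) (Lex a' b') =
     (if a + a' < int m then Lex (a + a') (b + b')
      else if a + a' = int m then Lex (int m) (min (b + b') 0) else Lex (int m) 0)"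
  by (auto simp: Delta_def mv_Gamma_def zero_lex_def minus_lex_def plus_lex_def inf_lex_def
      less_eq_lex_def)

lemma Delta_carrier:
  "Lex a b \<in> mv_carrier (Delta m) \<longleftrightarrow>
     0 \<le> a \<and> a \<le> int m \<and> (a = 0 \<longrightarrow> 0 \<le> b) \<and> (a = int m \<longrightarrow> b \<le> 0)"
  by (auto simp: Delta_def mv_Gamma_def zero_lex_def less_eq_lex_def)

lemma mv_algebra_Delta: "mv_algebra (Delta m)"
  unfolding Delta_def by (rule mv_algebra_Gamma) (auto simp: zero_lex_def less_eq_lex_def)

lemma mv_eval_Delta:
  "mv_eval (Delta m) (\<lambda>i. Lex (v i) (y i)) t = Lex (fst_value m v t) (snd_value m v t y)"
  by (induction t) (auto simp: Delta_simps)

lemma mv_eval_Delta':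
  "mv_eval (Delta m) f t =
     Lex (fst_value m (\<lambda>i. lex_fst (f i)) t) (snd_value m (\<lambda>i. lex_fst (f i)) t (\<lambda>i. lex_snd (f i)))"
  using mv_eval_Delta[of m "\<lambda>i. lex_fst (f i)" "\<lambda>i. lex_snd (f i)" t] by simp

lemma finite_mv_vars: "finite (mv_vars t)"
  by (induction t) auto

lemma fst_value_cong: "(\<And>i. i \<in> mv_vars t \<Longrightarrow> v i = w i) \<Longrightarrow> fst_value m v t = fst_value m w t"
  by (induction t) auto

lemma snd_value_cong:
  "(\<And>i. i \<in> mv_vars t \<Longrightarrow> v i = w i) \<Longrightarrow> (\<And>i. i \<in> mv_vars t \<Longrightarrow> x i = y i) \<Longrightarrow>
     snd_value m v t x = snd_value m w t y"
  by (induction t) (auto cong: fst_value_cong)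

lemma snd_value_zero: "snd_value m v t (\<lambda>i. 0) = 0"
  by (induction t) auto

text \<open>
The continuity that is needed to carry linear formulas from a cell to its closure.
\<close>

lemma snd_value_ray:
  "((\<lambda>\<epsilon>. snd_value m v t (\<lambda>i. x i + \<epsilon> * y i)) \<longlongrightarrow> snd_value m v t x) (at_right 0)"
proof (induction t)
  case (MVar i)
  have "((\<lambda>\<epsilon>. x i + \<epsilon> * y i) \<longlongrightarrow> x i + 0 * y i) (at_right 0)" by (intro tendsto_intros)
  then show ?case by simp
next
  case (MPlus s t)
  have "((\<lambda>\<epsilon>. snd_value m v s (\<lambda>i. x i + \<epsilon> * y i) + snd_value m v t (\<lambda>i. x i + \<epsilon> * y i))
      \<longlongrightarrow> snd_value m v s x + snd_value m v t x) (at_right 0)"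
    using MPlus by (intro tendsto_intros)
  moreover from this have
    "((\<lambda>\<epsilon>. min (snd_value m v s (\<lambda>i. x i + \<epsilon> * y i) + snd_value m v t (\<lambda>i. x i + \<epsilon> * y i)) 0)
      \<longlongrightarrow> min (snd_value m v s x + snd_value m v t x) 0) (at_right 0)"
    by (intro tendsto_min tendsto_const)
  ultimately show ?case by simp
qed (auto intro: tendsto_intros)

text \<open>
Each cell has its own linear form for the function. These forms are required to be members of \<open>H\<close>, so
that not only the function is linear on every cell but its sign is constant there as well.
\<close>

definition adapted :: "'k set \<Rightarrow> ('k \<Rightarrow> rat) set \<Rightarrow> (('k \<Rightarrow> real) \<Rightarrow> real) \<Rightarrow> bool" where
  "adapted F H \<tau> \<longleftrightarrow> (\<forall>x. \<exists>l\<in>H. \<forall>y. same_sign F H x y \<longrightarrow> \<tau> y = lin F l y)"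

lemma adapted_mono: "adapted F H \<tau> \<Longrightarrow> H \<subseteq> H' \<Longrightarrow> adapted F H' \<tau>"
  unfolding adapted_def same_sign_def by (meson subsetD)

text \<open>
All operations on terms amount, on a cell, to taking one of two linear forms depending on the sign of
the first one; adding the first form to the arrangement makes that sign constant.
\<close>

lemma adapted_combine:
  assumes "adapted F H1 \<sigma>" "adapted F H2 \<tau>"
    and L: "\<And>a b. a \<in> H1 \<Longrightarrow> b \<in> H2 \<Longrightarrow> f a b \<in> H \<and> g a b \<in> H" and sub: "H1 \<union> H2 \<subseteq> H"
    and val: "\<And>a b y. a \<in> H1 \<Longrightarrow> b \<in> H2 \<Longrightarrow> \<sigma> y = lin F a y \<Longrightarrow> \<tau> y = lin F b y \<Longrightarrow>
      \<rho> y = (if 0 \<le> lin F (f a b) y then lin F (g a b) y else lin F (f a b) y)"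
  shows "adapted F H \<rho>"
  unfolding adapted_def
proof
  fix x
  obtain a where a: "a \<in> H1" "\<And>y. same_sign F H1 x y \<Longrightarrow> \<sigma> y = lin F a y"
    using assms(1) unfolding adapted_def by blast
  obtain b where b: "b \<in> H2" "\<And>y. same_sign F H2 x y \<Longrightarrow> \<tau> y = lin F b y"
    using assms(2) unfolding adapted_def by blast
  have ab: "f a b \<in> H" "g a b \<in> H" using L a(1) b(1) by auto
  have "\<rho> y = (if 0 \<le> lin F (f a b) x then lin F (g a b) y else lin F (f a b) y)"
    if y: "same_sign F H x y" for y
  proof -
    have "same_sign F H1 x y" "same_sign F H2 x y" using y sub by (auto simp: same_sign_def)
    then have "\<rho> y = (if 0 \<le> lin F (f a b) y then lin F (g a b) y else lin F (f a b) y)"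
      using val a b by blast
    moreover have "sgn (lin F (f a b) x) = sgn (lin F (f a b) y)"
      using y ab by (simp add: same_sign_def)
    then have "0 \<le> lin F (f a b) x \<longleftrightarrow> 0 \<le> lin F (f a b) y"
      by (auto simp: sgn_if split: if_splits)
    ultimately show ?thesis by simp
  qed
  then show "\<exists>l\<in>H. \<forall>y. same_sign F H x y \<longrightarrow> \<rho> y = lin F l y"
    using ab by (cases "0 \<le> lin F (f a b) x") auto
qed

lemma adapted_snd_value_ex:
  assumes F: "finite F" and t: "mv_vars t \<subseteq> F"
  shows "\<exists>H. finite H \<and> adapted F H (snd_value m v t)"
  using t
proof (induction t)
  case (MVar j)
  have "adapted F {\<lambda>i. if i = j then 1 else 0} (snd_value m v (MVar j))"
    unfolding adapted_def using lin_unit_form[OF F, of j] MVar by simp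
  then show ?case by (intro exI conjI[rotated]) (assumption, simp)
next
  case MZero
  have "adapted F {\<lambda>i. 0} (snd_value m v MZero)" by (simp add: adapted_def lin_zero_form)
  then show ?case by (intro exI conjI[rotated]) (assumption, simp)
next
  case (MNeg t)
  then obtain H where H: "finite H" "adapted F H (snd_value m v t)" by auto
  have "adapted F (H \<union> (\<lambda>a i. - a i) ` H) (snd_value m v (MNeg t))"
    by (rule adapted_combine[OF H(2) H(2), of "\<lambda>a b i. - a i" _ "\<lambda>a b i. - a i"])
      (auto simp: lin_uminus_form)
  moreover have "finite (H \<union> (\<lambda>a i. - a i) ` H)" using H(1) by simp
  ultimately show ?case by (intro exI conjI)
next
  case (MPlus s t)
  then obtain H1 H2 where H: "finite H1" "adapted F H1 (snd_value m v s)"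
    "finite H2" "adapted F H2 (snd_value m v t)" by auto
  define S where "S = (\<lambda>(a, b) i. a i + b i) ` (H1 \<times> H2)"
  define H where "H = insert (\<lambda>i. 0) (H1 \<union> H2 \<union> S)"
  have S: "(\<lambda>i. a i + b i) \<in> H" if "a \<in> H1" "b \<in> H2" for a b
    using that by (auto simp: H_def S_def)
  have "finite H" using H(1,3) by (simp add: H_def S_def)
  moreover have "adapted F H (snd_value m v (MPlus s t))"
  proof -
    let ?n = "fst_value m v s + fst_value m v t"
    consider "?n < int m" | "?n = int m" | "?n > int m" by linarith
    then show ?thesis
    proof cases
      case 1
      show ?thesis
        by (rule adapted_combine[OF H(2,4), of "\<lambda>a b i. a i + b i" _ "\<lambda>a b i. a i + b i"])
          (use 1 S in \<open>auto simp: H_def lin_add_form\<close>)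
    next
      case 2
      show ?thesis
        by (rule adapted_combine[OF H(2,4), of "\<lambda>a b i. a i + b i" _ "\<lambda>a b i. 0"])
          (use 2 S in \<open>auto simp: H_def lin_add_form lin_zero_form min_def\<close>)
    next
      case 3
      show ?thesis
        by (rule adapted_combine[OF H(2,4), of "\<lambda>a b i. 0" _ "\<lambda>a b i. 0"])
          (use 3 in \<open>auto simp: H_def lin_zero_form\<close>)
    qed
  qed
  ultimately show ?case by (intro exI conjI)
qed

text \<open>
For \<open>p\<close> in the closure of the cell of \<open>x\<close> the points \<open>p + \<epsilon> x\<close> lie in the cell of \<open>x\<close>; now let \<open>\<epsilon>\<close> tend
to \<open>0\<close>.
\<close>

lemma adapted_face:
  assumes ad: "\<forall>y. same_sign F H x y \<longrightarrow> snd_value m v t y = lin F l y"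
    and face: "face_le F H p x"
  shows "snd_value m v t p = lin F l p"
proof -
  have eq: "snd_value m v t (\<lambda>i. p i + \<epsilon> * x i) = lin F l p + \<epsilon> * lin F l x" if "\<epsilon> > 0" for \<epsilon>
  proof -
    have "sgn (lin F a x) = sgn (lin F a (\<lambda>i. p i + \<epsilon> * x i))" if a: "a \<in> H" for a
    proof -
      have "lin F a (\<lambda>i. p i + \<epsilon> * x i) = lin F a p + \<epsilon> * lin F a x"
        by (simp add: lin_add lin_scale)
      moreover have "lin F a p = 0 \<or> sgn (lin F a p) = sgn (lin F a x)"
        using face a by (simp add: face_le_def)
      moreover have "sgn (\<epsilon> * lin F a x) = sgn (lin F a x)" using \<open>\<epsilon> > 0\<close> by (simp add: sgn_mult)
      moreover have "sgn (b + c) = sgn c" if "b = 0 \<or> sgn b = sgn c" for b c :: real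
        using that by (auto simp: sgn_if split: if_splits)
      ultimately show ?thesis by metis
    qed
    then have "same_sign F H x (\<lambda>i. p i + \<epsilon> * x i)" by (simp add: same_sign_def)
    then show ?thesis using ad by (simp add: lin_add lin_scale)
  qed
  have "((\<lambda>\<epsilon>. lin F l p + \<epsilon> * lin F l x) \<longlongrightarrow> lin F l p + 0 * lin F l x) (at_right 0)"
    by (intro tendsto_intros)
  moreover have "((\<lambda>\<epsilon>. lin F l p + \<epsilon> * lin F l x) \<longlongrightarrow> snd_value m v t p) (at_right 0)"
    using snd_value_ray[of m v t p x]
    by (rule Lim_transform_eventually) (auto simp: eq eventually_at_filter)
  ultimately show ?thesis using tendsto_unique[OF trivial_limit_at_right_real] by fastforce
qed

lemma arrangement_ex:
  assumes F: "finite F" and H: "finite H"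
  shows "\<exists>H'. arrangement F H' \<and> H \<subseteq> H'"
proof -
  have "arrangement F (H \<union> (\<lambda>j i. if i = j then 1 else 0) ` F)"
    using assms by unfold_locales auto
  then show ?thesis by blast
qed

lemma (in arrangement) quadrants_face:
  assumes "x \<in> quadrants m F v" "y \<in> F \<rightarrow>\<^sub>E UNIV" "face_le F H y x"
  shows "y \<in> quadrants m F v"
proof -
  have "y i = 0 \<or> sgn (y i) = sgn (x i)" if "i \<in> F" for i
    using assms(3) coordinates[OF that] lin_unit_form[OF finF that] unfolding face_le_def by metis
  then show ?thesis using assms(1,2) unfolding quadrants_def
    by (force simp: sgn_if split: if_splits)
qed

lemma quadrants_zero: "(\<lambda>i\<in>F. 0) \<in> quadrants m F v"
  by (simp add: quadrants_def)

lemma beta_in_radical_class: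
  assumes "m \<ge> 1" "v \<in> F \<rightarrow>\<^sub>E {0..int m}" "x \<in> quadrants m F v"
  shows "beta F v x \<in> radical_class m F v"
  using bij_betw_beta[OF assms(1,2)] assms(3) by (auto simp: bij_betw_def)

lemma mv_eval_beta:
  assumes "mv_vars t \<subseteq> F"
  shows "mv_eval (Delta m) (beta F v x) t = Lex (fst_value m v t) (snd_value m v t x)"
proof -
  have "mv_eval (Delta m) (beta F v x) t = mv_eval (Delta m) (\<lambda>i. Lex (v i) (x i)) t"
    using assms by (intro mv_eval_cong) (auto simp: beta_def)
  then show ?thesis by (simp add: mv_eval_Delta)
qed

lemma radical_class_beta:
  assumes "m \<ge> 1" "v \<in> F \<rightarrow>\<^sub>E {0..int m}" "f \<in> radical_class m F v"
  obtains x where "x \<in> quadrants m F v" "f = beta F v x"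
  using bij_betw_beta[OF assms(1,2)] assms(3) by (auto simp: bij_betw_def)

definition zero_set :: "nat \<Rightarrow> 'k set \<Rightarrow> 'k mv_term \<Rightarrow> ('k \<Rightarrow> (int, real) lex) set" where
  "zero_set m I t = {f \<in> Delta_pow m I. mv_eval (Delta m) f t = mv_zero (Delta m)}"

text \<open>
In a radical class where the first coordinate of \<open>t\<close> vanishes, the zero set is a union of cells of an
adapted arrangement, and it contains the closures of its cells by \<open>adapted_face\<close>. In the other radical
classes it is empty, which is the support of the empty fan.
\<close>

lemma zero_set_m_fan:
  assumes m: "m \<ge> 1" and F: "finite F" and t: "mv_vars t \<subseteq> F"
  shows "m_fan m F (zero_set m F t)"
  unfolding m_fan_def
proof (intro conjI ballI)
  show "zero_set m F t \<subseteq> Delta_pow m F" by (auto simp: zero_set_def)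
next
  fix v assume v: "v \<in> F \<rightarrow>\<^sub>E {0..int m}"
  show "\<exists>\<phi>. rational_fan F \<phi> \<and> \<Union>\<phi> \<subseteq> quadrants m F v \<and>
            zero_set m F t \<inter> radical_class m F v = beta F v ` \<Union>\<phi>"
  proof (cases "fst_value m v t = 0")
    case False
    have "mv_eval (Delta m) f t \<noteq> mv_zero (Delta m)" if f: "f \<in> radical_class m F v" for f
    proof -
      obtain x where "f = beta F v x" using radical_class_beta[OF m v f] by blast
      then show ?thesis using mv_eval_beta[OF t] False by (simp add: Delta_simps)
    qed
    then have "zero_set m F t \<inter> radical_class m F v = beta F v ` \<Union>{}"
      by (auto simp: zero_set_def)
    moreover have "rational_fan F {}" by (simp add: rational_fan_def fan_def)
    ultimately show ?thesis by blast
  next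
    case True
    obtain H0 where H0: "finite H0" "adapted F H0 (snd_value m v t)"
      using adapted_snd_value_ex[OF F t] by blast
    obtain H where H: "arrangement F H" "H0 \<subseteq> H" using arrangement_ex[OF F H0(1)] by blast
    interpret arrangement F H by fact
    have ad: "adapted F H (snd_value m v t)" using H0(2) H(2) by (rule adapted_mono)
    define D where "D = {x \<in> quadrants m F v. snd_value m v t x = 0}"
    have "\<exists>\<phi>. rational_fan F \<phi> \<and> \<Union>\<phi> = D"
    proof (rule rational_fan_of_cells)
      show "D \<subseteq> F \<rightarrow>\<^sub>E UNIV" by (auto simp: D_def quadrants_def)
      have "snd_value m v t (\<lambda>i\<in>F. 0) = snd_value m v t (\<lambda>i. 0)"
        using t by (intro snd_value_cong) auto
      then show "D \<noteq> {}" using quadrants_zero[of F m v] by (auto simp: D_def snd_value_zero)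
      show "y \<in> D" if xy: "x \<in> D" "y \<in> F \<rightarrow>\<^sub>E UNIV" "face_le F H y x" for x y
      proof -
        obtain l where l: "l \<in> H" "\<forall>y. same_sign F H x y \<longrightarrow> snd_value m v t y = lin F l y"
          using ad unfolding adapted_def by blast
        have "lin F l x = 0" using l(2)[rule_format, of x] xy(1) by (simp add: same_sign_def D_def)
        then have "lin F l y = 0" using xy(3) l(1) by (auto simp: face_le_def sgn_0_0)
        then have "snd_value m v t y = 0" using adapted_face[OF l(2) xy(3)] by simp
        then show ?thesis using quadrants_face[of x m v y] xy by (simp add: D_def)
      qed
    qed
    then obtain \<phi> where \<phi>: "rational_fan F \<phi>" "\<Union>\<phi> = D" by blast
    have "zero_set m F t \<inter> radical_class m F v = beta F v ` D"
    proof
      show "zero_set m F t \<inter> radical_class m F v \<subseteq> beta F v ` D"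
      proof
        fix f assume f: "f \<in> zero_set m F t \<inter> radical_class m F v"
        then obtain x where x: "x \<in> quadrants m F v" "f = beta F v x"
          using radical_class_beta[OF m v] by blast
        then have "x \<in> D" using f mv_eval_beta[OF t] by (auto simp: D_def zero_set_def Delta_simps)
        then show "f \<in> beta F v ` D" using x by blast
      qed
      show "beta F v ` D \<subseteq> zero_set m F t \<inter> radical_class m F v"
        using beta_in_radical_class[OF m v] mv_eval_beta[OF t] True
        by (auto simp: D_def zero_set_def Delta_simps radical_class_def)
    qed
    then show ?thesis using \<phi> by (intro exI[of _ \<phi>]) (auto simp: D_def)
  qed
qed

section \<open>Identities of the Komori chain\<close>

definition of_int_lex :: "(int, int) lex \<Rightarrow> (int, real) lex" where
  "of_int_lex x = Lex (lex_fst x) (of_int (lex_snd x))"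

lemma of_int_lex_inj: "of_int_lex x = of_int_lex y \<Longrightarrow> x = y"
  by (cases x; cases y) (simp add: of_int_lex_def)

lemma of_int_lex_Komori:
  "of_int_lex (mv_zero (Komori m)) = mv_zero (Delta m)"
  "of_int_lex (mv_neg (Komori m) x) = mv_neg (Delta m) (of_int_lex x)"
  "of_int_lex (mv_plus (Komori m) x y) = mv_plus (Delta m) (of_int_lex x) (of_int_lex y)"
  "of_int_lex x \<in> mv_carrier (Delta m) \<longleftrightarrow> x \<in> mv_carrier (Komori m)"
  by (auto simp: of_int_lex_def Komori_def Delta_def mv_Gamma_def zero_lex_def minus_lex_def
      plus_lex_def inf_lex_def less_eq_lex_def)

lemma mv_eval_of_int_lex:
  "mv_eval (Delta m) (\<lambda>i. of_int_lex (\<rho> i)) t = of_int_lex (mv_eval (Komori m) \<rho> t)"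
  by (induction t) (simp_all add: of_int_lex_Komori)

lemma Delta_identities_Komori:
  fixes s t :: "'k mv_term"
  assumes "mv_satisfies (Delta m) s t" shows "mv_satisfies (Komori m) s t"
  unfolding mv_satisfies_def
proof (intro allI impI)
  fix \<rho> :: "'k \<Rightarrow> (int, int) lex" assume "\<forall>i. \<rho> i \<in> mv_carrier (Komori m)"
  then have "\<forall>i. of_int_lex (\<rho> i) \<in> mv_carrier (Delta m)" by (simp add: of_int_lex_Komori)
  then have "of_int_lex (mv_eval (Komori m) \<rho> s) = of_int_lex (mv_eval (Komori m) \<rho> t)"
    using assms unfolding mv_satisfies_def by (simp flip: mv_eval_of_int_lex)
  then show "mv_eval (Komori m) \<rho> s = mv_eval (Komori m) \<rho> t" by (rule of_int_lex_inj)
qed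

lemma common_denominator:
  assumes "finite F" "rational_vector F z"
  shows "\<exists>N::nat. N > 0 \<and> (\<forall>i\<in>F. of_nat N * z i \<in> \<int>)"
  using assms
proof (induction F)
  case empty
  then show ?case by (auto intro: exI[of _ 1])
next
  case (insert j F)
  then obtain N :: nat where N: "N > 0" "\<forall>i\<in>F. of_nat N * z i \<in> \<int>"
    by (auto simp: rational_vector_def)
  have "z j \<in> \<rat>" using insert.prems by (simp add: rational_vector_def)
  then obtain a :: int and b :: int where ab: "b > 0" "z j = of_int a / of_int b"
    by (auto elim: Rats_cases')
  have "of_nat (N * nat b) * z i \<in> \<int>" if "i \<in> insert j F" for i
  proof (cases "i = j")
    case True
    have "of_nat (N * nat b) * z j = of_int (int N * a)" using ab by simp
    then show ?thesis unfolding True by (metis Ints_of_int)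
  next
    case False
    then have "of_nat N * z i \<in> \<int>" using that N by simp
    then have "of_int b * (of_nat N * z i) \<in> \<int>" by (rule Ints_mult[OF Ints_of_int])
    then show ?thesis using ab by (simp add: algebra_simps)
  qed
  then show ?case using N(1) ab(1) by (intro exI[of _ "N * nat b"]) auto
qed

text \<open>
Suppose the identity fails at a point \<open>y\<close> of a radical class. If the first coordinates differ, it
fails at the integral point \<open>0\<close> of that class. Otherwise take an arrangement containing the forms of
\<open>s\<close>, those of \<open>t\<close> and all their differences. The identity fails throughout the cell of \<open>y\<close>, which
contains a rational point and all its positive multiples, hence an integral point.
\<close>

theorem Komori_identities_Delta:
  fixes s t :: "'k mv_term"
  assumes m: "m \<ge> 1" and id: "mv_satisfies (Komori m) s t"
  shows "mv_satisfies (Delta m) s t"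
  unfolding mv_satisfies_def
proof (intro allI impI, rule ccontr)
  fix f :: "'k \<Rightarrow> (int, real) lex"
  assume f: "\<forall>i. f i \<in> mv_carrier (Delta m)"
    and neq: "mv_eval (Delta m) f s \<noteq> mv_eval (Delta m) f t"
  define v y where "v i = lex_fst (f i)" and "y i = lex_snd (f i)" for i
  have vy: "0 \<le> v i" "v i \<le> int m" "v i = 0 \<Longrightarrow> 0 \<le> y i" "v i = int m \<Longrightarrow> y i \<le> 0" for i
    using f[rule_format, of i] unfolding v_def y_def by (cases "f i"; simp add: Delta_carrier)+
  have neq': "Lex (fst_value m v s) (snd_value m v s y) \<noteq> Lex (fst_value m v t) (snd_value m v t y)"
    using neq unfolding mv_eval_Delta'[of m f] v_def y_def .
  define F where "F = mv_vars s \<union> mv_vars t"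
  have F: "finite F" "mv_vars s \<subseteq> F" "mv_vars t \<subseteq> F" by (auto simp: F_def finite_mv_vars)
  have int_point: "fst_value m v s = fst_value m v t \<and> snd_value m v s w = snd_value m v t w"
    if w: "\<And>i. i \<in> F \<Longrightarrow> w i \<in> \<int>" and sg: "\<And>i. i \<in> F \<Longrightarrow> w i = 0 \<or> sgn (w i) = sgn (y i)" for w
  proof -
    define \<rho> where "\<rho> i = (if i \<in> F then Lex (v i) \<lfloor>w i\<rfloor> else Lex 0 0)" for i
    have \<rho>: "of_int_lex (\<rho> i) = Lex (v i) (w i)" if "i \<in> F" for i
      using that w[OF that] by (simp add: \<rho>_def of_int_lex_def)
    have "\<forall>i. of_int_lex (\<rho> i) \<in> mv_carrier (Delta m)"
    proof
      fix i show "of_int_lex (\<rho> i) \<in> mv_carrier (Delta m)"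
      proof (cases "i \<in> F")
        case True
        show ?thesis unfolding \<rho>[OF True] Delta_carrier
          using vy[of i] sg[OF True] by (auto simp: sgn_if split: if_splits)
      next
        case False
        then show ?thesis by (simp add: \<rho>_def of_int_lex_def Delta_carrier)
      qed
    qed
    then have "mv_eval (Komori m) \<rho> s = mv_eval (Komori m) \<rho> t"
      using id by (simp add: mv_satisfies_def of_int_lex_Komori)
    moreover have "of_int_lex (mv_eval (Komori m) \<rho> r) = Lex (fst_value m v r) (snd_value m v r w)"
      if "mv_vars r \<subseteq> F" for r
    proof -
      have "mv_eval (Delta m) (\<lambda>i. of_int_lex (\<rho> i)) r = mv_eval (Delta m) (\<lambda>i. Lex (v i) (w i)) r"
        using \<rho> that by (intro mv_eval_cong) auto
      then show ?thesis by (simp add: mv_eval_of_int_lex mv_eval_Delta)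
    qed
    ultimately show ?thesis using F by (metis lex.inject)
  qed
  have "fst_value m v s = fst_value m v t" using int_point[of "\<lambda>i. 0"] by simp
  then have yneq: "snd_value m v s y \<noteq> snd_value m v t y" using neq' by simp
  obtain H1 where H1: "finite H1" "adapted F H1 (snd_value m v s)"
    using adapted_snd_value_ex[OF F(1,2)] by blast
  obtain H2 where H2: "finite H2" "adapted F H2 (snd_value m v t)"
    using adapted_snd_value_ex[OF F(1,3)] by blast
  \<comment> \<open>The sign of a difference of forms tells on a whole cell whether both sides agree.\<close>
  define S where "S = (\<lambda>(a, b) i. a i + - b i) ` (H1 \<times> H2)"
  have "finite (H1 \<union> H2 \<union> S)" using H1 H2 by (simp add: S_def)
  from arrangement_ex[OF F(1) this] obtain H
    where H: "arrangement F H" "H1 \<union> H2 \<union> S \<subseteq> H" by (elim exE conjE)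
  interpret arrangement F H by fact
  obtain z where z: "rational_vector F z" "same_sign F H y z"
    using rational_same_sign[OF finF finH] by blast
  obtain N :: nat where N: "N > 0" "\<forall>i\<in>F. of_nat N * z i \<in> \<int>"
    using common_denominator[OF F(1) z(1)] by blast
  define w where "w i = of_nat N * z i" for i
  have "lin F a w = of_nat N * lin F a z" for a
    using lin_scale[of F a "of_nat N" z] by (simp add: w_def[abs_def])
  then have yw: "same_sign F H y w" using z(2) N(1) by (simp add: same_sign_def sgn_mult)
  obtain a where a: "a \<in> H1" "\<And>x. same_sign F H1 y x \<Longrightarrow> snd_value m v s x = lin F a x"
    using H1(2) unfolding adapted_def by blast
  obtain b where b: "b \<in> H2" "\<And>x. same_sign F H2 y x \<Longrightarrow> snd_value m v t x = lin F b x"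
    using H2(2) unfolding adapted_def by blast
  have ab: "(\<lambda>i. a i + - b i) \<in> H"
  proof -
    have "(\<lambda>i. a i + - b i) \<in> S"
      unfolding S_def using a(1) b(1) by (intro image_eqI[of _ _ "(a, b)"]) auto
    then show ?thesis using H(2) by blast
  qed
  have sub: "same_sign F H1 y x \<and> same_sign F H2 y x" if "same_sign F H y x" for x
    using that H(2) by (auto simp: same_sign_def)
  have diff: "lin F (\<lambda>i. a i + - b i) x = snd_value m v s x - snd_value m v t x"
    if "same_sign F H y x" for x
    using a(2)[of x] b(2)[of x] sub[OF that] lin_add_form[of F a "\<lambda>i. - b i" x] lin_uminus_form[of F b x]
    by simp
  have "w i = 0 \<or> sgn (w i) = sgn (y i)" if "i \<in> F" for i
    using yw coordinates[OF that] lin_unit_form[OF finF that] unfolding same_sign_def by metis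
  then have "snd_value m v s w = snd_value m v t w" using int_point[of w] N(2) by (simp add: w_def)
  then have "lin F (\<lambda>i. a i + - b i) w = 0" using diff[OF yw] by simp
  then have "lin F (\<lambda>i. a i + - b i) y = 0" using yw ab unfolding same_sign_def by (metis sgn_0_0)
  moreover have "same_sign F H y y" by (simp add: same_sign_def)
  ultimately show False using diff[of y] yneq by simp
qed

section \<open>Inclusion of zero sets\<close>

fun term_mult :: "nat \<Rightarrow> 'v mv_term \<Rightarrow> 'v mv_term" where
  "term_mult 0 s = MZero"
| "term_mult (Suc n) s = MPlus s (term_mult n s)"

lemma mv_vars_term_mult: "mv_vars (term_mult n s) \<subseteq> mv_vars s"
  by (induction n) auto

lemma mv_le_Gamma: "mv_le (mv_Gamma u) x y \<longleftrightarrow> x \<le> (y::'g::lattice_ab_group_add)"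
proof -
  have "mv_le (mv_Gamma u) x y \<longleftrightarrow> inf (u - x + y) u = u" by (simp add: mv_le_def mv_Gamma_def)
  also have "\<dots> \<longleftrightarrow> u \<le> u - x + y" by (metis inf.absorb2 inf.cobounded1)
  also have "\<dots> \<longleftrightarrow> 0 \<le> y - x" by (simp add: algebra_simps)
  finally show ?thesis by simp
qed

lemma mv_le_Delta: "mv_le (Delta m) x y \<longleftrightarrow> x \<le> y"
  by (simp add: Delta_def mv_le_Gamma)

lemma Delta_carrier_iff: "x \<in> mv_carrier (Delta m) \<longleftrightarrow> 0 \<le> x \<and> x \<le> Lex (int m) 0"
  by (simp add: Delta_def mv_Gamma_def)

lemma mv_eval_Delta_pow:
  assumes "f \<in> Delta_pow m F" "mv_vars t \<subseteq> F"
  shows "mv_eval (Delta m) f t \<in> mv_carrier (Delta m)"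
  by (rule mv_eval_closed[OF mv_algebra_Delta]) (use assms in \<open>auto simp: Delta_pow_def\<close>)

lemma Delta_plus_upper:
  assumes "x \<in> mv_carrier (Delta m)" "y \<in> mv_carrier (Delta m)"
  shows "y \<le> mv_plus (Delta m) x y"
proof -
  have "y \<le> x + y" using assms(1) by (simp add: Delta_carrier_iff)
  then show ?thesis using assms(2) by (simp add: Delta_def mv_Gamma_def)
qed

lemma term_mult_mono:
  assumes f: "f \<in> Delta_pow m F" and s: "mv_vars s \<subseteq> F" and nk: "n \<le> k"
  shows "mv_eval (Delta m) f (term_mult n s) \<le> mv_eval (Delta m) f (term_mult k s)"
proof (rule lift_Suc_mono_le[OF _ nk])
  fix n
  have "mv_vars (term_mult n s) \<subseteq> F" using mv_vars_term_mult[of n s] s by blast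
  then show "mv_eval (Delta m) f (term_mult n s) \<le> mv_eval (Delta m) f (term_mult (Suc n) s)"
    using Delta_plus_upper mv_eval_Delta_pow[OF f] s by simp
qed

text \<open>
On a cone of the barycentric subdivision both functions are linear, so the inequality holds as soon as
it holds at the finitely many vertices. At a vertex where \<open>s\<close> vanishes so does \<open>t\<close>; elsewhere the
quotient of the two values bounds \<open>n\<close> from below.
\<close>

lemma snd_value_dominated:
  assumes m: "m \<ge> 1" and F: "finite F" and v: "v \<in> F \<rightarrow>\<^sub>E {0..int m}"
    and vars: "mv_vars s \<subseteq> F" "mv_vars t \<subseteq> F"
    and nonneg: "\<And>x. x \<in> quadrants m F v \<Longrightarrow> 0 \<le> snd_value m v s x"
    and zero: "\<And>x. x \<in> quadrants m F v \<Longrightarrow> snd_value m v s x = 0 \<Longrightarrow> snd_value m v t x = 0"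
  shows "\<exists>n::nat. \<forall>x\<in>quadrants m F v. snd_value m v t x \<le> of_nat n * snd_value m v s x"
proof -
  let ?\<sigma> = "snd_value m v s" and ?\<tau> = "snd_value m v t"
  obtain H1 where H1: "finite H1" "adapted F H1 ?\<sigma>" using adapted_snd_value_ex[OF F vars(1)] by blast
  obtain H2 where H2: "finite H2" "adapted F H2 ?\<tau>" using adapted_snd_value_ex[OF F vars(2)] by blast
  have "finite (H1 \<union> H2)" using H1(1) H2(1) by simp
  from arrangement_ex[OF F this] obtain H
    where H: "arrangement F H" "H1 \<union> H2 \<subseteq> H" by (elim exE conjE)
  interpret arrangement F H by fact
  have ad: "adapted F H ?\<sigma>" "adapted F H ?\<tau>" using H1(2) H2(2) H(2) by (auto intro: adapted_mono)
  define r where "r = (\<Sum>p\<in>vertices. \<bar>?\<tau> p / ?\<sigma> p\<bar>)"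
  obtain n :: nat where n: "r \<le> of_nat n" using real_arch_simple by blast
  have vert: "?\<tau> p \<le> of_nat n * ?\<sigma> p" if p: "p \<in> vertices" "p \<in> quadrants m F v" for p
  proof (cases "?\<sigma> p = 0")
    case True
    then show ?thesis using zero p by simp
  next
    case False
    then have pos: "?\<sigma> p > 0" using nonneg[OF p(2)] by simp
    have "\<bar>?\<tau> p / ?\<sigma> p\<bar> \<le> r" unfolding r_def
      using member_le_sum[OF p(1) _ finite_vertices, of "\<lambda>p. \<bar>?\<tau> p / ?\<sigma> p\<bar>"] by simp
    then have "?\<tau> p / ?\<sigma> p \<le> of_nat n" using n by linarith
    then show ?thesis using pos by (simp add: pos_divide_le_eq)
  qed
  have "?\<tau> x \<le> of_nat n * ?\<sigma> x" if x: "x \<in> quadrants m F v" for x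
  proof -
    obtain S c where S: "flag S" "\<forall>p\<in>S. 0 < c p \<and> face_le F H p x" "x = comb S c"
      using flag_cover[of x] x by (auto simp: quadrants_def)
    have Sq: "p \<in> vertices \<and> p \<in> quadrants m F v" if "p \<in> S" for p
      using that S(1,2) vertices_props(2) quadrants_face[OF x] by (auto simp: flag_def)
    obtain a where a: "\<forall>y. same_sign F H x y \<longrightarrow> ?\<sigma> y = lin F a y"
      using ad(1) unfolding adapted_def by blast
    obtain b where b: "\<forall>y. same_sign F H x y \<longrightarrow> ?\<tau> y = lin F b y"
      using ad(2) unfolding adapted_def by blast
    have xx: "same_sign F H x x" by (simp add: same_sign_def)
    have ap: "lin F a p = ?\<sigma> p" "lin F b p = ?\<tau> p" if "p \<in> S" for p
      using adapted_face[OF a] adapted_face[OF b] S(2) that by auto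
    have "?\<tau> x = (\<Sum>p\<in>S. c p * lin F b p)" using b xx lin_comb[where a=b and S=S and c=c] S(3) by simp
    also have "\<dots> = (\<Sum>p\<in>S. c p * ?\<tau> p)" using ap by simp
    also have "\<dots> \<le> (\<Sum>p\<in>S. c p * (of_nat n * ?\<sigma> p))"
      using S(2) vert Sq by (intro sum_mono mult_left_mono) (auto intro: less_imp_le)
    also have "\<dots> = of_nat n * (\<Sum>p\<in>S. c p * lin F a p)"
      using ap by (simp add: sum_distrib_left algebra_simps)
    also have "(\<Sum>p\<in>S. c p * lin F a p) = ?\<sigma> x" using a xx lin_comb[where a=a and S=S and c=c] S(3) by simp
    finally show ?thesis .
  qed
  then show ?thesis by blast
qed

text \<open>
If the first coordinate of \<open>s\<close> is positive on the class, the multiple \<open>(m + 1) s\<close> is already the unit.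
If it is zero, \<open>s\<close> vanishes at the origin of the class, so the first coordinate of \<open>t\<close> is zero too, and
the second coordinates can be compared.
\<close>

lemma zero_set_subset_class:
  assumes m: "m \<ge> 1" and F: "finite F" and vars: "mv_vars s \<subseteq> F" "mv_vars t \<subseteq> F"
    and sub: "zero_set m F s \<subseteq> zero_set m F t" and v: "v \<in> F \<rightarrow>\<^sub>E {0..int m}"
  shows "\<exists>n. \<forall>f\<in>radical_class m F v. mv_eval (Delta m) f t \<le> mv_eval (Delta m) f (term_mult n s)"
proof -
  have car: "beta F v x \<in> Delta_pow m F" if "x \<in> quadrants m F v" for x
    using beta_in_radical_class[OF m v that] by (auto simp: radical_class_def)
  have val: "Lex (fst_value m v r) (snd_value m v r x) \<in> mv_carrier (Delta m)"
    if "x \<in> quadrants m F v" "mv_vars r \<subseteq> F" for x r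
    using mv_eval_Delta_pow[OF car[OF that(1)] that(2)] mv_eval_beta[OF that(2), of m v x] by simp
  have fst_mult: "fst_value m v (term_mult n s) \<ge> min (int n) (int m)"
    if "fst_value m v s \<ge> 1" for n
    using that by (induction n) auto
  have "fst_value m v s \<ge> 0" using val[OF quadrants_zero vars(1)] by (simp add: Delta_carrier)
  then consider "fst_value m v s \<ge> 1" | "fst_value m v s = 0" by linarith
  then show ?thesis
  proof cases
    case 1
    have "mv_eval (Delta m) f t \<le> mv_eval (Delta m) f (term_mult (Suc m) s)"
      if f: "f \<in> radical_class m F v" for f
    proof -
      obtain x where x: "x \<in> quadrants m F v" "f = beta F v x" using radical_class_beta[OF m v f] by blast
      have vm: "mv_vars (term_mult n s) \<subseteq> F" for n using mv_vars_term_mult[of n s] vars(1) by blast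
      have "fst_value m v s + fst_value m v (term_mult m s) > int m"
        using fst_mult[OF 1, of m] 1 by simp
      then have "mv_eval (Delta m) f (term_mult (Suc m) s) = Lex (int m) 0"
        using mv_eval_beta[OF vm[of "Suc m"], of m v x] x(2) by simp
      moreover have "mv_eval (Delta m) f t \<in> mv_carrier (Delta m)"
        using mv_eval_Delta_pow[OF car[OF x(1)] vars(2)] x(2) by simp
      ultimately show ?thesis by (simp add: Delta_carrier_iff)
    qed
    then show ?thesis by blast
  next
    case 2
    have zs: "beta F v x \<in> zero_set m F r \<longleftrightarrow> fst_value m v r = 0 \<and> snd_value m v r x = 0"
      if "x \<in> quadrants m F v" "mv_vars r \<subseteq> F" for x r
      using car[OF that(1)] mv_eval_beta[OF that(2), of m v x] by (simp add: zero_set_def Delta_simps)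
    have "snd_value m v s (\<lambda>i\<in>F. 0) = snd_value m v s (\<lambda>i. 0)"
      using vars(1) by (intro snd_value_cong) auto
    then have t0: "fst_value m v t = 0"
      using zs[OF quadrants_zero vars(1)] zs[OF quadrants_zero vars(2)] 2 sub
      by (auto simp: snd_value_zero)
    have "\<exists>n::nat. \<forall>x\<in>quadrants m F v. snd_value m v t x \<le> of_nat n * snd_value m v s x"
    proof (rule snd_value_dominated[OF m F v vars])
      show "0 \<le> snd_value m v s x" if "x \<in> quadrants m F v" for x
        using val[OF that vars(1)] 2 by (simp add: Delta_carrier)
      show "snd_value m v t x = 0" if "x \<in> quadrants m F v" "snd_value m v s x = 0" for x
        using zs[OF that(1) vars(1)] zs[OF that(1) vars(2)] 2 that(2) sub by auto
    qed
    then obtain n :: nat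
      where n: "\<And>x. x \<in> quadrants m F v \<Longrightarrow> snd_value m v t x \<le> of_nat n * snd_value m v s x"
      by blast
    have mult: "fst_value m v (term_mult n s) = 0 \<and>
        snd_value m v (term_mult n s) x = of_nat n * snd_value m v s x" for n x
      using 2 m by (induction n) (auto simp: algebra_simps)
    have "mv_eval (Delta m) f t \<le> mv_eval (Delta m) f (term_mult n s)"
      if f: "f \<in> radical_class m F v" for f
    proof -
      obtain x where x: "x \<in> quadrants m F v" "f = beta F v x" using radical_class_beta[OF m v f] by blast
      have vm: "mv_vars (term_mult n s) \<subseteq> F" using mv_vars_term_mult[of n s] vars(1) by blast
      show ?thesis
        using mv_eval_beta[OF vm, of m v x] mv_eval_beta[OF vars(2), of m v x] mult n[OF x(1)] t0
        by (simp add: x(2) less_eq_lex_def)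
    qed
    then show ?thesis by blast
  qed
qed

lemma Delta_pow_class:
  assumes f: "f \<in> Delta_pow m F"
  shows "\<exists>v \<in> F \<rightarrow>\<^sub>E {0..int m}. f \<in> radical_class m F v"
proof
  have "lex_fst (f i) \<in> {0..int m}" if "i \<in> F" for i
  proof -
    have "f i \<in> mv_carrier (Delta m)" using f that by (auto simp: Delta_pow_def)
    then show ?thesis by (cases "f i") (simp add: Delta_carrier)
  qed
  then show "(\<lambda>i\<in>F. lex_fst (f i)) \<in> F \<rightarrow>\<^sub>E {0..int m}" by auto
  show "f \<in> radical_class m F (\<lambda>i\<in>F. lex_fst (f i))" using f by (simp add: radical_class_def)
qed

lemma zero_set_subset_finite:
  assumes m: "m \<ge> 1" and F: "finite F" and vars: "mv_vars s \<subseteq> F" "mv_vars t \<subseteq> F"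
    and sub: "zero_set m F s \<subseteq> zero_set m F t"
  shows "\<exists>n. \<forall>f\<in>Delta_pow m F. mv_eval (Delta m) f t \<le> mv_eval (Delta m) f (term_mult n s)"
proof -
  let ?V = "F \<rightarrow>\<^sub>E {0..int m}"
  have "\<forall>v\<in>?V. \<exists>n. \<forall>f\<in>radical_class m F v.
      mv_eval (Delta m) f t \<le> mv_eval (Delta m) f (term_mult n s)"
    using zero_set_subset_class[OF m F vars sub] by blast
  from bchoice[OF this] obtain n where n: "\<forall>v\<in>?V. \<forall>f\<in>radical_class m F v.
      mv_eval (Delta m) f t \<le> mv_eval (Delta m) f (term_mult (n v) s)" ..
  have fin: "finite ?V" using F by (intro finite_PiE) auto
  have "mv_eval (Delta m) f t \<le> mv_eval (Delta m) f (term_mult (sum n ?V) s)"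
    if f: "f \<in> Delta_pow m F" for f
  proof -
    obtain v where v: "v \<in> ?V" "f \<in> radical_class m F v" using Delta_pow_class[OF f] by blast
    then have "mv_eval (Delta m) f t \<le> mv_eval (Delta m) f (term_mult (n v) s)" using n v by blast
    also have "\<dots> \<le> mv_eval (Delta m) f (term_mult (sum n ?V) s)"
      using member_le_sum[OF v(1) _ fin, of n] by (intro term_mult_mono[OF f vars(1)]) simp
    finally show ?thesis .
  qed
  then show ?thesis by blast
qed

lemma zero_set_restrict:
  assumes "F \<subseteq> I" "mv_vars t \<subseteq> F"
  shows "zero_set m I t = {f \<in> Delta_pow m I. restrict f F \<in> zero_set m F t}"
proof -
  have "mv_eval (Delta m) (restrict f F) t = mv_eval (Delta m) f t" for f
    using assms by (intro mv_eval_cong) auto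
  moreover have "restrict f F \<in> Delta_pow m F" if "f \<in> Delta_pow m I" for f
    using assms that by (auto simp: Delta_pow_def)
  ultimately show ?thesis by (auto simp: zero_set_def)
qed

lemma Delta_pow_extend:
  assumes "F \<subseteq> I" "g \<in> Delta_pow m F"
  obtains f where "f \<in> Delta_pow m I" "restrict f F = g"
proof
  have "Lex 0 0 \<in> mv_carrier (Delta m)" by (simp add: Delta_carrier)
  then show "(\<lambda>i\<in>I. if i \<in> F then g i else Lex 0 0) \<in> Delta_pow m I"
    using assms by (auto simp: Delta_pow_def)
  show "restrict (\<lambda>i\<in>I. if i \<in> F then g i else Lex 0 0) F = g"
    using assms by (auto simp: Delta_pow_def fun_eq_iff PiE_def extensional_def)
qed

text \<open>
Satisfaction of identities refers to assignments to all variables, points of \<open>\<Delta>\<^sub>m(\<real>)\<^sup>I\<close> only to those in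
\<open>I\<close>.
\<close>

lemma Delta_pow_total:
  assumes "f \<in> Delta_pow m I"
  obtains g where "\<And>i. g i \<in> mv_carrier (Delta m)"
    "\<And>r. mv_vars r \<subseteq> I \<Longrightarrow> mv_eval (Delta m) g r = mv_eval (Delta m) f r"
proof
  let ?g = "\<lambda>i. if i \<in> I then f i else Lex 0 0"
  show "?g i \<in> mv_carrier (Delta m)" for i
    using assms by (auto simp: Delta_pow_def Delta_carrier)
  show "mv_eval (Delta m) ?g r = mv_eval (Delta m) f r" if "mv_vars r \<subseteq> I" for r
    using that by (intro mv_eval_cong) auto
qed

text \<open>
The identity on the right says \<open>t \<le> n s\<close> in the free algebra. It is enough to consider the finitely many
variables of \<open>s\<close> and \<open>t\<close>, which leaves finitely many radical classes; the sum of the values of \<open>n\<close> found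
for the classes works for all of them.
\<close>

theorem zero_set_subset_iff:
  fixes s t :: "'k mv_term"
  assumes m: "m \<ge> 1" and vars: "mv_vars s \<subseteq> I" "mv_vars t \<subseteq> I"
  shows "zero_set m I s \<subseteq> zero_set m I t \<longleftrightarrow>
         (\<exists>n. mv_satisfies (Komori m) (MPlus (MNeg t) (term_mult n s)) (MNeg MZero))"
proof
  assume sub: "zero_set m I s \<subseteq> zero_set m I t"
  define F where "F = mv_vars s \<union> mv_vars t"
  have F: "finite F" "F \<subseteq> I" "mv_vars s \<subseteq> F" "mv_vars t \<subseteq> F"
    using vars by (auto simp: F_def finite_mv_vars)
  have "zero_set m F s \<subseteq> zero_set m F t"
  proof
    fix g assume g: "g \<in> zero_set m F s"
    then have "g \<in> Delta_pow m F" by (simp add: zero_set_def)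
    then obtain f where f: "f \<in> Delta_pow m I" "restrict f F = g" using Delta_pow_extend[OF F(2)] by blast
    then have "f \<in> zero_set m I s" using g zero_set_restrict[OF F(2,3)] by blast
    then show "g \<in> zero_set m F t" using sub f zero_set_restrict[OF F(2,4)] by blast
  qed
  then obtain n where n: "\<And>f. f \<in> Delta_pow m F \<Longrightarrow>
      mv_eval (Delta m) f t \<le> mv_eval (Delta m) f (term_mult n s)"
    using zero_set_subset_finite[OF m F(1,3,4)] by blast
  have "mv_satisfies (Delta m) (MPlus (MNeg t) (term_mult n s)) (MNeg MZero)"
    unfolding mv_satisfies_def
  proof (intro allI impI)
    fix f :: "'k \<Rightarrow> (int, real) lex"
    assume f: "\<forall>i. f i \<in> mv_carrier (Delta m)"
    have cong: "mv_eval (Delta m) (restrict f F) r = mv_eval (Delta m) f r" if "mv_vars r \<subseteq> F" for r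
      using that by (intro mv_eval_cong) auto
    have "restrict f F \<in> Delta_pow m F" using f by (simp add: Delta_pow_def)
    then have "mv_eval (Delta m) f t \<le> mv_eval (Delta m) f (term_mult n s)"
      using n[of "restrict f F"] cong F(3,4) mv_vars_term_mult[of n s] by auto
    then show "mv_eval (Delta m) f (MPlus (MNeg t) (term_mult n s)) = mv_eval (Delta m) f (MNeg MZero)"
      unfolding mv_le_Delta[symmetric, of _ _ m] mv_le_def by simp
  qed
  then show "\<exists>n. mv_satisfies (Komori m) (MPlus (MNeg t) (term_mult n s)) (MNeg MZero)"
    using Delta_identities_Komori by blast
next
  assume "\<exists>n. mv_satisfies (Komori m) (MPlus (MNeg t) (term_mult n s)) (MNeg MZero)"
  then obtain n where "mv_satisfies (Delta m) (MPlus (MNeg t) (term_mult n s)) (MNeg MZero)"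
    using Komori_identities_Delta[OF m] by blast
  note n = this[unfolded mv_satisfies_def, rule_format]
  show "zero_set m I s \<subseteq> zero_set m I t"
  proof
    fix f assume f: "f \<in> zero_set m I s"
    then have fI: "f \<in> Delta_pow m I" and fs: "mv_eval (Delta m) f s = Lex 0 0"
      by (auto simp: zero_set_def Delta_simps)
    obtain g where g: "\<And>i. g i \<in> mv_carrier (Delta m)"
        and cong: "\<And>r. mv_vars r \<subseteq> I \<Longrightarrow> mv_eval (Delta m) g r = mv_eval (Delta m) f r"
      using Delta_pow_total[OF fI] by blast
    have gm: "mv_eval (Delta m) g (term_mult k s) = Lex 0 0" for k
      using cong[OF vars(1)] fs by (induction k) (auto simp: Delta_simps)
    have "mv_le (Delta m) (mv_eval (Delta m) g t) (mv_eval (Delta m) g (term_mult n s))"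
      unfolding mv_le_def using n[OF g] by simp
    then have "mv_eval (Delta m) f t \<le> Lex 0 0"
      using cong[OF vars(2)] gm by (simp add: mv_le_Delta)
    moreover have "Lex 0 0 \<le> mv_eval (Delta m) f t"
      using mv_eval_Delta_pow[OF fI vars(2)] by (simp add: Delta_carrier_iff zero_lex_def)
    ultimately show "f \<in> zero_set m I t" using fI by (simp add: zero_set_def Delta_simps)
  qed
qed

section \<open>Terms with prescribed zero sets\<close>

definition clamp :: "'g::lattice_ab_group_add \<Rightarrow> 'g \<Rightarrow> 'g" where
  "clamp u g = inf (sup 0 g) u"

lemma clamp_simps:
  fixes u h :: "'g::lattice_ab_group_add"
  assumes "0 \<le> u"
  shows "h \<le> 0 \<Longrightarrow> clamp u h = 0" "0 \<le> h \<Longrightarrow> h \<le> u \<Longrightarrow> clamp u h = h" "u \<le> h \<Longrightarrow> clamp u h = u"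
proof -
  show "clamp u h = 0" if "h \<le> 0" using that assms by (simp add: clamp_def sup_absorb1 inf_absorb1)
  show "clamp u h = h" if "0 \<le> h" "h \<le> u" using that by (simp add: clamp_def sup_absorb2 inf_absorb1)
  show "clamp u h = u" if "u \<le> h"
  proof -
    have "0 \<le> h" using assms that by (rule order_trans)
    then show ?thesis using that by (simp add: clamp_def sup_absorb2 inf_absorb2)
  qed
qed

text \<open>
The truncations of \<open>h\<close> and of \<open>h + u\<close> determine that of \<open>h + x\<close>, and the right-hand side is an
MV-expression in them: the product \<open>(clamp u h \<oplus> x) \<odot> clamp u (h + u)\<close>. This is what makes truncated
affine forms term functions.
\<close>

lemma clamp_add:
  fixes u h x :: "'g::{lattice_ab_group_add, linorder}"
  assumes u: "0 \<le> u" and x: "0 \<le> x" "x \<le> u"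
  shows "clamp u (h + x) = sup 0 (inf (clamp u h + x) u + clamp u (h + u) - u)"
proof -
  consider "h + u \<le> 0" | "0 \<le> h + u" "h \<le> 0" | "0 \<le> h" "h \<le> u" | "u \<le> h" by (metis linear)
  then show ?thesis
  proof cases
    case 1
    have "h \<le> 0" "h + x \<le> 0"
      using 1 u x by (metis add_increasing2 dual_order.trans order_refl, metis add_left_mono order_trans)
    then show ?thesis using 1 u x by (simp add: clamp_simps inf_absorb1 sup_absorb1)
  next
    case 2
    have "h + u \<le> u" "h + x \<le> u" using 2 x add_mono[of h 0 x u] by auto
    then have "sup 0 (h + x) \<le> u" using u by simp
    then have "clamp u (h + x) = sup 0 (h + x)" by (simp add: clamp_def inf_absorb1)
    then show ?thesis using 2 u x \<open>h + u \<le> u\<close> by (simp add: clamp_simps inf_absorb1 algebra_simps)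
  next
    case 3
    have "u \<le> h + u" "0 \<le> h + x" using 3 x by auto
    then show ?thesis using 3 u by (simp add: clamp_simps) (simp add: clamp_def sup_absorb2)
  next
    case 4
    have "u \<le> h + u" "u \<le> h + x" using 4 u x order_trans[OF u 4] by (auto intro: add_increasing2)
    then show ?thesis using 4 u x by (simp add: clamp_simps inf_absorb2 sup_absorb2)
  qed
qed

lemma clamp_neg:
  fixes u h :: "'g::{lattice_ab_group_add, linorder}"
  assumes u: "0 \<le> u"
  shows "clamp u (u - h) = u - clamp u h"
proof -
  consider "h \<le> 0" | "0 \<le> h" "h \<le> u" | "u \<le> h" by (metis linear)
  then show ?thesis using u by cases (simp_all add: clamp_simps)
qed

lemma clamp_eq_zero:
  fixes u h :: "'g::{lattice_ab_group_add, linorder}"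
  assumes u: "0 \<le> u" "u \<noteq> 0"
  shows "clamp u h = 0 \<longleftrightarrow> h \<le> 0"
proof -
  consider "h \<le> 0" | "0 \<le> h" "h \<le> u" | "u \<le> h" by (metis linear)
  then show ?thesis
  proof cases
    case 3
    then have "\<not> h \<le> 0" using u by (metis order_antisym order_trans)
    then show ?thesis using 3 u by (simp add: clamp_simps)
  qed (use u in \<open>auto simp: clamp_simps\<close>)
qed

abbreviation unit_Delta :: "nat \<Rightarrow> (int, real) lex" where
  "unit_Delta m \<equiv> Lex (int m) 0"

lemma unit_Delta_nonneg: "0 \<le> unit_Delta m"
  by (cases "m = 0") (simp_all add: zero_lex_def less_eq_lex_def)

lemma Delta_ops:
  "mv_zero (Delta m) = 0" "mv_neg (Delta m) x = unit_Delta m - x"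
  "mv_plus (Delta m) x y = inf (x + y) (unit_Delta m)"
  by (simp_all add: Delta_def mv_Gamma_def)

definition term_join :: "'v mv_term \<Rightarrow> 'v mv_term \<Rightarrow> 'v mv_term" where
  "term_join s t = MPlus (MNeg (MPlus (MNeg s) t)) t"

definition term_meet :: "'v mv_term \<Rightarrow> 'v mv_term \<Rightarrow> 'v mv_term" where
  "term_meet s t = MNeg (term_join (MNeg s) (MNeg t))"

text \<open>
The product \<open>\<odot>\<close> dual to the sum of an MV-algebra.
\<close>

definition term_times :: "'v mv_term \<Rightarrow> 'v mv_term \<Rightarrow> 'v mv_term" where
  "term_times s t = MNeg (MPlus (MNeg s) (MNeg t))"

lemma mv_vars_term_ops:
  "mv_vars (term_meet s t) = mv_vars s \<union> mv_vars t"
  "mv_vars (term_times s t) = mv_vars s \<union> mv_vars t"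
  by (auto simp: term_meet_def term_join_def term_times_def)

lemma mv_eval_term_meet:
  "mv_eval A \<rho> (term_meet s t) = mv_meet A (mv_eval A \<rho> s) (mv_eval A \<rho> t)"
  by (simp add: term_meet_def term_join_def mv_meet_def mv_join_def)

lemma mv_eval_term_times:
  "mv_eval (Delta m) \<rho> (term_times s t) =
     sup 0 (mv_eval (Delta m) \<rho> s + mv_eval (Delta m) \<rho> t - unit_Delta m)"
proof -
  have "u - inf ((u - x) + (u - y)) u = sup 0 (x + y - u)" for u x y :: "(int, real) lex"
  proof -
    have "u - inf ((u - x) + (u - y)) u = u + sup (- ((u - x) + (u - y))) (- u)"
      by (simp add: neg_inf_eq_sup flip: add_uminus_conv_diff)
    also have "\<dots> = sup (u + - ((u - x) + (u - y))) (u + - u)" by (rule add_sup_distrib_left)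
    also have "u + - ((u - x) + (u - y)) = x + y - u" by (simp add: algebra_simps)
    finally show ?thesis by (simp add: sup_commute)
  qed
  then show ?thesis by (simp add: term_times_def Delta_ops)
qed

lemma mv_join_Delta:
  assumes "x \<in> mv_carrier (Delta m)" "y \<in> mv_carrier (Delta m)"
  shows "mv_join (Delta m) x y = sup x y"
proof (cases "x \<le> y")
  case True
  then have "mv_plus (Delta m) (mv_neg (Delta m) x) y = mv_neg (Delta m) (mv_zero (Delta m))"
    using mv_le_Delta[of m x y] by (simp add: mv_le_def)
  then show ?thesis using True assms unfolding mv_join_def
    by (simp add: Delta_ops Delta_carrier_iff inf_absorb1 sup_absorb2)
next
  case False
  then have yx: "y \<le> x" by simp
  have "unit_Delta m - x + y \<le> unit_Delta m" using yx by (simp add: algebra_simps)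
  then show ?thesis using yx assms unfolding mv_join_def
    by (simp add: Delta_ops Delta_carrier_iff inf_absorb1 sup_absorb1)
qed

lemma mv_meet_Delta:
  assumes "x \<in> mv_carrier (Delta m)" "y \<in> mv_carrier (Delta m)"
  shows "mv_meet (Delta m) x y = inf x y"
proof -
  have "mv_neg (Delta m) z \<in> mv_carrier (Delta m)" if "z \<in> mv_carrier (Delta m)" for z
    using that mv_algebra_Delta by (auto simp: mv_algebra_def)
  then have "mv_meet (Delta m) x y = unit_Delta m - sup (unit_Delta m - x) (unit_Delta m - y)"
    using assms unfolding mv_meet_def by (simp add: mv_join_Delta Delta_ops)
  then show ?thesis
    by (cases "x \<le> y") (simp_all add: sup_absorb1 sup_absorb2 inf_absorb1 inf_absorb2)
qed

lemma zero_set_plus: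
  assumes "mv_vars s \<subseteq> I" "mv_vars t \<subseteq> I"
  shows "zero_set m I (MPlus s t) = zero_set m I s \<inter> zero_set m I t"
proof -
  have "mv_plus (Delta m) x y = 0 \<longleftrightarrow> x = 0 \<and> y = 0"
    if xy: "x \<in> mv_carrier (Delta m)" "y \<in> mv_carrier (Delta m)" for x y
  proof
    assume "mv_plus (Delta m) x y = 0"
    moreover from this have "mv_plus (Delta m) y x = 0" by (simp add: Delta_ops add.commute)
    ultimately have "y \<le> 0" "x \<le> 0"
      using Delta_plus_upper[OF xy] Delta_plus_upper[OF xy(2,1)] by simp_all
    moreover have "0 \<le> x" "0 \<le> y" using xy by (simp_all add: Delta_carrier_iff)
    ultimately show "x = 0 \<and> y = 0" by auto
  next
    assume "x = 0 \<and> y = 0"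
    then show "mv_plus (Delta m) x y = 0" by (simp add: Delta_ops inf_absorb1 unit_Delta_nonneg)
  qed
  then show ?thesis
    using mv_eval_Delta_pow[of _ m I s] mv_eval_Delta_pow[of _ m I t] assms
    by (auto simp: zero_set_def Delta_ops(1))
qed

lemma zero_set_meet:
  assumes "mv_vars s \<subseteq> I" "mv_vars t \<subseteq> I"
  shows "zero_set m I (term_meet s t) = zero_set m I s \<union> zero_set m I t"
proof -
  have "mv_meet (Delta m) x y = 0 \<longleftrightarrow> x = 0 \<or> y = 0"
    if xy: "x \<in> mv_carrier (Delta m)" "y \<in> mv_carrier (Delta m)" for x y
  proof -
    have "0 \<le> x" "0 \<le> y" using xy by (simp_all add: Delta_carrier_iff)
    then show ?thesis unfolding mv_meet_Delta[OF xy]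
      by (cases "x \<le> y") (auto simp: inf_absorb1 inf_absorb2)
  qed
  then show ?thesis
    using mv_eval_Delta_pow[of _ m I s] mv_eval_Delta_pow[of _ m I t] assms
    by (auto simp: zero_set_def Delta_ops(1) mv_eval_term_meet)
qed

lemma zero_set_zero: "zero_set m I MZero = Delta_pow m I"
  by (simp add: zero_set_def)

lemma zero_set_unit: "m \<ge> 1 \<Longrightarrow> zero_set m I (MNeg MZero) = {}"
  by (simp add: zero_set_def Delta_simps)

definition definable :: "nat \<Rightarrow> 'k set \<Rightarrow> ('k \<Rightarrow> (int, real) lex) set \<Rightarrow> bool" where
  "definable m F Z \<longleftrightarrow> (\<exists>t. mv_vars t \<subseteq> F \<and> Z = zero_set m F t)"

lemma definable_Un: "definable m F Y \<Longrightarrow> definable m F Z \<Longrightarrow> definable m F (Y \<union> Z)"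
proof -
  assume "definable m F Y" "definable m F Z"
  then obtain s t where "mv_vars s \<subseteq> F" "Y = zero_set m F s" "mv_vars t \<subseteq> F" "Z = zero_set m F t"
    by (auto simp: definable_def)
  then show ?thesis unfolding definable_def
    by (intro exI[of _ "term_meet s t"]) (simp add: zero_set_meet mv_vars_term_ops)
qed

lemma definable_Int:
  assumes "definable m F Y" "definable m F Z" shows "definable m F (Y \<inter> Z)"
proof -
  obtain s t where "mv_vars s \<subseteq> F" "Y = zero_set m F s" "mv_vars t \<subseteq> F" "Z = zero_set m F t"
    using assms by (auto simp: definable_def)
  then show ?thesis unfolding definable_def
    by (intro exI[of _ "MPlus s t"]) (simp add: zero_set_plus)
qed

lemma definable_UN:
  assumes "m \<ge> 1" "finite A" "\<And>a. a \<in> A \<Longrightarrow> definable m F (Z a)"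
  shows "definable m F (\<Union>a\<in>A. Z a)"
  using assms(2,3)
proof (induction A)
  case empty
  then show ?case unfolding definable_def
    by (intro exI[of _ "MNeg MZero"]) (simp add: zero_set_unit[OF assms(1)])
next
  case (insert a A)
  then have "definable m F (Z a \<union> (\<Union>a\<in>A. Z a))" by (intro definable_Un) auto
  then show ?case by simp
qed

lemma definable_INT:
  assumes "finite A" "\<And>a. a \<in> A \<Longrightarrow> definable m F {f \<in> Delta_pow m F. Q a f}"
  shows "definable m F {f \<in> Delta_pow m F. \<forall>a\<in>A. Q a f}"
  using assms
proof (induction A)
  case empty
  then show ?case unfolding definable_def by (intro exI[of _ MZero]) (simp add: zero_set_zero)
next
  case (insert a A)
  have "{f \<in> Delta_pow m F. \<forall>a\<in>insert a A. Q a f} =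
      {f \<in> Delta_pow m F. Q a f} \<inter> {f \<in> Delta_pow m F. \<forall>a\<in>A. Q a f}" by auto
  then show ?case using insert by (simp add: definable_Int)
qed

text \<open>
All shifts of the form by integral multiples of the unit are required at once, because \<open>clamp_add\<close>
consumes two consecutive shifts.
\<close>

definition clampable :: "nat \<Rightarrow> 'k set \<Rightarrow> (('k \<Rightarrow> (int, real) lex) \<Rightarrow> (int, real) lex) \<Rightarrow> bool" where
  "clampable m F \<phi> \<longleftrightarrow> (\<forall>a. \<exists>r. mv_vars r \<subseteq> F \<and>
     (\<forall>f\<in>Delta_pow m F. mv_eval (Delta m) f r = clamp (unit_Delta m) (Lex (a * int m) 0 + \<phi> f)))"

lemma clampable_zero: "clampable m F (\<lambda>f. 0)"
  unfolding clampable_def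
proof
  fix a :: int
  show "\<exists>r. mv_vars r \<subseteq> F \<and>
     (\<forall>f\<in>Delta_pow m F. mv_eval (Delta m) f r = clamp (unit_Delta m) (Lex (a * int m) 0 + 0))"
  proof (cases "a \<le> 0")
    case True
    then have "a * int m \<le> 0" by (simp add: mult_le_0_iff)
    then have "Lex (a * int m) 0 \<le> (0 :: (int, real) lex)"
      unfolding zero_lex_def less_eq_lex_def lex.sel by linarith
    then show ?thesis
      by (intro exI[of _ MZero]) (simp add: clamp_simps unit_Delta_nonneg Delta_ops)
  next
    case False
    then have "1 * int m \<le> a * int m" by (intro mult_right_mono) auto
    then have "unit_Delta m \<le> Lex (a * int m) 0" unfolding less_eq_lex_def lex.sel by linarith
    then show ?thesis
      by (intro exI[of _ "MNeg MZero"]) (simp add: clamp_simps unit_Delta_nonneg Delta_ops)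
  qed
qed

lemma clampable_uminus:
  assumes "clampable m F \<phi>" shows "clampable m F (\<lambda>f. - \<phi> f)"
  unfolding clampable_def
proof
  fix a :: int
  obtain r where r: "mv_vars r \<subseteq> F" "\<And>f. f \<in> Delta_pow m F \<Longrightarrow>
      mv_eval (Delta m) f r = clamp (unit_Delta m) (Lex ((1 - a) * int m) 0 + \<phi> f)"
    using assms unfolding clampable_def by meson
  have eq: "Lex (a * int m) 0 + - x = unit_Delta m - (Lex ((1 - a) * int m) 0 + x)"
    for x :: "(int, real) lex"
    by (simp add: plus_lex_def minus_lex_def uminus_lex_def algebra_simps)
  have "mv_eval (Delta m) f (MNeg r) = clamp (unit_Delta m) (Lex (a * int m) 0 + - \<phi> f)"
    if "f \<in> Delta_pow m F" for f
    unfolding eq clamp_neg[OF unit_Delta_nonneg] using r(2)[OF that] by (simp add: Delta_ops(2))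
  then show "\<exists>r. mv_vars r \<subseteq> F \<and> (\<forall>f\<in>Delta_pow m F.
      mv_eval (Delta m) f r = clamp (unit_Delta m) (Lex (a * int m) 0 + - \<phi> f))"
    using r(1) by (intro exI[of _ "MNeg r"]) simp
qed

lemma clampable_add_var:
  assumes "clampable m F \<phi>" "i \<in> F" shows "clampable m F (\<lambda>f. \<phi> f + f i)"
  unfolding clampable_def
proof
  fix a :: int
  obtain r where r: "mv_vars r \<subseteq> F" "\<And>f. f \<in> Delta_pow m F \<Longrightarrow>
      mv_eval (Delta m) f r = clamp (unit_Delta m) (Lex (a * int m) 0 + \<phi> f)"
    using assms(1) unfolding clampable_def by meson
  obtain r' where r': "mv_vars r' \<subseteq> F" "\<And>f. f \<in> Delta_pow m F \<Longrightarrow>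
      mv_eval (Delta m) f r' = clamp (unit_Delta m) (Lex ((a + 1) * int m) 0 + \<phi> f)"
    using assms(1) unfolding clampable_def by meson
  define q where "q = term_times (MPlus r (MVar i)) r'"
  have "mv_eval (Delta m) f q = clamp (unit_Delta m) (Lex (a * int m) 0 + (\<phi> f + f i))"
    if f: "f \<in> Delta_pow m F" for f
  proof -
    have "f i \<in> mv_carrier (Delta m)" using f assms(2) by (auto simp: Delta_pow_def)
    then have fi: "0 \<le> f i" "f i \<le> unit_Delta m" by (simp_all add: Delta_carrier_iff)
    have eq: "Lex ((a + 1) * int m) 0 + \<phi> f = Lex (a * int m) 0 + \<phi> f + unit_Delta m"
      by (simp add: plus_lex_def algebra_simps)
    show ?thesis
      unfolding q_def mv_eval_term_times mv_eval.simps r(2)[OF f] r'(2)[OF f] Delta_ops(3) eq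
        add.assoc[symmetric]
      by (rule clamp_add[OF unit_Delta_nonneg fi, symmetric])
  qed
  moreover have "mv_vars q \<subseteq> F" using r(1) r'(1) assms(2) by (simp add: q_def mv_vars_term_ops)
  ultimately show "\<exists>r. mv_vars r \<subseteq> F \<and> (\<forall>f\<in>Delta_pow m F.
      mv_eval (Delta m) f r = clamp (unit_Delta m) (Lex (a * int m) 0 + (\<phi> f + f i)))" by blast
qed

definition int_multiple :: "int \<Rightarrow> (int, real) lex \<Rightarrow> (int, real) lex" where
  "int_multiple k x = Lex (k * lex_fst x) (of_int k * lex_snd x)"

lemma clampable_add_nat_multiple:
  assumes "clampable m F \<phi>" "i \<in> F" shows "clampable m F (\<lambda>f. \<phi> f + int_multiple (int n) (f i))"
proof (induction n)
  case 0
  have "int_multiple (int 0) x = 0" for x by (simp add: int_multiple_def zero_lex_def)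
  then show ?case using assms by simp
next
  case (Suc n)
  have eq: "\<phi> f + int_multiple (int (Suc n)) x = \<phi> f + int_multiple (int n) x + x" for f x
    by (simp add: int_multiple_def plus_lex_def algebra_simps)
  show ?case unfolding eq by (rule clampable_add_var[OF Suc assms(2)])
qed

lemma clampable_add_int_multiple:
  assumes "clampable m F \<phi>" "i \<in> F" shows "clampable m F (\<lambda>f. \<phi> f + int_multiple k (f i))"
proof (cases "0 \<le> k")
  case True
  then show ?thesis using clampable_add_nat_multiple[OF assms, of "nat k"] by simp
next
  case False
  have eq: "\<phi> f + int_multiple k x = - (- \<phi> f + int_multiple (int (nat (- k))) x)" for f x
    using False by (simp add: int_multiple_def plus_lex_def uminus_lex_def)
  show ?thesis unfolding eq
    by (rule clampable_uminus[OF clampable_add_nat_multiple[OF clampable_uminus[OF assms(1)] assms(2)]])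
qed

definition affine_value ::
    "nat \<Rightarrow> 'k set \<Rightarrow> int \<Rightarrow> ('k \<Rightarrow> int) \<Rightarrow> ('k \<Rightarrow> (int, real) lex) \<Rightarrow> (int, real) lex" where
  "affine_value m F a k f =
     Lex (a * int m + (\<Sum>i\<in>F. k i * lex_fst (f i))) (\<Sum>i\<in>F. of_int (k i) * lex_snd (f i))"

lemma clampable_linear:
  assumes "finite S" "S \<subseteq> F" shows "clampable m F (affine_value m S 0 k)"
  using assms
proof (induction S)
  case empty
  have "affine_value m {} 0 k = (\<lambda>f. 0)" by (simp add: affine_value_def fun_eq_iff zero_lex_def)
  then show ?case by (simp add: clampable_zero)
next
  case (insert i S)
  have eq: "affine_value m (insert i S) 0 k = (\<lambda>f. affine_value m S 0 k f + int_multiple (k i) (f i))"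
    using insert.hyps by (simp add: affine_value_def fun_eq_iff int_multiple_def plus_lex_def algebra_simps)
  show ?case unfolding eq using insert by (intro clampable_add_int_multiple) auto
qed

lemma definable_affine:
  assumes m: "m \<ge> 1" and F: "finite F"
  shows "definable m F {f \<in> Delta_pow m F. affine_value m F a k f \<le> 0}"
proof -
  obtain r where r: "mv_vars r \<subseteq> F" "\<And>f. f \<in> Delta_pow m F \<Longrightarrow>
      mv_eval (Delta m) f r = clamp (unit_Delta m) (Lex (a * int m) 0 + affine_value m F 0 k f)"
    using clampable_linear[OF F subset_refl, of m k] unfolding clampable_def by meson
  have "Lex (a * int m) 0 + affine_value m F 0 k f = affine_value m F a k f" for f
    by (simp add: affine_value_def plus_lex_def)
  moreover have "unit_Delta m \<noteq> 0" using m by (simp add: zero_lex_def)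
  ultimately have "zero_set m F r = {f \<in> Delta_pow m F. affine_value m F a k f \<le> 0}"
    using r(2) by (auto simp: zero_set_def Delta_ops(1) clamp_eq_zero unit_Delta_nonneg)
  then show ?thesis using r(1) unfolding definable_def by blast
qed

text \<open>
The first coordinate of \<open>(2 j - 1) u - 2 m x\<^sub>i\<close> is \<open>m (2 j - 1 - 2 v)\<close> at a point whose \<open>i\<close>-th first
coordinate is \<open>v\<close>. The factor is odd, hence nonzero, so the sign of the form is determined by the
first coordinate alone.
\<close>

lemma definable_fst_ge:
  assumes m: "m \<ge> 1" and F: "finite F" and i: "i \<in> F"
  shows "definable m F {f \<in> Delta_pow m F. j \<le> lex_fst (f i)}"
    and "definable m F {f \<in> Delta_pow m F. lex_fst (f i) < j}"
proof -
  have sum: "(\<Sum>l\<in>F. (if l = i then c else 0) * g l) = c * g i" for c :: int and g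
    using F i by (subst sum.remove[of _ i]) (auto intro: sum.neutral)
  define d where "d f = 2 * j - 1 - 2 * lex_fst (f i)" for f :: "'a \<Rightarrow> (int, real) lex"
  have d: "d f \<noteq> 0" for f unfolding d_def by presburger
  define g where "g e = affine_value m F (e * (2 * j - 1)) (\<lambda>l. if l = i then - 2 * e * int m else 0)" for e
  have g: "g e f \<le> 0 \<longleftrightarrow> e * d f < 0" if "e \<noteq> 0" for e f
  proof -
    have "lex_fst (g e f) = e * d f * int m"
      unfolding g_def affine_value_def lex.sel sum by (simp add: d_def algebra_simps)
    moreover have "e * d f * int m \<noteq> 0" using d that m by simp
    moreover have "e * d f * int m < 0 \<longleftrightarrow> e * d f < 0" using m by (simp add: mult_less_0_iff)
    ultimately show ?thesis by (auto simp: less_eq_lex_def zero_lex_def)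
  qed
  have "j \<le> lex_fst (f i) \<longleftrightarrow> 1 * d f < 0" "lex_fst (f i) < j \<longleftrightarrow> - 1 * d f < 0" for f
    unfolding d_def by presburger+
  then have ge: "j \<le> lex_fst (f i) \<longleftrightarrow> g 1 f \<le> 0" and less: "lex_fst (f i) < j \<longleftrightarrow> g (- 1) f \<le> 0" for f
    using g[of 1] g[of "- 1"] by simp_all
  show "definable m F {f \<in> Delta_pow m F. j \<le> lex_fst (f i)}"
    unfolding ge g_def by (rule definable_affine[OF m F])
  show "definable m F {f \<in> Delta_pow m F. lex_fst (f i) < j}"
    unfolding less g_def by (rule definable_affine[OF m F])
qed

lemma definable_other_class:
  assumes m: "m \<ge> 1" and F: "finite F"
  shows "definable m F (Delta_pow m F - radical_class m F v)"
proof -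
  have "f \<in> Delta_pow m F - radical_class m F v \<longleftrightarrow>
      f \<in> (\<Union>i\<in>F. {f \<in> Delta_pow m F. v i + 1 \<le> lex_fst (f i)} \<union>
        {f \<in> Delta_pow m F. lex_fst (f i) < v i})" for f
  proof -
    have "lex_fst (f i) \<noteq> v i \<longleftrightarrow> v i + 1 \<le> lex_fst (f i) \<or> lex_fst (f i) < v i" for i by linarith
    then show ?thesis by (auto simp: radical_class_def)
  qed
  then have eq: "Delta_pow m F - radical_class m F v =
      (\<Union>i\<in>F. {f \<in> Delta_pow m F. v i + 1 \<le> lex_fst (f i)} \<union>
        {f \<in> Delta_pow m F. lex_fst (f i) < v i})" by (rule set_eqI)
  show ?thesis
    unfolding eq using definable_fst_ge[OF m F] by (intro definable_UN[OF m F] definable_Un)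
qed

lemma integral_form:
  assumes "finite F"
  obtains k :: "'k \<Rightarrow> int" where "\<And>x. 0 \<le> lin F a x \<longleftrightarrow> 0 \<le> (\<Sum>i\<in>F. of_int (k i) * x i)"
proof -
  have "rational_vector F (\<lambda>i. of_rat (a i))" by (simp add: rational_vector_def)
  then obtain N :: nat where N: "N > 0" "\<forall>i\<in>F. of_nat N * (of_rat (a i) :: real) \<in> \<int>"
    using common_denominator[OF assms] by blast
  define k where "k i = \<lfloor>of_nat N * (of_rat (a i) :: real)\<rfloor>" for i
  have "(\<Sum>i\<in>F. of_int (k i) * x i) = of_nat N * lin F a x" for x
    unfolding lin_def sum_distrib_left using N(2) by (intro sum.cong) (auto simp: k_def)
  then show ?thesis using that[of k] N(1) by (simp add: zero_le_mult_iff)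
qed

text \<open>
After clearing denominators the form has integral coefficients \<open>k\<close>. On the radical class \<open>v\<close> the affine
form \<open>c u - m (\<Sum>i. k\<^sub>i x\<^sub>i)\<close> with \<open>c = (\<Sum>i. k\<^sub>i v\<^sub>i)\<close> has first coordinate \<open>0\<close> and second coordinate
\<open>- m\<close> times the given one.
\<close>

lemma definable_halfspace:
  assumes m: "m \<ge> 1" and F: "finite F" and v: "v \<in> F \<rightarrow>\<^sub>E {0..int m}"
  shows "\<exists>W. definable m F W \<and> (\<forall>x\<in>quadrants m F v. beta F v x \<in> W \<longleftrightarrow> 0 \<le> lin F a x)"
proof -
  obtain k :: "'a \<Rightarrow> int" where k: "\<And>x. 0 \<le> lin F a x \<longleftrightarrow> 0 \<le> (\<Sum>i\<in>F. of_int (k i) * x i)"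
    by (rule integral_form[OF F, of a]) blast
  define c where "c = (\<Sum>i\<in>F. k i * v i)"
  define W where "W = {f \<in> Delta_pow m F. affine_value m F c (\<lambda>i. - int m * k i) f \<le> 0}"
  have "beta F v x \<in> W \<longleftrightarrow> 0 \<le> lin F a x" if x: "x \<in> quadrants m F v" for x
  proof -
    have "affine_value m F c (\<lambda>i. - int m * k i) (beta F v x) =
        Lex (c * int m + (\<Sum>i\<in>F. - int m * k i * v i)) (\<Sum>i\<in>F. of_int (- int m * k i) * x i)"
      unfolding affine_value_def by (simp add: beta_def)
    also have "(\<Sum>i\<in>F. - int m * k i * v i) = - int m * c"
      by (simp add: c_def sum_distrib_left algebra_simps)
    also have "(\<Sum>i\<in>F. of_int (- int m * k i) * x i) = - of_nat m * (\<Sum>i\<in>F. of_int (k i) * x i)"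
      unfolding sum_distrib_left by (intro sum.cong) auto
    finally have "affine_value m F c (\<lambda>i. - int m * k i) (beta F v x) =
        Lex 0 (- of_nat m * (\<Sum>i\<in>F. of_int (k i) * x i))" by simp
    moreover have "beta F v x \<in> Delta_pow m F"
      using beta_in_radical_class[OF m v x] by (simp add: radical_class_def)
    ultimately show ?thesis unfolding k W_def using m
      by (simp add: less_eq_lex_def zero_lex_def zero_le_mult_iff)
  qed
  moreover have "definable m F W" unfolding W_def by (rule definable_affine[OF m F])
  ultimately show ?thesis by blast
qed

text \<open>
In each radical class, cones are intersections of half-spaces and fans are unions of cones. Adjoining
the complement of the class puts no condition on the points of the other classes, so the intersection
over all classes is \<open>P\<close>.
\<close>

theorem m_fan_definable:
  assumes m: "m \<ge> 1" and F: "finite F" and P: "m_fan m F P"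
  shows "definable m F P"
proof -
  let ?V = "F \<rightarrow>\<^sub>E {0..int m}"
  have PD: "P \<subseteq> Delta_pow m F" using P by (simp add: m_fan_def)
  have cone: "\<exists>W. definable m F W \<and> (\<forall>x\<in>quadrants m F v. beta F v x \<in> W \<longleftrightarrow> x \<in> \<sigma>)"
    if v: "v \<in> ?V" and \<sigma>: "rational_cone F \<sigma>" for v \<sigma>
  proof -
    obtain A where A: "finite A" "\<sigma> = {x \<in> F \<rightarrow>\<^sub>E UNIV. \<forall>a\<in>A. 0 \<le> lin F a x}"
      using \<sigma> unfolding rational_cone_def lin_def by blast
    have "\<forall>a\<in>A. \<exists>W. definable m F W \<and> (\<forall>x\<in>quadrants m F v. beta F v x \<in> W \<longleftrightarrow> 0 \<le> lin F a x)"
      using definable_halfspace[OF m F v] by blast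
    from bchoice[OF this] obtain W where W: "\<forall>a\<in>A. definable m F (W a) \<and>
        (\<forall>x\<in>quadrants m F v. beta F v x \<in> W a \<longleftrightarrow> 0 \<le> lin F a x)" ..
    have WD: "{f \<in> Delta_pow m F. f \<in> W a} = W a" if "a \<in> A" for a
      using W that by (auto simp: definable_def zero_set_def)
    have "definable m F {f \<in> Delta_pow m F. \<forall>a\<in>A. f \<in> W a}"
      by (rule definable_INT[OF A(1)]) (use W WD in simp)
    moreover have "beta F v x \<in> {f \<in> Delta_pow m F. \<forall>a\<in>A. f \<in> W a} \<longleftrightarrow> x \<in> \<sigma>"
      if x: "x \<in> quadrants m F v" for x
      using beta_in_radical_class[OF m v x] W x
      by (auto simp: A(2) radical_class_def quadrants_def)
    ultimately show ?thesis by blast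
  qed
  have "\<exists>W. definable m F W \<and> W \<inter> radical_class m F v = P \<inter> radical_class m F v"
    if v: "v \<in> ?V" for v
  proof -
    obtain \<phi> where \<phi>: "rational_fan F \<phi>" "\<Union>\<phi> \<subseteq> quadrants m F v"
        "P \<inter> radical_class m F v = beta F v ` \<Union>\<phi>"
      using P v unfolding m_fan_def by blast
    have "\<forall>\<sigma>\<in>\<phi>. \<exists>W. definable m F W \<and> (\<forall>x\<in>quadrants m F v. beta F v x \<in> W \<longleftrightarrow> x \<in> \<sigma>)"
      using cone[OF v] \<phi>(1) by (auto simp: rational_fan_def)
    from bchoice[OF this] obtain W where W: "\<forall>\<sigma>\<in>\<phi>. definable m F (W \<sigma>) \<and>
        (\<forall>x\<in>quadrants m F v. beta F v x \<in> W \<sigma> \<longleftrightarrow> x \<in> \<sigma>)" ..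
    have "finite \<phi>" using \<phi>(1) by (simp add: rational_fan_def fan_def)
    then have "definable m F (\<Union>\<sigma>\<in>\<phi>. W \<sigma>)" using W by (intro definable_UN[OF m]) auto
    moreover have "(\<Union>\<sigma>\<in>\<phi>. W \<sigma>) \<inter> radical_class m F v = P \<inter> radical_class m F v"
    proof
      show "(\<Union>\<sigma>\<in>\<phi>. W \<sigma>) \<inter> radical_class m F v \<subseteq> P \<inter> radical_class m F v"
      proof
        fix f assume f: "f \<in> (\<Union>\<sigma>\<in>\<phi>. W \<sigma>) \<inter> radical_class m F v"
        then obtain x where x: "x \<in> quadrants m F v" "f = beta F v x"
          using radical_class_beta[OF m v] by blast
        obtain \<sigma> where "\<sigma> \<in> \<phi>" "f \<in> W \<sigma>" using f by blast
        then have "x \<in> \<sigma>" using W x by blast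
        then show "f \<in> P \<inter> radical_class m F v" unfolding \<phi>(3) using x(2) \<open>\<sigma> \<in> \<phi>\<close> by blast
      qed
      show "P \<inter> radical_class m F v \<subseteq> (\<Union>\<sigma>\<in>\<phi>. W \<sigma>) \<inter> radical_class m F v"
      proof
        fix f assume f: "f \<in> P \<inter> radical_class m F v"
        then obtain x \<sigma> where x: "\<sigma> \<in> \<phi>" "x \<in> \<sigma>" "f = beta F v x" unfolding \<phi>(3) by blast
        then have "x \<in> quadrants m F v" using \<phi>(2) by blast
        then have "f \<in> W \<sigma>" using W x by blast
        then show "f \<in> (\<Union>\<sigma>\<in>\<phi>. W \<sigma>) \<inter> radical_class m F v" using f x(1) by blast
      qed
    qed
    ultimately show ?thesis by blast
  qed
  then have "\<forall>v\<in>?V. \<exists>W. definable m F W \<and> W \<inter> radical_class m F v = P \<inter> radical_class m F v"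
    by blast
  from bchoice[OF this] obtain W where W: "\<forall>v\<in>?V. definable m F (W v) \<and>
      W v \<inter> radical_class m F v = P \<inter> radical_class m F v" ..
  define W' where "W' v = W v \<union> (Delta_pow m F - radical_class m F v)" for v
  have "definable m F {f \<in> Delta_pow m F. \<forall>v\<in>?V. f \<in> W' v}"
  proof (rule definable_INT)
    show "finite ?V" using F by (intro finite_PiE) auto
    fix v assume v: "v \<in> ?V"
    have "definable m F (W' v)"
      unfolding W'_def using W v definable_other_class[OF m F] by (intro definable_Un) auto
    moreover from this have "{f \<in> Delta_pow m F. f \<in> W' v} = W' v"
      by (auto simp: definable_def zero_set_def)
    ultimately show "definable m F {f \<in> Delta_pow m F. f \<in> W' v}" by simp
  qed
  moreover have "{f \<in> Delta_pow m F. \<forall>v\<in>?V. f \<in> W' v} = P"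
  proof
    show "P \<subseteq> {f \<in> Delta_pow m F. \<forall>v\<in>?V. f \<in> W' v}"
      unfolding W'_def using PD W by blast
    show "{f \<in> Delta_pow m F. \<forall>v\<in>?V. f \<in> W' v} \<subseteq> P"
    proof
      fix f assume f: "f \<in> {f \<in> Delta_pow m F. \<forall>v\<in>?V. f \<in> W' v}"
      then obtain v where v: "v \<in> ?V" "f \<in> radical_class m F v" using Delta_pow_class by blast
      then show "f \<in> P" using f W unfolding W'_def by blast
    qed
  qed
  ultimately show ?thesis by simp
qed

theorem cylinder_m_fans_eq:
  assumes m: "m \<ge> 1"
  shows "cylinder_m_fans m I = zero_set m I ` {t. mv_vars t \<subseteq> I}"
proof
  show "cylinder_m_fans m I \<subseteq> zero_set m I ` {t. mv_vars t \<subseteq> I}"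
  proof
    fix Z assume "Z \<in> cylinder_m_fans m I"
    then obtain Y P where Y: "finite Y" "Y \<subseteq> I" "m_fan m Y P"
        "Z = {f \<in> Delta_pow m I. restrict f Y \<in> P}"
      by (auto simp: cylinder_m_fans_def)
    then obtain t where t: "mv_vars t \<subseteq> Y" "P = zero_set m Y t"
      using m_fan_definable[OF m] unfolding definable_def by blast
    then have "Z = zero_set m I t" using zero_set_restrict[OF Y(2) t(1)] Y(4) by simp
    then show "Z \<in> zero_set m I ` {t. mv_vars t \<subseteq> I}" using t(1) Y(2) by blast
  qed
  show "zero_set m I ` {t. mv_vars t \<subseteq> I} \<subseteq> cylinder_m_fans m I"
  proof
    fix Z assume "Z \<in> zero_set m I ` {t. mv_vars t \<subseteq> I}"
    then obtain t where t: "mv_vars t \<subseteq> I" "Z = zero_set m I t" by blast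
    then have "Z = {f \<in> Delta_pow m I. restrict f (mv_vars t) \<in> zero_set m (mv_vars t) t}"
      using zero_set_restrict[OF t(1) subset_refl] by simp
    then show "Z \<in> cylinder_m_fans m I"
      using t(1) finite_mv_vars zero_set_m_fan[OF m finite_mv_vars subset_refl]
      unfolding cylinder_m_fans_def by blast
  qed
qed

section \<open>Prime ideals of the free algebra\<close>

lemma set_lattice_cylinder_m_fans:
  assumes m: "m \<ge> 1" shows "set_lattice (cylinder_m_fans m I)"
proof -
  let ?L = "zero_set m I ` {t. mv_vars t \<subseteq> I}"
  have "{} \<in> ?L" using zero_set_unit[OF m, of I] by (intro image_eqI[of _ _ "MNeg MZero"]) auto
  moreover have top: "Delta_pow m I \<in> ?L"
    by (intro image_eqI[of _ _ MZero]) (auto simp: zero_set_zero)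
  moreover have "\<Union>?L = Delta_pow m I" using top by (auto simp: zero_set_def)
  moreover have "a \<inter> b \<in> ?L \<and> a \<union> b \<in> ?L" if ab: "a \<in> ?L" "b \<in> ?L" for a b
  proof -
    obtain s t where st: "mv_vars s \<subseteq> I" "a = zero_set m I s" "mv_vars t \<subseteq> I" "b = zero_set m I t"
      using ab by auto
    have "a \<inter> b = zero_set m I (MPlus s t)" using zero_set_plus[OF st(1,3)] st by simp
    moreover have "a \<union> b = zero_set m I (term_meet s t)" using zero_set_meet[OF st(1,3)] st by simp
    ultimately show ?thesis using st(1,3) by (auto simp: mv_vars_term_ops)
  qed
  ultimately show ?thesis unfolding set_lattice_def cylinder_m_fans_eq[OF m] by simp
qed

context
  fixes m :: nat and I :: "'k set"
  assumes m: "m \<ge> 1"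
begin

abbreviation (input) "free_mv \<equiv> Free m I"
abbreviation (input) "fans \<equiv> cylinder_m_fans m I"
abbreviation (input) "zeros \<equiv> zero_set m I"

definition cls :: "'k mv_term \<Rightarrow> 'k mv_term set" where
  "cls t = mv_identities (Komori m) I `` {t}"

lemma carrier_Free: "mv_carrier free_mv = cls ` {t. mv_vars t \<subseteq> I}"
  by (auto simp: Free_def mv_free_def quotient_def cls_def)

lemma cls_eq_iff:
  assumes "mv_vars s \<subseteq> I" "mv_vars t \<subseteq> I"
  shows "cls s = cls t \<longleftrightarrow> mv_satisfies (Komori m) s t"
  unfolding cls_def using eq_equiv_class_iff[OF equiv_mv_identities, of s I t "Komori m"] assms
  by (auto simp: mv_identities_def)

lemma Free_zero: "mv_zero free_mv = cls MZero"
  by (simp add: Free_def mv_free_def cls_def)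

lemma Free_neg: "mv_vars s \<subseteq> I \<Longrightarrow> mv_neg free_mv (cls s) = cls (MNeg s)"
  unfolding Free_def cls_def by (rule mv_free_neg_class)

lemma Free_plus: "mv_vars s \<subseteq> I \<Longrightarrow> mv_vars t \<subseteq> I \<Longrightarrow> mv_plus free_mv (cls s) (cls t) = cls (MPlus s t)"
  unfolding Free_def cls_def by (rule mv_free_plus_class)

lemma Free_meet:
  "mv_vars s \<subseteq> I \<Longrightarrow> mv_vars t \<subseteq> I \<Longrightarrow> mv_meet free_mv (cls s) (cls t) = cls (term_meet s t)"
  by (simp add: mv_meet_def mv_join_def Free_neg Free_plus term_meet_def term_join_def)

lemma mv_algebra_Free: "mv_algebra free_mv"
  unfolding Free_def using mv_free_in_variety[OF mv_algebra_Komori[of m], where I = I]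
  by (simp add: mv_in_variety_def)

lemma Free_le_iff:
  assumes "mv_vars s \<subseteq> I" "mv_vars t \<subseteq> I"
  shows "mv_le free_mv (cls s) (cls t) \<longleftrightarrow> mv_satisfies (Komori m) (MPlus (MNeg s) t) (MNeg MZero)"
  using assms by (simp add: mv_le_def Free_neg Free_plus Free_zero cls_eq_iff)

lemma zero_set_subset_iff_Free:
  assumes "mv_vars s \<subseteq> I" "mv_vars t \<subseteq> I"
  shows "zeros s \<subseteq> zeros t \<longleftrightarrow> (\<exists>n. mv_le free_mv (cls t) (cls (term_mult n s)))"
proof -
  have "mv_vars (term_mult n s) \<subseteq> I" for n using mv_vars_term_mult[of n s] assms(1) by blast
  then show ?thesis using zero_set_subset_iff[OF m assms] Free_le_iff[OF assms(2)] by simp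
qed

lemma zero_set_cls:
  assumes "mv_vars s \<subseteq> I" "mv_vars t \<subseteq> I" "cls s = cls t"
  shows "zeros s = zeros t"
proof -
  have sat: "mv_satisfies (Delta m) s t"
    using assms cls_eq_iff Komori_identities_Delta[OF m] by blast
  have "mv_eval (Delta m) f s = mv_eval (Delta m) f t" if f: "f \<in> Delta_pow m I" for f
  proof -
    obtain g where g: "\<And>i. g i \<in> mv_carrier (Delta m)"
        and cong: "\<And>r. mv_vars r \<subseteq> I \<Longrightarrow> mv_eval (Delta m) g r = mv_eval (Delta m) f r"
      using Delta_pow_total[OF f] by blast
    have "mv_eval (Delta m) g s = mv_eval (Delta m) g t" using sat g by (simp add: mv_satisfies_def)
    then show ?thesis using assms cong by simp
  qed
  then show ?thesis by (auto simp: zero_set_def)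
qed

definition vanishing :: "'k mv_term set set \<Rightarrow> ('k \<Rightarrow> (int, real) lex) set set" where
  "vanishing P = {zeros t | t. mv_vars t \<subseteq> I \<and> cls t \<in> P}"

text \<open>
By \<open>zero_set_subset_iff_Free\<close> some multiple of the class of \<open>s\<close>, which belongs to \<open>P\<close>, is above the
class of \<open>t\<close>. So membership in an ideal depends on the zero set only.
\<close>

lemma ideal_upward:
  assumes P: "mv_ideal free_mv P" and s: "mv_vars s \<subseteq> I" "cls s \<in> P"
    and t: "mv_vars t \<subseteq> I" "zeros s \<subseteq> zeros t"
  shows "cls t \<in> P"
proof -
  have P': "P \<subseteq> mv_carrier free_mv" "P \<noteq> {}"
    "\<And>x y. x \<in> mv_carrier free_mv \<Longrightarrow> y \<in> P \<Longrightarrow> mv_le free_mv x y \<Longrightarrow> x \<in> P"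
    "\<And>x y. x \<in> P \<Longrightarrow> y \<in> P \<Longrightarrow> mv_plus free_mv x y \<in> P"
    using P by (auto simp: mv_ideal_def)
  have mult: "cls (term_mult n s) \<in> P" for n
  proof (induction n)
    case 0
    have "mv_zero free_mv \<in> mv_carrier free_mv" "cls s \<in> mv_carrier free_mv"
      using mv_algebra_Free s P'(1) by (auto simp: mv_algebra_def)
    moreover from this have "mv_le free_mv (mv_zero free_mv) (cls s)"
      using mv_algebra_Free unfolding mv_le_def mv_algebra_def by metis
    ultimately have "mv_zero free_mv \<in> P" using P'(3)[OF _ s(2)] by blast
    then show ?case by (simp add: Free_zero)
  next
    case (Suc n)
    have "mv_vars (term_mult n s) \<subseteq> I" using mv_vars_term_mult[of n s] s(1) by blast
    then show ?case using P'(4)[OF s(2) Suc] Free_plus[OF s(1)] by simp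
  qed
  obtain n where "mv_le free_mv (cls t) (cls (term_mult n s))"
    using zero_set_subset_iff_Free[OF s(1) t(1)] t(2) by blast
  moreover have "cls t \<in> mv_carrier free_mv" using t(1) by (simp add: carrier_Free)
  ultimately show ?thesis using P'(3)[OF _ mult] by blast
qed

lemma vanishing_iff:
  assumes "mv_ideal free_mv P" "mv_vars t \<subseteq> I" shows "zeros t \<in> vanishing P \<longleftrightarrow> cls t \<in> P"
  using ideal_upward[OF assms(1) _ _ assms(2)] assms(2) unfolding vanishing_def by blast

lemma fans_iff: "a \<in> fans \<longleftrightarrow> (\<exists>t. mv_vars t \<subseteq> I \<and> a = zeros t)"
  unfolding cylinder_m_fans_eq[OF m] by auto

lemma prime_filter_vanishing:
  assumes P: "mv_prime_ideal free_mv P" shows "prime_filter fans (vanishing P)"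
proof -
  have id: "mv_ideal free_mv P" and proper: "P \<noteq> mv_carrier free_mv"
    and prime: "\<And>x y. x \<in> mv_carrier free_mv \<Longrightarrow> y \<in> mv_carrier free_mv \<Longrightarrow> mv_meet free_mv x y \<in> P \<Longrightarrow>
      x \<in> P \<or> y \<in> P"
    using P by (auto simp: mv_prime_ideal_def)
  have PA: "P \<subseteq> mv_carrier free_mv" "P \<noteq> {}"
    and plus: "\<And>x y. x \<in> P \<Longrightarrow> y \<in> P \<Longrightarrow> mv_plus free_mv x y \<in> P"
    using id by (auto simp: mv_ideal_def)
  note v = vanishing_iff[OF id]
  show ?thesis
    unfolding prime_filter_def
  proof (intro conjI ballI impI)
    show "vanishing P \<subseteq> fans" unfolding vanishing_def using fans_iff by blast
    show "vanishing P \<noteq> {}" using PA by (auto simp: vanishing_def carrier_Free)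
    show "{} \<notin> vanishing P"
    proof
      assume "{} \<in> vanishing P"
      then obtain s where s: "mv_vars s \<subseteq> I" "cls s \<in> P" "zeros s = {}" by (auto simp: vanishing_def)
      then have "cls t \<in> P" if "mv_vars t \<subseteq> I" for t using ideal_upward[OF id s(1,2) that] by simp
      then show False using PA(1) proper by (auto simp: carrier_Free)
    qed
    show "b \<in> vanishing P" if ab: "a \<in> vanishing P" "b \<in> fans" "a \<subseteq> b" for a b
    proof -
      obtain s t where st: "mv_vars s \<subseteq> I" "cls s \<in> P" "a = zeros s" "mv_vars t \<subseteq> I" "b = zeros t"
        using ab by (auto simp: vanishing_def fans_iff)
      then show ?thesis using ideal_upward[OF id st(1,2,4)] v[OF st(4)] ab(3) by simp
    qed
    show "a \<inter> b \<in> vanishing P" if ab: "a \<in> vanishing P" "b \<in> vanishing P" for a b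
    proof -
      obtain s t where st: "mv_vars s \<subseteq> I" "cls s \<in> P" "a = zeros s"
          "mv_vars t \<subseteq> I" "cls t \<in> P" "b = zeros t"
        using ab by (auto simp: vanishing_def)
      then show ?thesis
        using plus[OF st(2,5)] Free_plus[OF st(1,4)] v[of "MPlus s t"] zero_set_plus[OF st(1,4)] by simp
    qed
    show "a \<in> vanishing P \<or> b \<in> vanishing P" if ab: "a \<in> fans" "b \<in> fans" "a \<union> b \<in> vanishing P" for a b
    proof -
      obtain s t where st: "mv_vars s \<subseteq> I" "a = zeros s" "mv_vars t \<subseteq> I" "b = zeros t"
        using ab(1,2) by (auto simp: fans_iff)
      then have "cls (term_meet s t) \<in> P"
        using ab(3) v[of "term_meet s t"] zero_set_meet[OF st(1,3)] by (simp add: mv_vars_term_ops)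
      then have "mv_meet free_mv (cls s) (cls t) \<in> P" using Free_meet st by simp
      then have "cls s \<in> P \<or> cls t \<in> P" using st(1,3) by (intro prime) (auto simp: carrier_Free)
      then show ?thesis using v st by simp
    qed
  qed
qed

lemma prime_ideal_of_filter:
  assumes F: "prime_filter fans F"
  shows "\<exists>P. mv_prime_ideal free_mv P \<and> vanishing P = F"
proof -
  have FL: "F \<subseteq> fans" "F \<noteq> {}" "{} \<notin> F"
    and up: "\<And>a b. a \<in> F \<Longrightarrow> b \<in> fans \<Longrightarrow> a \<subseteq> b \<Longrightarrow> b \<in> F"
    and inter: "\<And>a b. a \<in> F \<Longrightarrow> b \<in> F \<Longrightarrow> a \<inter> b \<in> F"
    and prime: "\<And>a b. a \<in> fans \<Longrightarrow> b \<in> fans \<Longrightarrow> a \<union> b \<in> F \<Longrightarrow> a \<in> F \<or> b \<in> F"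
    using F unfolding prime_filter_def by auto
  define P where "P = {cls t | t. mv_vars t \<subseteq> I \<and> zeros t \<in> F}"
  have P_iff: "cls t \<in> P \<longleftrightarrow> zeros t \<in> F" if t: "mv_vars t \<subseteq> I" for t
  proof
    assume "cls t \<in> P"
    then obtain s where "mv_vars s \<subseteq> I" "zeros s \<in> F" "cls t = cls s" by (auto simp: P_def)
    then show "zeros t \<in> F" using zero_set_cls[OF t] by metis
  qed (use t in \<open>auto simp: P_def\<close>)
  have zeros_mem: "zeros t \<in> fans" if "mv_vars t \<subseteq> I" for t using that by (auto simp: fans_iff)
  have PA: "P \<subseteq> mv_carrier free_mv" by (auto simp: P_def carrier_Free)
  have "mv_ideal free_mv P"
    unfolding mv_ideal_def
  proof (intro conjI ballI impI)
    show "P \<subseteq> mv_carrier free_mv" by fact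
    obtain a where "a \<in> F" using FL(2) by blast
    then obtain t where "mv_vars t \<subseteq> I" "a = zeros t" using FL(1) fans_iff by blast
    then show "P \<noteq> {}" using P_iff \<open>a \<in> F\<close> by blast
    show "x \<in> P" if xy: "x \<in> mv_carrier free_mv" "y \<in> P" "mv_le free_mv x y" for x y
    proof -
      obtain s t where st: "mv_vars s \<subseteq> I" "x = cls s" "mv_vars t \<subseteq> I" "y = cls t"
        using xy(1,2) PA by (auto simp: carrier_Free)
      have "cls (term_mult 1 t) = cls t"
      proof -
        have "mv_plus free_mv (cls t) (mv_zero free_mv) = cls t"
          using mv_algebra_Free st(3) unfolding mv_algebra_def by (auto simp: carrier_Free)
        then show ?thesis using st(3) by (simp add: Free_zero Free_plus)
      qed
      then have "zeros t \<subseteq> zeros s" using zero_set_subset_iff_Free[OF st(3,1)] xy(3) st by metis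
      then show ?thesis using up[of "zeros t" "zeros s"] xy(2) P_iff st zeros_mem by simp
    qed
    show "mv_plus free_mv x y \<in> P" if xy: "x \<in> P" "y \<in> P" for x y
    proof -
      obtain s t where st: "mv_vars s \<subseteq> I" "x = cls s" "zeros s \<in> F"
          "mv_vars t \<subseteq> I" "y = cls t" "zeros t \<in> F"
        using xy by (auto simp: P_def)
      then have "zeros (MPlus s t) \<in> F" using inter zero_set_plus[OF st(1,4)] by simp
      then show ?thesis using P_iff[of "MPlus s t"] st by (simp add: Free_plus)
    qed
  qed
  moreover have "P \<noteq> mv_carrier free_mv"
  proof
    assume "P = mv_carrier free_mv"
    then have "cls (MNeg MZero) \<in> P" by (auto simp: carrier_Free)
    then show False using P_iff[of "MNeg MZero"] zero_set_unit[OF m, of I] FL(3) by simp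
  qed
  moreover have "x \<in> P \<or> y \<in> P"
    if xy: "x \<in> mv_carrier free_mv" "y \<in> mv_carrier free_mv" "mv_meet free_mv x y \<in> P" for x y
  proof -
    obtain s t where st: "mv_vars s \<subseteq> I" "x = cls s" "mv_vars t \<subseteq> I" "y = cls t"
      using xy(1,2) by (auto simp: carrier_Free)
    then have "zeros s \<union> zeros t \<in> F"
      using xy(3) P_iff[of "term_meet s t"] zero_set_meet[OF st(1,3)]
      by (simp add: Free_meet mv_vars_term_ops)
    then show ?thesis using prime[OF zeros_mem[OF st(1)] zeros_mem[OF st(3)]] P_iff st by simp
  qed
  ultimately have "mv_prime_ideal free_mv P" by (simp add: mv_prime_ideal_def)
  moreover have "vanishing P = F"
  proof
    show "vanishing P \<subseteq> F" using P_iff by (auto simp: vanishing_def)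
    show "F \<subseteq> vanishing P"
    proof
      fix a assume a: "a \<in> F"
      then obtain t where "mv_vars t \<subseteq> I" "a = zeros t" using FL(1) fans_iff by blast
      then show "a \<in> vanishing P" using P_iff a by (auto simp: vanishing_def)
    qed
  qed
  ultimately show ?thesis by blast
qed

lemma inj_on_vanishing: "inj_on vanishing {P. mv_prime_ideal free_mv P}"
proof (rule inj_onI)
  fix P Q
  assume PQ: "P \<in> {P. mv_prime_ideal free_mv P}" "Q \<in> {P. mv_prime_ideal free_mv P}"
    "vanishing P = vanishing Q"
  then have id: "mv_ideal free_mv P" "mv_ideal free_mv Q" by (auto simp: mv_prime_ideal_def)
  have "cls t \<in> P \<longleftrightarrow> cls t \<in> Q" if "mv_vars t \<subseteq> I" for t
    using vanishing_iff[OF id(1) that] vanishing_iff[OF id(2) that] PQ(3) by simp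
  moreover have "P \<subseteq> mv_carrier free_mv" "Q \<subseteq> mv_carrier free_mv" using id by (auto simp: mv_ideal_def)
  ultimately show "P = Q" unfolding carrier_Free by blast
qed

text \<open>
The basic open set of a term corresponds to the prime filters omitting its zero set. Since prime filters
omit \<open>a \<union> b\<close> if and only if they omit \<open>a\<close> and \<open>b\<close>, these sets are closed under intersection, and the
topology generated by them consists of their unions.
\<close>

theorem stone_map_vanishing: "stone_map (mv_Spec free_mv) fans vanishing"
  unfolding stone_map_def topspace_mv_Spec
proof (intro conjI allI)
  let ?S = "{P. mv_prime_ideal free_mv P}"
  show "bij_betw vanishing ?S {F. prime_filter fans F}"
    unfolding bij_betw_def
  proof
    show "inj_on vanishing ?S" by (rule inj_on_vanishing)
    show "vanishing ` ?S = {F. prime_filter fans F}"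
      using prime_filter_vanishing prime_ideal_of_filter by blast
  qed
  let ?B = "\<lambda>a. {Q \<in> ?S. a \<notin> vanishing Q}"
  let ?N = "\<lambda>U. \<forall>P\<in>U. \<exists>a\<in>fans. a \<notin> vanishing P \<and> ?B a \<subseteq> U"
  have B: "{P. mv_prime_ideal free_mv P \<and> cls t \<notin> P} = ?B (zeros t)" if "mv_vars t \<subseteq> I" for t
    using vanishing_iff[OF _ that] by (auto simp: mv_prime_ideal_def)
  have open_B: "openin (mv_Spec free_mv) (?B a)" if a: "a \<in> fans" for a
  proof -
    obtain t where t: "mv_vars t \<subseteq> I" "a = zeros t" using a by (auto simp: fans_iff)
    then have "cls t \<in> mv_carrier free_mv" by (auto simp: carrier_Free)
    then have "openin (mv_Spec free_mv) {P. mv_prime_ideal free_mv P \<and> cls t \<notin> P}"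
      unfolding mv_Spec_def by (intro topology_generated_by_Basis) blast
    then show ?thesis using B[OF t(1)] t(2) by simp
  qed
  fix U
  show "openin (mv_Spec free_mv) U \<longleftrightarrow> U \<subseteq> ?S \<and> ?N U"
  proof
    assume U: "openin (mv_Spec free_mv) U"
    then have "U \<subseteq> ?S" using openin_subset topspace_mv_Spec by metis
    moreover have "?N V \<and> V \<subseteq> ?S"
      if "generate_topology_on {{P. mv_prime_ideal free_mv P \<and> x \<notin> P} | x. x \<in> mv_carrier free_mv} V" for V
      using that
    proof (induction rule: generate_topology_on.induct)
      case Empty
      then show ?case by simp
    next
      case (Int U V)
      have "\<exists>c\<in>fans. c \<notin> vanishing P \<and> ?B c \<subseteq> U \<inter> V" if P: "P \<in> U \<inter> V" for P
      proof -
        obtain a b where ab: "a \<in> fans" "a \<notin> vanishing P" "?B a \<subseteq> U"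
            "b \<in> fans" "b \<notin> vanishing P" "?B b \<subseteq> V"
          using Int.IH P by blast
        have abL: "a \<union> b \<in> fans"
          using set_lattice_cylinder_m_fans[OF m, of I] ab by (simp add: set_lattice_def)
        have pf: "prime_filter fans (vanishing Q)" if "Q \<in> ?S" for Q
          using that prime_filter_vanishing by blast
        have "P \<in> ?S" using Int.IH P by blast
        then have "a \<union> b \<notin> vanishing P" using pf[of P] ab unfolding prime_filter_def by blast
        moreover have "?B (a \<union> b) \<subseteq> ?B a \<inter> ?B b"
        proof
          fix Q assume Q: "Q \<in> ?B (a \<union> b)"
          then have Q': "mv_prime_ideal free_mv Q" "a \<union> b \<notin> vanishing Q" by simp_all
          have "c \<notin> vanishing Q" if "c \<subseteq> a \<union> b" for c
            using pf[of Q] Q' abL that unfolding prime_filter_def by auto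
          then have "a \<notin> vanishing Q" "b \<notin> vanishing Q" by simp_all
          then show "Q \<in> ?B a \<inter> ?B b" using Q' by simp
        qed
        ultimately show ?thesis using abL ab(3,6) by blast
      qed
      then show ?case using Int.IH by blast
    next
      case (UN K)
      then show ?case by blast
    next
      case (Basis V)
      then obtain t where t: "mv_vars t \<subseteq> I" "V = {P. mv_prime_ideal free_mv P \<and> cls t \<notin> P}"
        by (auto simp: carrier_Free)
      have "zeros t \<in> fans" using t(1) by (auto simp: fans_iff)
      then show ?case unfolding t(2) B[OF t(1)] by blast
    qed
    ultimately show "U \<subseteq> ?S \<and> ?N U"
      using U unfolding mv_Spec_def openin_topology_generated_by_iff by blast
  next
    assume U: "U \<subseteq> ?S \<and> ?N U"
    show "openin (mv_Spec free_mv) U"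
    proof (subst openin_subopen, rule ballI)
      fix P assume P: "P \<in> U"
      then obtain a where a: "a \<in> fans" "a \<notin> vanishing P" "?B a \<subseteq> U" using U by blast
      have "P \<in> ?B a" using P U a(2) by blast
      then show "\<exists>T. openin (mv_Spec free_mv) T \<and> P \<in> T \<and> T \<subseteq> U" using open_B[OF a(1)] a(3) by blast
    qed
  qed
qed

end

theorem theorem10p2:
  fixes m :: nat and X :: "'a topology"
  assumes "m \<ge> 1"
  shows "(\<exists>I :: 'k set. X homeomorphic_space mv_Spec (Free m I))
         \<longleftrightarrow> m_fan_based TYPE('k) m X"
  unfolding m_fan_based_def
  using homeomorphic_iff_anti_isomorphic[OF set_lattice_cylinder_m_fans[OF assms]
      stone_map_vanishing[OF assms]]
  by blast

end
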